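(* Let $s,M\ge0$. Let $\varphi\in\mathcal{S}(\mathbb{R}^2)$ (Schwartz class) satisfy, for some $\delta>0$ and $\varsigma>2$, $|\widehat\varphi(\xi)|\lesssim\min(1,|\xi_1|^{\varsigma})e^{-\delta|\xi|^2}$ for all $\xi\in\mathbb{R}^2$, together with the covering condition of the context (for some window $\varphi_0$), and assume that $\varsigma>2s+2M-1/2$. Let $\Lambda\subseteq\mathbb{R}^2$ be a lattice, let $(x_0,\theta_0)\in\mathbb{R}^2\times[0,2\pi)$, and let $\{(k_j,\lambda_j):j\ge1\}$ be corresponding grid parameters (as defined in the context). If $f\in H^s_M(x_0,\theta_0)$, then $$\sum_{j\ge1}|\langle f,\varphi_{j,k_j,\lambda_j}\rangle|^2\,4^{2js}<+\infty.$$
   Context: Notation. $|x|$ is the Euclidean norm on $\mathbb{R}^2$. The Fourier transform is $\widehat f(\xi)=\int_{\mathbb{R}^2} f(x)e^{-2\pi i \xi\cdot x}\,dx$ (extended to tempered distributions). $\langle\cdot,\cdot\rangle$ denotes the (sesquilinear) pairing between $\mathcal{S}'$ and $\mathcal{S}$ extending the $L^2$ inner product. Let $$D_j=\begin{bmatrix}4^j&0\\0&2^j\end{bmatrix},\quad R_\theta=\begin{bmatrix}\cos\theta&-\sin\theta\\ \sin\theta&\cos\theta\end{bmatrix},\quad A_{j,k}=D_jR_{2k\pi/2^j},\quad B_{j,k}=(A_{j,k}^* )^{-1}.$$ A lattice is a set $\Lambda=P\mathbb{Z}^2$ with $P\in\mathbb{R}^{2\times2}$ invertible. Wavepackets: $\varphi_{j,k,\lambda}(x)=8^{j/2}\varphi(A_{j,k}x-\lambda)$.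 $X\lesssim Y$ means $X\le cY$ for a constant $c>0$. Covering condition (standing assumption of the paper): there are $\varphi_0\in L^2(\mathbb{R}^2)$ with $|\widehat{\varphi_0}(\xi)|\lesssim e^{-\delta|\xi|^2}$ and constants $0<A\le B<\infty$ with $A\le|\widehat{\varphi_0}(\xi)|^2+\sum_{j\ge1}\sum_{k=0}^{2^j-1}|\widehat\varphi(B_{j,k}\xi)|^2\le B$ for (almost) every $\xi$. Grid parameters: fix a constant $L_\Lambda$ depending on $\Lambda$ (the diameter of a fundamental domain), so that every point of $\mathbb{R}^2$ is at distance at most $L_\Lambda$ from $\Lambda$. Given $(x_0,\theta_0)$, for each $j\ge1$ choose $k_j\in\{0,\dots,2^j-1\}$ and $\lambda_j\in\Lambda$ with $$\frac{2\pi k_j}{2^j}\le2\pi-\theta_0\le\frac{2\pi(k_j+1)}{2^j},\qquad|A_{j,k_j}x_0-\lambda_j|\le L_\Lambda;$$ any such choice is allowed. Microlocal Sobolev spaces: for $\varepsilon>0$ let $V_\varepsilon=\{\xi\in\mathbb{R}^2:|\xi_2|\le\varepsilon|\xi_1|\}$. A distribution $f\in\mathcal{S}'(\mathbb{R}^2)$ belongs to $H^s_M(x_0,\theta_0)$ if there exist $\varepsilon>0$ and a smooth compactly supported function $\eta$ with $\eta\equiv1$ near $x_0$ such that $$\int_{R_{\theta_0}V_\varepsilon}|\widehat{\eta f}(\xi)|^2|\xi|^{2s}\,d\xi<+\infty\quad\text{and}\quad\int_{\mathbb{R}^2}|\widehat{\eta f}(\xi)|^2(1+|\xi|)^{-2M}\,d\xi<+\infty.$$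 *)

theory Defs
  imports "HOL-Analysis.Analysis"
begin

section \<open>Schwartz functions and tempered distributions on the plane\<close>

definition pderiv_dir :: "2 \<Rightarrow> (real^2 \<Rightarrow> complex) \<Rightarrow> real^2 \<Rightarrow> complex" where
  "pderiv_dir i f x = frechet_derivative f (at x) (axis i 1)"

text \<open>A list of indices serves as a multi-index: \<open>pderivs [i, j] f\<close> is the second-order
  derivative obtained by differentiating in direction \<open>j\<close> first.\<close>

fun pderivs :: "2 list \<Rightarrow> (real^2 \<Rightarrow> complex) \<Rightarrow> real^2 \<Rightarrow> complex" where
  "pderivs [] f = f"
| "pderivs (i # is) f = pderiv_dir i (pderivs is f)"

definition smooth :: "(real^2 \<Rightarrow> complex) \<Rightarrow> bool" where
  "smooth f \<longleftrightarrow> (\<forall>is x. pderivs is f differentiable at x)"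

definition schwartz :: "(real^2 \<Rightarrow> complex) set" where
  "schwartz = {f. smooth f \<and>
     (\<forall>is N. \<exists>C. \<forall>x. (1 + norm x) ^ N * cmod (pderivs is f x) \<le> C)}"

text \<open>The norms \<open>schwartz_norm 0 \<le> schwartz_norm 1 \<le> \<dots>\<close> generate the Frechet topology
  of the Schwartz space.  On Schwartz functions the supremum is over a bounded set.\<close>

definition schwartz_norm :: "nat \<Rightarrow> (real^2 \<Rightarrow> complex) \<Rightarrow> real" where
  "schwartz_norm N f =
     (SUP (is, x) \<in> {is. length is \<le> N} \<times> UNIV. (1 + norm x) ^ N * cmod (pderivs is f x))"

text \<open>Distributions are complex-linear functionals; their values outside \<^term>\<open>schwartz\<close>
  are irrelevant.\<close>

definition tempered_distribution :: "((real^2 \<Rightarrow> complex) \<Rightarrow> complex) \<Rightarrow> bool" where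
  "tempered_distribution u \<longleftrightarrow>
     (\<forall>\<phi>\<in>schwartz. \<forall>\<psi>\<in>schwartz. u (\<lambda>x. \<phi> x + \<psi> x) = u \<phi> + u \<psi>) \<and>
     (\<forall>c. \<forall>\<phi>\<in>schwartz. u (\<lambda>x. c * \<phi> x) = c * u \<phi>) \<and>
     (\<exists>N C. \<forall>\<phi>\<in>schwartz. cmod (u \<phi>) \<le> C * schwartz_norm N \<phi>)"

text \<open>The conjugate makes the pairing extend the inner product
  \<open>\<langle>f, \<phi>\<rangle> = \<integral> f(x) cnj (\<phi>(x)) dx\<close>, linear in the first argument.\<close>

definition pairing :: "((real^2 \<Rightarrow> complex) \<Rightarrow> complex) \<Rightarrow> (real^2 \<Rightarrow> complex) \<Rightarrow> complex" where
  "pairing u \<phi> = u (\<lambda>x. cnj (\<phi> x))"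

definition regular_dist :: "(real^2 \<Rightarrow> complex) \<Rightarrow> (real^2 \<Rightarrow> complex) \<Rightarrow> complex" where
  "regular_dist g \<psi> = (LINT x|lborel. g x * \<psi> x)"

definition mult_dist ::
  "(real^2 \<Rightarrow> complex) \<Rightarrow> ((real^2 \<Rightarrow> complex) \<Rightarrow> complex) \<Rightarrow> (real^2 \<Rightarrow> complex) \<Rightarrow> complex" where
  "mult_dist \<eta> u \<psi> = u (\<lambda>x. \<eta> x * \<psi> x)"

text \<open>The Bochner integral below is the Fourier transform for integrable functions only;
  all other functions are transformed through \<open>fourier_dist\<close>.\<close>

definition fourier :: "(real^2 \<Rightarrow> complex) \<Rightarrow> real^2 \<Rightarrow> complex" where
  "fourier f \<xi> = (LINT x|lborel. f x * exp (- 2 * of_real pi * \<i> * of_real (\<xi> \<bullet> x)))"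

definition fourier_dist ::
  "((real^2 \<Rightarrow> complex) \<Rightarrow> complex) \<Rightarrow> (real^2 \<Rightarrow> complex) \<Rightarrow> complex" where
  "fourier_dist u \<psi> = u (fourier \<psi>)"

text \<open>The distribution \<open>u\<close> is the function \<open>g\<close>, which is thereby determined almost everywhere.
  Integrability is required because the Bochner integral is \<open>0\<close> when it diverges.\<close>

definition dist_is_function ::
  "((real^2 \<Rightarrow> complex) \<Rightarrow> complex) \<Rightarrow> (real^2 \<Rightarrow> complex) \<Rightarrow> bool" where
  "dist_is_function u g \<longleftrightarrow> g \<in> borel_measurable borel \<and>
     (\<forall>\<psi>\<in>schwartz. integrable lborel (\<lambda>x. g x * \<psi> x) \<and> u \<psi> = regular_dist g \<psi>)"

section \<open>Wavepackets\<close>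

definition dil :: "nat \<Rightarrow> real^2^2" where
  "dil j = vector [vector [4 ^ j, 0], vector [0, 2 ^ j]]"

definition rot :: "real \<Rightarrow> real^2^2" where
  "rot \<theta> = vector [vector [cos \<theta>, - sin \<theta>], vector [sin \<theta>, cos \<theta>]]"

definition A_mat :: "nat \<Rightarrow> nat \<Rightarrow> real^2^2" where
  "A_mat j k = dil j ** rot (2 * real k * pi / 2 ^ j)"

definition B_mat :: "nat \<Rightarrow> nat \<Rightarrow> real^2^2" where
  "B_mat j k = matrix_inv (transpose (A_mat j k))"

definition wavepacket ::
  "(real^2 \<Rightarrow> complex) \<Rightarrow> nat \<Rightarrow> nat \<Rightarrow> real^2 \<Rightarrow> real^2 \<Rightarrow> complex" where
  "wavepacket \<phi> j k l x = of_real (8 powr (real j / 2)) * \<phi> (A_mat j k *v x - l)"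

definition is_lattice :: "(real^2) set \<Rightarrow> bool" where
  "is_lattice \<Lambda> \<longleftrightarrow>
     (\<exists>P :: real^2^2. invertible P \<and> \<Lambda> = (\<lambda>z. P *v z) ` {z. \<forall>i. z $ i \<in> \<int>})"

definition square_integrable :: "(real^2 \<Rightarrow> complex) \<Rightarrow> bool" where
  "square_integrable f \<longleftrightarrow>
     f \<in> borel_measurable borel \<and> integrable lborel (\<lambda>x. (cmod (f x))\<^sup>2)"

text \<open>The function \<open>h\<^sub>0\<close> is the Fourier transform of the square-integrable window \<open>\<phi>\<^sub>0\<close>, which
  need not be integrable.  The series is taken in \<^typ>\<open>ennreal\<close>, so that its
  convergence is part of the upper bound.\<close>

definition covering_condition :: "real \<Rightarrow> (real^2 \<Rightarrow> complex) \<Rightarrow> bool" where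
  "covering_condition \<delta> \<phi> \<longleftrightarrow>
     (\<exists>\<phi>\<^sub>0 h\<^sub>0 A B.
        square_integrable \<phi>\<^sub>0 \<and>
        dist_is_function (fourier_dist (regular_dist \<phi>\<^sub>0)) h\<^sub>0 \<and>
        (\<exists>c>0. AE \<xi> in lborel. cmod (h\<^sub>0 \<xi>) \<le> c * exp (- \<delta> * (norm \<xi>)\<^sup>2)) \<and>
        0 < A \<and> A \<le> B \<and>
        (AE \<xi> in lborel.
           (let S = ennreal ((cmod (h\<^sub>0 \<xi>))\<^sup>2) +
                    (\<Sum>\<^sub>\<infinity>j\<in>{1..}. \<Sum>k=0..2 ^ j - 1.
                       ennreal ((cmod (fourier \<phi> (B_mat j k *v \<xi>)))\<^sup>2))
            in ennreal A \<le> S \<and> S \<le> ennreal B)))"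

definition grid_parameters ::
  "(real^2) set \<Rightarrow> real \<Rightarrow> real^2 \<Rightarrow> real \<Rightarrow> (nat \<Rightarrow> nat) \<Rightarrow> (nat \<Rightarrow> real^2) \<Rightarrow> bool" where
  "grid_parameters \<Lambda> L x\<^sub>0 \<theta>\<^sub>0 k l \<longleftrightarrow>
     (\<forall>j\<ge>1. k j \<in> {0..2 ^ j - 1} \<and> l j \<in> \<Lambda> \<and>
        2 * pi * real (k j) / 2 ^ j \<le> 2 * pi - \<theta>\<^sub>0 \<and>
        2 * pi - \<theta>\<^sub>0 \<le> 2 * pi * (real (k j) + 1) / 2 ^ j \<and>
        norm (A_mat j (k j) *v x\<^sub>0 - l j) \<le> L)"

section \<open>Microlocal Sobolev spaces\<close>

definition cone_V :: "real \<Rightarrow> (real^2) set" where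
  "cone_V \<epsilon> = {\<xi>. \<bar>\<xi> $ 2\<bar> \<le> \<epsilon> * \<bar>\<xi> $ 1\<bar>}"

definition microlocal_sobolev ::
  "real \<Rightarrow> real \<Rightarrow> real^2 \<Rightarrow> real \<Rightarrow> ((real^2 \<Rightarrow> complex) \<Rightarrow> complex) set" where
  "microlocal_sobolev s M x\<^sub>0 \<theta>\<^sub>0 =
     {f. tempered_distribution f \<and>
        (\<exists>\<epsilon>>0. \<exists>\<eta> g.
           smooth \<eta> \<and> compact (closure {x. \<eta> x \<noteq> 0}) \<and> (\<forall>\<^sub>F x in nhds x\<^sub>0. \<eta> x = 1) \<and>
           dist_is_function (fourier_dist (mult_dist \<eta> f)) g \<and>
           (\<integral>\<^sup>+\<xi>\<in>(\<lambda>\<zeta>. rot \<theta>\<^sub>0 *v \<zeta>) ` cone_V \<epsilon>.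
              ennreal ((cmod (g \<xi>))\<^sup>2 * norm \<xi> powr (2 * s)) \<partial>lborel) < \<infinity> \<and>
           (\<integral>\<^sup>+\<xi>. ennreal ((cmod (g \<xi>))\<^sup>2 * (1 + norm \<xi>) powr (- 2 * M)) \<partial>lborel) < \<infinity>)}"

end

theory Submission
  imports Defs "HOL-Probability.Probability"
begin

text \<open>Write \<open>w\<close> for the wavepacket at scale \<open>j\<close> and split
  \<open>\<langle>f, w\<rangle> = \<langle>\<eta>f, w\<rangle> + \<langle>(1 - \<eta>)f, w\<rangle>\<close>. The packet concentrates at \<open>x\<^sub>0\<close>, where \<open>1 - \<eta>\<close> vanishes,
  so the second term decays faster than every power of \<open>2 ^ j\<close>. By Fourier inversion the first term
  is the integral of \<open>g\<close> against the conjugate of the Fourier transform of \<open>w\<close>, where \<open>g\<close> is the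
  Fourier transform of \<open>\<eta>f\<close>. Over the cone, Cauchy--Schwarz with the
  weight \<open>exp (- \<delta> \<bar>B\<xi>\<bar>\<^sup>2)\<close> reduces the claim to the pointwise bound
  \<open>(\<Sum>j. 4 powr (2 j s) * profile \<sigma> \<delta> (\<bar>\<xi>\<bar> / 4 ^ j)) \<le> D \<bar>\<xi>\<bar> powr (2 s)\<close>, where \<open>\<sigma> > s\<close> suffices. Off the cone
  \<open>\<bar>B\<xi>\<bar> \<ge> \<kappa> \<bar>\<xi>\<bar> / 2 ^ j\<close> for large \<open>j\<close>, so the Gaussian factor confines \<open>\<bar>\<xi>\<bar>\<close> to size about \<open>2 ^ j\<close>, and the
  vanishing of order \<open>\<sigma>\<close> gives terms of order \<open>2 powr (j (4 s + 2 M - 2 \<sigma> - 1))\<close>.\<close>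

section \<open>Schwartz functions and multipliers\<close>

text \<open>The squared transform of a packet carries the factor \<open>1 / 8 ^ j\<close>. Over the
  cone it cancels exactly against the integral of the Gaussian weight, which is
  \<open>8 ^ j * (pi / \<delta>)\<close>, so no power of \<open>2 ^ j\<close> is lost there. Off the
  cone the Gaussian has width of order \<open>2 ^ j\<close> and area of order \<open>4 ^ j\<close>,
  which leaves \<open>2 powr (- j)\<close>; the bound on \<open>g\<close> with weight
  \<open>M\<close> costs \<open>2 powr (2 * M * j)\<close>, the vanishing gains
  \<open>2 powr (- 2 * \<sigma> * j)\<close> and the summation weight costs
  \<open>2 powr (4 * s * j)\<close>. These four factors make up the exponent. The tail is shaped by
  another obstacle: a tempered distribution is controlled by a seminorm of unknown order, so all
  derivatives of the cut-off packets have to be bounded uniformly in \<open>j\<close>. Hence the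
  work with whole families of functions that are closed under differentiation. Since
  \<open>g\<close> is known only through its action on Schwartz functions, the bound for \<eta>f
  needs the Schwartz class to be stable under the Fourier transform, and inversion on it; both are
  derived here from affine changes of variables and one explicit Gaussian.\<close>

lemma pderiv_dir_eqI: "(f has_derivative f') (at x) \<Longrightarrow> pderiv_dir i f x = f' (axis i 1)"
  unfolding pderiv_dir_def using frechet_derivative_at by metis

lemma pderivs_mem:
  assumes "f \<in> S" "\<And>h i. h \<in> S \<Longrightarrow> pderiv_dir i h \<in> S"
  shows "pderivs is f \<in> S"
  by (induction "is") (use assms in auto)

text \<open>The recursion adds the outermost derivative at the front of the list. Stability of a
  class under \<open>pderiv_dir\<close> needs the other end, where the innermost derivative is split
  off.\<close>

lemma pderivs_snoc: "pderivs (is @ [i]) f = pderivs is (pderiv_dir i f)"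
  by (induction "is") auto

text \<open>The definition quantifies over all iterated derivatives. A set that is stable under
  first derivatives contains them all, so differentiability and decay need to be checked only for
  its members, and no Leibniz or chain formula of higher order is ever written down.\<close>

lemma schwartz_coinduct:
  assumes "f \<in> S" "\<And>h i. h \<in> S \<Longrightarrow> pderiv_dir i h \<in> S"
    and "\<And>h x. h \<in> S \<Longrightarrow> h differentiable at x"
    and "\<And>h N. h \<in> S \<Longrightarrow> \<exists>C. \<forall>x. (1 + norm x) ^ N * cmod (h x) \<le> C"
  shows "f \<in> schwartz"
proof -
  have "pderivs is f \<in> S" for "is"
    by (rule pderivs_mem) (use assms(1,2) in auto)
  then show ?thesis
    unfolding schwartz_def smooth_def using assms(3,4) by blast
qed

lemma schwartz_pderiv_dir: "\<psi> \<in> schwartz \<Longrightarrow> pderiv_dir i \<psi> \<in> schwartz"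
  unfolding schwartz_def smooth_def by (auto simp flip: pderivs_snoc)

lemma schwartz_differentiable: "\<psi> \<in> schwartz \<Longrightarrow> \<psi> differentiable at x"
  unfolding schwartz_def smooth_def by (metis (mono_tags, lifting) mem_Collect_eq pderivs.simps(1))

lemma schwartz_decay: "\<psi> \<in> schwartz \<Longrightarrow> \<exists>C\<ge>0. \<forall>x. (1 + norm x) ^ N * cmod (\<psi> x) \<le> C"
proof -
  assume "\<psi> \<in> schwartz"
  then have "\<forall>is N. \<exists>C. \<forall>x. (1 + norm x) ^ N * cmod (pderivs is \<psi> x) \<le> C"
    by (simp add: schwartz_def)
  then obtain C where C: "\<And>x. (1 + norm x) ^ N * cmod (\<psi> x) \<le> C"
    by (metis pderivs.simps(1))
  have "0 \<le> (1 + norm (0::real^2)) ^ N * cmod (\<psi> 0)" by simp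
  also have "\<dots> \<le> C" by (rule C)
  finally show ?thesis using C by blast
qed

lemma schwartz_decay_div:
  assumes "\<psi> \<in> schwartz"
  obtains C where "C \<ge> 0" "\<And>x. cmod (\<psi> x) \<le> C / (1 + norm x) ^ N"
proof -
  from schwartz_decay[OF assms, of N] obtain C where
    C: "C \<ge> 0" "\<And>x. (1 + norm x) ^ N * cmod (\<psi> x) \<le> C" by blast
  have "0 < (1 + norm x) ^ N" for x :: "real^2"
    by (intro zero_less_power add_pos_nonneg) auto
  then have "cmod (\<psi> x) \<le> C / (1 + norm x) ^ N" for x
    using C(2)[of x] by (simp add: pos_le_divide_eq mult.commute)
  with C(1) show ?thesis using that by blast
qed

text \<open>The multiplier space of the Schwartz class, usually called O_M: the degree
  \<open>N\<close> may depend on the derivative.\<close>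

definition slowly_growing :: "(real^2 \<Rightarrow> complex) set" where
  "slowly_growing = {f. smooth f \<and>
     (\<forall>is. \<exists>N C. \<forall>x. cmod (pderivs is f x) \<le> C * (1 + norm x) ^ N)}"

lemma slowly_growing_coinduct:
  assumes "f \<in> S" "\<And>h i. h \<in> S \<Longrightarrow> pderiv_dir i h \<in> S"
    and "\<And>h x. h \<in> S \<Longrightarrow> h differentiable at x"
    and "\<And>h. h \<in> S \<Longrightarrow> \<exists>N C. \<forall>x. cmod (h x) \<le> C * (1 + norm x) ^ N"
  shows "f \<in> slowly_growing"
proof -
  have "pderivs is f \<in> S" for "is"
    by (rule pderivs_mem) (use assms(1,2) in auto)
  then show ?thesis
    unfolding slowly_growing_def smooth_def using assms(3,4) by blast
qed

lemma slowly_growing_pderiv_dir: "\<psi> \<in> slowly_growing \<Longrightarrow> pderiv_dir i \<psi> \<in> slowly_growing"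
  unfolding slowly_growing_def smooth_def by (auto simp flip: pderivs_snoc)

lemma slowly_growing_differentiable: "\<psi> \<in> slowly_growing \<Longrightarrow> \<psi> differentiable at x"
  unfolding slowly_growing_def smooth_def
  by (metis (mono_tags, lifting) mem_Collect_eq pderivs.simps(1))

lemma slowly_growing_bound:
  assumes "\<eta> \<in> slowly_growing"
  obtains N C where "C \<ge> 0" "\<And>x. cmod (\<eta> x) \<le> C * (1 + norm x) ^ N"
proof -
  have "\<forall>is. \<exists>N C. \<forall>x. cmod (pderivs is \<eta> x) \<le> C * (1 + norm x) ^ N"
    using assms by (simp add: slowly_growing_def)
  then obtain N C where C: "\<And>x. cmod (\<eta> x) \<le> C * (1 + norm x) ^ N"
    by (metis pderivs.simps(1))
  have "0 \<le> cmod (\<eta> 0)" by simp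
  also have "\<dots> \<le> C * (1 + norm (0::real^2)) ^ N" by (rule C)
  finally have "C \<ge> 0" by simp
  then show ?thesis using C that by blast
qed

lemma pderiv_dir_const: "pderiv_dir i (\<lambda>x. c) = (\<lambda>x. 0)"
  by (intro ext pderiv_dir_eqI[where f' = "\<lambda>x. 0"]) auto

lemma slowly_growing_const: "(\<lambda>x. c) \<in> slowly_growing"
proof (rule slowly_growing_coinduct[where S = "range (\<lambda>c x. c)"])
  fix h :: "real^2 \<Rightarrow> complex" assume "h \<in> range (\<lambda>c x. c)"
  then obtain c where h: "h = (\<lambda>x. c)" by auto
  show "pderiv_dir i h \<in> range (\<lambda>c x. c)" for i
    by (simp add: h pderiv_dir_const)
  show "h differentiable at x" for x by (simp add: h)
  have "cmod (h x) \<le> cmod c * (1 + norm x) ^ 0" for x by (simp add: h)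
  then show "\<exists>N C. \<forall>x. cmod (h x) \<le> C * (1 + norm x) ^ N" by blast
qed auto

lemma pderiv_dir_coord: "pderiv_dir i (\<lambda>x. of_real (x $ m)) = (\<lambda>x. of_real (axis i 1 $ m))"
proof (intro ext pderiv_dir_eqI[where f' = "\<lambda>h. of_real (h $ m)"])
  fix x :: "real^2"
  have "bounded_linear (\<lambda>h::real^2. complex_of_real (h $ m))"
    by (intro bounded_linear_compose[OF bounded_linear_of_real] bounded_linear_vec_nth)
  then show "((\<lambda>x. complex_of_real (x $ m)) has_derivative (\<lambda>h. complex_of_real (h $ m))) (at x)"
    by (rule bounded_linear_imp_has_derivative)
qed

lemma slowly_growing_coord: "(\<lambda>x. of_real (x $ m)) \<in> slowly_growing"
proof (rule slowly_growing_coinduct[where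
      S = "insert (\<lambda>x. of_real (x $ m)) slowly_growing"])
  fix h :: "real^2 \<Rightarrow> complex"
  let ?X = "\<lambda>x::real^2. complex_of_real (x $ m)"
  assume h: "h \<in> insert ?X slowly_growing"
  show "pderiv_dir i h \<in> insert ?X slowly_growing" for i
    using h by (auto simp: pderiv_dir_coord slowly_growing_const slowly_growing_pderiv_dir)
  have "bounded_linear ?X"
    by (intro bounded_linear_compose[OF bounded_linear_of_real] bounded_linear_vec_nth)
  then have "?X differentiable at x" for x
    using bounded_linear_imp_has_derivative differentiableI by blast
  then show "h differentiable at x" for x
    using h slowly_growing_differentiable by blast
  have "cmod (?X x) \<le> 1 * (1 + norm x) ^ 1" for x
    using component_le_norm_cart[of x m] by simp
  then show "\<exists>N C. \<forall>x. cmod (h x) \<le> C * (1 + norm x) ^ N"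
    using h by (elim insertE) (blast, metis slowly_growing_bound)
qed auto

text \<open>Spans of products of multipliers in \<open>T\<close> with affine images of Schwartz functions, as families
  indexed by the scale \<open>j\<close>; the coefficients may grow geometrically, as the
  differentiation of a wavepacket produces powers of \<open>4 ^ j\<close>.\<close>

inductive_set packet_span ::
  "(real^2 \<Rightarrow> complex) set \<Rightarrow> (nat \<Rightarrow> real^2^2) \<Rightarrow> (nat \<Rightarrow> real^2) \<Rightarrow>
    (nat \<Rightarrow> real^2 \<Rightarrow> complex) set"
  for T A l where
  prod: "\<lbrakk>\<eta> \<in> T; \<psi> \<in> schwartz; \<exists>K\<ge>1. \<forall>j. cmod (c j) \<le> K ^ Suc j\<rbrakk> \<Longrightarrow>
    (\<lambda>j x. c j * (\<eta> x * \<psi> (A j *v x - l j))) \<in> packet_span T A l"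
| add: "\<lbrakk>F \<in> packet_span T A l; G \<in> packet_span T A l\<rbrakk> \<Longrightarrow>
    (\<lambda>j x. F j x + G j x) \<in> packet_span T A l"

section \<open>Differentiation and decay of packet families\<close>

lemma has_derivative_affine_comp:
  fixes A :: "real^2^2" and \<psi> :: "real^2 \<Rightarrow> complex"
  assumes "\<psi> differentiable at (A *v x - l)"
  shows "((\<lambda>x. \<psi> (A *v x - l)) has_derivative
    (\<lambda>h. frechet_derivative \<psi> (at (A *v x - l)) (A *v h))) (at x)"
proof -
  have 1: "((\<lambda>x. A *v x - l) has_derivative (\<lambda>h. A *v h)) (at x)"
    by (auto intro!: derivative_eq_intros bounded_linear_imp_has_derivative matrix_vector_mul_bounded_linear)
  have 2: "(\<psi> has_derivative frechet_derivative \<psi> (at (A *v x - l))) (at (A *v x - l))"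
    using assms frechet_derivative_works by blast
  show ?thesis using has_derivative_compose[OF 1 2] by simp
qed

lemma frechet_derivative_eq_pderiv_dir:
  fixes \<psi> :: "real^2 \<Rightarrow> complex"
  assumes "\<psi> differentiable at y"
  shows "frechet_derivative \<psi> (at y) h =
    of_real (h $ 1) * pderiv_dir 1 \<psi> y + of_real (h $ 2) * pderiv_dir 2 \<psi> y"
proof -
  have lin: "linear (frechet_derivative \<psi> (at y))"
    using assms linear_frechet_derivative by blast
  have "h = (h $ 1) *\<^sub>R axis 1 1 + (h $ 2) *\<^sub>R axis 2 1"
    by (simp add: vec_eq_iff forall_2 axis_def)
  then have "frechet_derivative \<psi> (at y) h =
      (h $ 1) *\<^sub>R frechet_derivative \<psi> (at y) (axis 1 1) +
      (h $ 2) *\<^sub>R frechet_derivative \<psi> (at y) (axis 2 1)"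
    using lin by (metis (no_types, lifting) linear_add linear_cmul)
  then show ?thesis by (simp add: pderiv_dir_def scaleR_conv_of_real)
qed

lemma matrix_vector_mult_axis: "(A *v axis i 1) $ m = (A $ m $ i :: real)"
  by (simp add: matrix_vector_mult_basis column_def)

lemma packet_deriv:
  fixes A :: "real^2^2" and \<psi> :: "real^2 \<Rightarrow> complex"
  assumes "\<And>x. \<psi> differentiable at x" and "\<And>x. \<eta> differentiable at x"
  shows "(\<lambda>x. c * (\<eta> x * \<psi> (A *v x - l))) differentiable at x" (is ?th1)
    and "pderiv_dir i (\<lambda>x. c * (\<eta> x * \<psi> (A *v x - l))) x =
      c * (pderiv_dir i \<eta> x * \<psi> (A *v x - l)) +
      ((c * of_real (A $ 1 $ i)) * (\<eta> x * pderiv_dir 1 \<psi> (A *v x - l)) +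
       (c * of_real (A $ 2 $ i)) * (\<eta> x * pderiv_dir 2 \<psi> (A *v x - l)))" (is ?th2)
proof -
  have 1: "((\<lambda>x. c * (\<eta> x * \<psi> (A *v x - l))) has_derivative
      (\<lambda>h. c * (\<eta> x * frechet_derivative \<psi> (at (A *v x - l)) (A *v h) +
         frechet_derivative \<eta> (at x) h * \<psi> (A *v x - l)))) (at x)"
    using assms frechet_derivative_works
    by (intro has_derivative_mult_right has_derivative_mult has_derivative_affine_comp) blast+
  show ?th1 using 1 differentiableI by blast
  show ?th2
    unfolding pderiv_dir_eqI[OF 1] frechet_derivative_eq_pderiv_dir[OF assms(1)]
      matrix_vector_mult_axis
    by (simp add: pderiv_dir_def[of i] algebra_simps)
qed

text \<open>The chain rule brings out entries of \<open>A j\<close>, which are absorbed in the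
  coefficients because a product of two geometric bounds is again geometric. With the exponent
  \<open>Suc j\<close> in place of \<open>j\<close>, the bound still admits arbitrary constants at
  \<open>j = 0\<close>.\<close>

lemma packet_span_deriv:
  assumes F: "F \<in> packet_span T A l"
    and T: "T \<subseteq> slowly_growing" "\<And>\<eta> i. \<eta> \<in> T \<Longrightarrow> pderiv_dir i \<eta> \<in> T"
    and A: "K \<ge> 1" "\<And>j m i. \<bar>A j $ m $ i\<bar> \<le> K ^ Suc j"
  shows "(\<forall>j x. F j differentiable at x) \<and>
    (\<lambda>j. pderiv_dir i (F j)) \<in> packet_span T A l"
  using F
proof induction
  case (prod \<eta> \<psi> c)
  have d: "\<And>x. \<psi> differentiable at x" "\<And>x. \<eta> differentiable at x"
    using prod T schwartz_differentiable slowly_growing_differentiable by blast+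
  obtain K' where K': "K' \<ge> 1" "\<And>j. cmod (c j) \<le> K' ^ Suc j" using prod by blast
  have "cmod (c j * of_real (A j $ m $ i)) \<le> (K' * K) ^ Suc j" for j m
    unfolding norm_mult power_mult_distrib using K' A by (intro mult_mono) auto
  moreover have "K' * K \<ge> 1" using K' A mult_mono[of 1 K' 1 K] by simp
  ultimately have "\<exists>K\<ge>1. \<forall>j. cmod (c j * of_real (A j $ m $ i)) \<le> K ^ Suc j" for m
    by blast
  then have "(\<lambda>j x. c j * (pderiv_dir i \<eta> x * \<psi> (A j *v x - l j)) +
      ((c j * of_real (A j $ 1 $ i)) * (\<eta> x * pderiv_dir 1 \<psi> (A j *v x - l j)) +
       (c j * of_real (A j $ 2 $ i)) * (\<eta> x * pderiv_dir 2 \<psi> (A j *v x - l j)))) \<in> packet_span T A l"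
    using prod T by (intro packet_span.intros schwartz_pderiv_dir) auto
  moreover have "(\<lambda>j. pderiv_dir i (\<lambda>x. c j * (\<eta> x * \<psi> (A j *v x - l j)))) =
    (\<lambda>j x. c j * (pderiv_dir i \<eta> x * \<psi> (A j *v x - l j)) +
      ((c j * of_real (A j $ 1 $ i)) * (\<eta> x * pderiv_dir 1 \<psi> (A j *v x - l j)) +
       (c j * of_real (A j $ 2 $ i)) * (\<eta> x * pderiv_dir 2 \<psi> (A j *v x - l j))))"
    by (intro ext packet_deriv(2) d)
  ultimately show ?case
    using packet_deriv(1)[OF d] by simp
next
  case (add F G)
  have d: "\<And>j x. F j differentiable at x" "\<And>j x. G j differentiable at x"
    using add by auto
  have D: "((\<lambda>x. F j x + G j x) has_derivative
      (\<lambda>h. frechet_derivative (F j) (at x) h + frechet_derivative (G j) (at x) h)) (at x)" for j x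
    using d frechet_derivative_works by (intro has_derivative_add) blast+
  have "pderiv_dir i (\<lambda>x. F j x + G j x) x = pderiv_dir i (F j) x + pderiv_dir i (G j) x" for j x
    unfolding pderiv_dir_eqI[OF D] by (simp add: pderiv_dir_def)
  then have "(\<lambda>j. pderiv_dir i (\<lambda>x. F j x + G j x)) =
      (\<lambda>j x. pderiv_dir i (F j) x + pderiv_dir i (G j) x)"
    by (simp add: fun_eq_iff)
  with add show ?case by (auto intro: packet_span.add)
qed

text \<open>Where the multiplier lives, both \<open>2 ^ j\<close> and \<open>1 + norm x\<close> are
  at most a constant times \<open>1 + norm y\<close> with \<open>y = A j *v x - l j\<close>. Every
  loss is polynomial in these two quantities, so a sufficiently high order of decay of the Schwartz
  factor at \<open>y\<close> pays for all of them.\<close>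

lemma packet_span_decay:
  assumes F: "F \<in> packet_span T A l"
    and T: "T \<subseteq> slowly_growing" "\<And>\<eta> x. \<eta> \<in> T \<Longrightarrow> x \<notin> X \<Longrightarrow> \<eta> x = 0"
    and K: "\<And>j x. j \<in> J \<Longrightarrow> x \<in> X \<Longrightarrow> 2 ^ j \<le> K * (1 + norm (A j *v x - l j))"
      "\<And>j x. j \<in> J \<Longrightarrow> x \<in> X \<Longrightarrow> 1 + norm x \<le> K * (1 + norm (A j *v x - l j))"
  shows "\<exists>C. \<forall>j\<in>J. \<forall>x. (2 ^ j) ^ Q * ((1 + norm x) ^ N * cmod (F j x)) \<le> C"
  using F
proof induction
  case (prod \<eta> \<psi> c)
  have "\<eta> \<in> slowly_growing" using prod T by blast
  then obtain n C1 where C1: "C1 \<ge> 0" "\<And>x. cmod (\<eta> x) \<le> C1 * (1 + norm x) ^ n"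
    by (elim slowly_growing_bound) blast
  obtain K' where K': "K' \<ge> 1" "\<And>j. cmod (c j) \<le> K' ^ Suc j" using prod by blast
  \<comment> \<open>Turns geometric growth of the coefficients into a fixed power of
    \<open>2 ^ j\<close>.\<close>
  obtain m where m: "K' < 2 ^ m" using real_arch_pow[of 2 K'] by auto
  \<comment> \<open>The required order of decay: \<open>Q\<close> for the claimed gain,
    \<open>m\<close> for the coefficients, \<open>N\<close> for the weight and \<open>n\<close> for
    the growth of the multiplier.\<close>
  define P where "P = Q + (m + (N + n))"
  obtain C2 where C2: "C2 \<ge> 0" "\<And>x. (1 + norm x) ^ P * cmod (\<psi> x) \<le> C2"
    using schwartz_decay[OF prod(2), of P] by blast
  define C where "C = 2 ^ m * C1 * (\<bar>K\<bar> ^ P * C2)"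
  have C0: "C \<ge> 0" using C1 C2 by (simp add: C_def)
  have "(2 ^ j) ^ Q * ((1 + norm x) ^ N * cmod (c j * (\<eta> x * \<psi> (A j *v x - l j)))) \<le> C"
    if j: "j \<in> J" for j x
  proof (cases "x \<in> X")
    case True
    define y where "y = A j *v x - l j"
    have c: "cmod (c j) \<le> 2 ^ m * (2 ^ j) ^ m"
    proof -
      have "cmod (c j) \<le> (2 ^ m) ^ Suc j"
        using K'(2)[of j] power_mono[of K' "2 ^ m" "Suc j"] m K'(1) by linarith
      then show ?thesis by (simp add: power_mult[symmetric] mult.commute)
    qed
    have "K * (1 + norm y) > 0" using K(1)[OF j True] unfolding y_def
      by (meson less_le_trans zero_less_numeral zero_less_power)
    then have "K > 0" by (metis add_nonneg_nonneg norm_ge_zero not_less zero_le_one zero_less_mult_iff)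
    let ?z = "\<bar>K\<bar> * (1 + norm y)"
    have z: "2 ^ j \<le> ?z" "1 + norm x \<le> ?z" "?z \<ge> 0"
      using K[OF j True] \<open>K > 0\<close> by (auto simp: y_def)
    have "(2 ^ j) ^ Q * ((1 + norm x) ^ N * cmod (c j * (\<eta> x * \<psi> y))) =
      ((2 ^ j) ^ Q * (1 + norm x) ^ N * (cmod (c j) * cmod (\<eta> x))) * cmod (\<psi> y)"
      by (simp add: norm_mult)
    also have "\<dots> \<le> ((2 ^ j) ^ Q * (1 + norm x) ^ N *
        (2 ^ m * (2 ^ j) ^ m * (C1 * (1 + norm x) ^ n))) * cmod (\<psi> y)"
      using c C1 by (intro mult_right_mono mult_left_mono mult_mono) auto
    also have "\<dots> = 2 ^ m * C1 * ((2 ^ j) ^ Q * ((2 ^ j) ^ m * ((1 + norm x) ^ N * (1 + norm x) ^ n))) * cmod (\<psi> y)"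
      by (simp add: algebra_simps)
    also have "\<dots> \<le> 2 ^ m * C1 * (?z ^ Q * (?z ^ m * (?z ^ N * ?z ^ n))) * cmod (\<psi> y)"
      using z C1 by (intro mult_right_mono mult_left_mono mult_mono power_mono) auto
    also have "\<dots> = 2 ^ m * C1 * (\<bar>K\<bar> ^ P * ((1 + norm y) ^ P * cmod (\<psi> y)))"
      unfolding P_def power_add power_mult_distrib by (simp add: algebra_simps)
    also have "\<dots> \<le> C"
      unfolding C_def using C1 C2 by (intro mult_left_mono) auto
    finally show ?thesis unfolding y_def .
  next
    case False
    then have "\<eta> x = 0" using T(2) prod(1) by blast
    then show ?thesis using C0 by simp
  qed
  then show ?case by blast
next
  case (add F G)
  then obtain C D where C: "\<And>j x. j \<in> J \<Longrightarrow> (2 ^ j) ^ Q * ((1 + norm x) ^ N * cmod (F j x)) \<le> C"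
    and D: "\<And>j x. j \<in> J \<Longrightarrow> (2 ^ j) ^ Q * ((1 + norm x) ^ N * cmod (G j x)) \<le> D" by blast
  have "(2 ^ j) ^ Q * ((1 + norm x) ^ N * cmod (F j x + G j x)) \<le> C + D" if j: "j \<in> J" for j x
  proof -
    have "(2 ^ j) ^ Q * ((1 + norm x) ^ N * cmod (F j x + G j x)) \<le>
      (2 ^ j) ^ Q * ((1 + norm x) ^ N * (cmod (F j x) + cmod (G j x)))"
      by (intro mult_left_mono norm_triangle_ineq) auto
    also have "\<dots> \<le> C + D" using C[OF j, of x] D[OF j, of x] by (simp add: algebra_simps)
    finally show ?thesis .
  qed
  then show ?case by blast
qed

text \<open>For a single scale the constants may depend on \<open>j\<close>, so the decay lemma
  applies with \<open>J = {j}\<close>, \<open>X = UNIV\<close> and \<open>Q = 0\<close>;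
  invertibility of \<open>A j\<close> replaces any assumption on the supports.\<close>

lemma packet_span_schwartz:
  assumes F: "F \<in> packet_span T A l"
    and T: "T \<subseteq> slowly_growing" "\<And>\<eta> i. \<eta> \<in> T \<Longrightarrow> pderiv_dir i \<eta> \<in> T"
    and A: "K \<ge> 1" "\<And>j m i. \<bar>A j $ m $ i\<bar> \<le> K ^ Suc j" "invertible (A j)"
  shows "F j \<in> schwartz"
proof (rule schwartz_coinduct[where S = "(\<lambda>F. F j) ` packet_span T A l"])
  show "F j \<in> (\<lambda>F. F j) ` packet_span T A l" using F by blast
next
  fix h i assume "h \<in> (\<lambda>F. F j) ` packet_span T A l"
  then obtain F where F: "F \<in> packet_span T A l" "h = F j" by blast
  have "(\<lambda>j. pderiv_dir i (F j)) \<in> packet_span T A l"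
    using packet_span_deriv[OF F(1) T A(1,2)] by (rule conjunct2)
  then show "pderiv_dir i h \<in> (\<lambda>F. F j) ` packet_span T A l"
    unfolding F(2) by (rule rev_image_eqI) simp
next
  fix h x assume "h \<in> (\<lambda>F. F j) ` packet_span T A l"
  then obtain F where F: "F \<in> packet_span T A l" "h = F j" by blast
  show "h differentiable at x"
    using packet_span_deriv[OF F(1) T A(1,2)] unfolding F(2) by simp
next
  fix h N assume "h \<in> (\<lambda>F. F j) ` packet_span T A l"
  then obtain F where F: "F \<in> packet_span T A l" "h = F j" by blast
  obtain A' where A': "A' ** A j = mat 1" using A(3) unfolding invertible_def by blast
  obtain B where B: "B > 0" "\<And>x. norm (A' *v x) \<le> norm x * B"
    using bounded_linear.pos_bounded[OF matrix_vector_mul_bounded_linear[of A']] by blast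
  have x: "norm x \<le> B * norm (A j *v x)" for x
    using B(2)[of "A j *v x"] A' by (simp add: matrix_vector_mul_assoc mult.commute)
  \<comment> \<open>The first entry of the maximum serves the bound on \<open>2 ^ j\<close>, the
    second the bound on \<open>1 + norm x\<close>.\<close>
  define K where "K = max (2 ^ j) (1 + B * (1 + norm (l j)))"
  have 1: "2 ^ j \<le> K * (1 + norm (A j *v x - l j))" for x
  proof -
    have "2 ^ j \<le> K" "0 \<le> K" by (auto simp: K_def le_max_iff_disj)
    then have "2 ^ j * 1 \<le> K * (1 + norm (A j *v x - l j))" by (intro mult_mono) auto
    then show ?thesis by simp
  qed
  have 2: "1 + norm x \<le> K * (1 + norm (A j *v x - l j))" for x
  proof -
    have "norm (A j *v x) \<le> norm (A j *v x - l j) + norm (l j)"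
      by (metis diff_add_cancel norm_triangle_ineq)
    also have "\<dots> \<le> (1 + norm (l j)) * (1 + norm (A j *v x - l j))"
      by (simp add: algebra_simps)
    finally have "1 + norm x \<le> 1 + B * ((1 + norm (l j)) * (1 + norm (A j *v x - l j)))"
      using x[of x] B(1) order_trans mult_left_mono[of "norm (A j *v x)" _ B] by fastforce
    also have "\<dots> \<le> (1 + B * (1 + norm (l j))) * (1 + norm (A j *v x - l j))"
      by (simp add: algebra_simps)
    also have "\<dots> \<le> K * (1 + norm (A j *v x - l j))"
      by (intro mult_right_mono) (auto simp: K_def)
    finally show ?thesis .
  qed
  have "\<exists>C. \<forall>j\<in>{j}. \<forall>x. (2 ^ j) ^ 0 * ((1 + norm x) ^ N * cmod (F j x)) \<le> C"
    using packet_span_decay[OF F(1) T(1), of UNIV "{j}" K 0 N] 1 2 by blast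
  then show "\<exists>C. \<forall>x. (1 + norm x) ^ N * cmod (h x) \<le> C"
    using F(2) by simp
qed

text \<open>A single function is treated as a family that is constant in \<open>j\<close>.\<close>

lemma schwartz_mult_affine:
  assumes "\<eta> \<in> slowly_growing" "\<psi> \<in> schwartz" "invertible A"
  shows "(\<lambda>x. c * (\<eta> x * \<psi> (A *v x - l))) \<in> schwartz"
proof -
  define K where "K = 1 + norm A"
  have K: "K \<ge> 1" "\<bar>A $ m $ i\<bar> \<le> K" for m i
    using component_le_norm_cart[of "A $ m" i] Finite_Cartesian_Product.norm_nth_le[of A m] by (auto simp: K_def)
  have K2: "K \<le> K ^ Suc j" for j
    using K(1) by (simp add: mult_le_cancel_left1)
  have c: "\<exists>K\<ge>1. \<forall>j::nat. cmod c \<le> K ^ Suc j"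
  proof (intro exI conjI allI)
    show "cmod c \<le> (1 + cmod c) ^ Suc j" for j
      using power_increasing[of 1 "Suc j" "1 + cmod c"] by simp
  qed auto
  have "(\<lambda>j::nat. \<lambda>x. c * (\<eta> x * \<psi> (A *v x - l))) \<in> packet_span slowly_growing (\<lambda>j. A) (\<lambda>j. l)"
    by (rule packet_span.prod[where c = "\<lambda>_. c"]) (use assms c in auto)
  then show ?thesis
    by (rule packet_span_schwartz[where K = K])
       (use assms slowly_growing_pderiv_dir K K2 order_trans in blast)+
qed

lemma schwartz_affine:
  "\<psi> \<in> schwartz \<Longrightarrow> invertible A \<Longrightarrow> (\<lambda>x. c * \<psi> (A *v x - l)) \<in> schwartz"
  using schwartz_mult_affine[of "\<lambda>x. 1" \<psi> A c l] slowly_growing_const by simp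

lemma schwartz_mult:
  "\<eta> \<in> slowly_growing \<Longrightarrow> \<psi> \<in> schwartz \<Longrightarrow> (\<lambda>x. c * (\<eta> x * \<psi> x)) \<in> schwartz"
  using schwartz_mult_affine[of \<eta> \<psi> "mat 1" c 0] by (simp add: invertible_def)

lemma pderiv_dir_cnj:
  assumes "\<psi> differentiable at x"
  shows "pderiv_dir i (\<lambda>x. cnj (\<psi> x)) x = cnj (pderiv_dir i \<psi> x)"
    and "(\<lambda>x. cnj (\<psi> x)) differentiable at x"
proof -
  have 1: "((\<lambda>x. cnj (\<psi> x)) has_derivative (\<lambda>h. cnj (frechet_derivative \<psi> (at x) h))) (at x)"
    using assms frechet_derivative_works has_derivative_cnj by blast
  show "pderiv_dir i (\<lambda>x. cnj (\<psi> x)) x = cnj (pderiv_dir i \<psi> x)"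
    unfolding pderiv_dir_eqI[OF 1] by (simp add: pderiv_dir_def)
  show "(\<lambda>x. cnj (\<psi> x)) differentiable at x" using 1 differentiableI by blast
qed

lemma schwartz_cnj:
  assumes "\<psi> \<in> schwartz"
  shows "(\<lambda>x. cnj (\<psi> x)) \<in> schwartz"
proof (rule schwartz_coinduct[where S = "(\<lambda>\<psi> x. cnj (\<psi> x)) ` schwartz"])
  show "(\<lambda>x. cnj (\<psi> x)) \<in> (\<lambda>\<psi> x. cnj (\<psi> x)) ` schwartz" using assms by blast
  fix h :: "real^2 \<Rightarrow> complex" assume "h \<in> (\<lambda>\<psi> x. cnj (\<psi> x)) ` schwartz"
  then obtain \<psi> where h: "\<psi> \<in> schwartz" "h = (\<lambda>x. cnj (\<psi> x))" by blast
  have d: "\<psi> differentiable at x" for x using h schwartz_differentiable by blast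
  have "pderiv_dir i h = (\<lambda>x. cnj (pderiv_dir i \<psi> x))" for i
    using d by (simp add: fun_eq_iff h pderiv_dir_cnj)
  then show "pderiv_dir i h \<in> (\<lambda>\<psi> x. cnj (\<psi> x)) ` schwartz" for i
    using h schwartz_pderiv_dir by blast
  show "h differentiable at x" for x using d by (simp add: h pderiv_dir_cnj)
  show "\<exists>C. \<forall>x. (1 + norm x) ^ N * cmod (h x) \<le> C" for N
    using schwartz_decay[OF h(1), of N] by (auto simp: h)
qed

section \<open>Lebesgue integrals on the plane\<close>

lemma matrix_vector_mult_diff_measurable [measurable]:
  fixes A :: "real^2^2"
  shows "(\<lambda>x. A *v x - l) \<in> borel_measurable borel" "(\<lambda>x. A *v x) \<in> borel_measurable borel"
proof -
  have c: "continuous_on UNIV (\<lambda>x. A *v x)"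
    using matrix_vector_mul_bounded_linear[of A] linear_continuous_on by blast
  then show "(\<lambda>x. A *v x) \<in> borel_measurable borel"
    by (rule borel_measurable_continuous_onI)
  show "(\<lambda>x. A *v x - l) \<in> borel_measurable borel"
    using c by (intro borel_measurable_continuous_onI continuous_intros)
qed

text \<open>Change of variables as an identity of measures, from which the versions for both kinds
  of integrals follow. Lebesgue measure is characterised by its values on boxes, and these are
  computed from the determinant formula for linear images.\<close>

lemma lborel_matrix_affine:
  fixes A :: "real^2^2"
  assumes "A' ** A = mat 1" "A ** A' = mat 1"
  shows "lborel = density (distr lborel borel (\<lambda>x. A *v x - l)) (\<lambda>_. ennreal \<bar>det A\<bar>)"
proof (rule lborel_eqI)
  fix a b :: "real^2" assume ab: "\<And>i. i \<in> Basis \<Longrightarrow> a \<bullet> i \<le> b \<bullet> i"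
  define S where "S = box (a + l) (b + l)"
  have det: "det A' * det A = 1" using assms(1) det_mul[of A' A] by simp
  \<comment> \<open>The preimage of a box is rewritten as the image of a translated box under the
    inverse matrix, to which \<open>measure_linear_image\<close> applies.\<close>
  have pre: "(\<lambda>x. A *v x - l) -` box a b = (\<lambda>y. A' *v y) ` S"
  proof (intro equalityI subsetI)
    fix x assume "x \<in> (\<lambda>x. A *v x - l) -` box a b"
    then have "A *v x \<in> S" by (simp add: S_def mem_box algebra_simps less_diff_eq diff_less_eq)
    moreover have "x = A' *v (A *v x)" by (simp add: matrix_vector_mul_assoc assms)
    ultimately show "x \<in> (\<lambda>y. A' *v y) ` S" by blast
  next
    fix x assume "x \<in> (\<lambda>y. A' *v y) ` S"
    then obtain y where y: "y \<in> S" "x = A' *v y" by blast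
    then have "A *v x = y" by (simp add: matrix_vector_mul_assoc assms)
    then show "x \<in> (\<lambda>x. A *v x - l) -` box a b"
      using y by (simp add: S_def mem_box algebra_simps less_diff_eq diff_less_eq)
  qed
  have S: "S \<in> lmeasurable" by (simp add: S_def)
  have T: "(\<lambda>y. A' *v y) ` S \<in> lmeasurable"
    by (intro measurable_linear_image S matrix_vector_mul_linear)
  have "emeasure lborel ((\<lambda>y. A' *v y) ` S) = emeasure lebesgue ((\<lambda>y. A' *v y) ` S)"
    unfolding pre[symmetric]
    using measurable_sets[OF matrix_vector_mult_diff_measurable(1)[of A l], of "box a b"]
    by simp
  also have "\<dots> = ennreal (measure lebesgue ((\<lambda>y. A' *v y) ` S))"
    using T by (simp add: emeasure_eq_measure2)
  also have "\<dots> = ennreal (\<bar>det A'\<bar> * measure lebesgue S)"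
    using measure_linear_image[OF matrix_vector_mul_linear[of A'] S] by simp
  finally have e: "emeasure lborel ((\<lambda>y. A' *v y) ` S) = ennreal (\<bar>det A'\<bar> * measure lebesgue S)" .
  have mS: "measure lebesgue S = (\<Prod>i\<in>Basis. (b - a) \<bullet> i)"
    using ab unfolding S_def by (simp add: measure_lborel_box_eq inner_add_left)
  have "emeasure (density (distr lborel borel (\<lambda>x. A *v x - l)) (\<lambda>_. ennreal \<bar>det A\<bar>)) (box a b)
      = ennreal \<bar>det A\<bar> * emeasure lborel ((\<lambda>x. A *v x - l) -` box a b)"
    by (subst emeasure_density_const) (simp_all add: emeasure_distr)
  also have "\<dots> = ennreal (\<bar>det A\<bar> * (\<bar>det A'\<bar> * measure lebesgue S))"
    unfolding pre e by (simp add: ennreal_mult)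
  also have "\<bar>det A\<bar> * (\<bar>det A'\<bar> * measure lebesgue S) = \<bar>det A' * det A\<bar> * measure lebesgue S"
    by (simp add: abs_mult)
  also have "\<dots> = (\<Prod>i\<in>Basis. (b - a) \<bullet> i)" by (simp add: det mS)
  finally show "emeasure (density (distr lborel borel (\<lambda>x. A *v x - l)) (\<lambda>_. ennreal \<bar>det A\<bar>)) (box a b)
      = (\<Prod>i\<in>Basis. (b - a) \<bullet> i)"
    by simp
qed simp

lemma nn_integral_matrix_affine:
  fixes A :: "real^2^2"
  assumes A: "A' ** A = mat 1" "A ** A' = mat 1" and [measurable]: "f \<in> borel_measurable borel"
  shows "(\<integral>\<^sup>+x. f x \<partial>lborel) = ennreal \<bar>det A\<bar> * (\<integral>\<^sup>+x. f (A *v x - l) \<partial>lborel)"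
  by (subst lborel_matrix_affine[OF A, of l])
     (simp add: nn_integral_density nn_integral_distr nn_integral_cmult)

lemma integrable_matrix_affine:
  fixes A :: "real^2^2" and f :: "real^2 \<Rightarrow> complex"
  assumes A: "A' ** A = mat 1" "A ** A' = mat 1" and f: "integrable lborel f"
  shows "integrable lborel (\<lambda>x. f (A *v x - l))"
    and "(LINT x|lborel. f x) = of_real \<bar>det A\<bar> * (LINT x|lborel. f (A *v x - l))"
proof -
  have [measurable]: "f \<in> borel_measurable borel" using f by auto
  have det: "det A \<noteq> 0" using A(1) det_mul[of A' A] by auto
  have "integrable (density (distr lborel borel (\<lambda>x. A *v x - l)) (\<lambda>_. ennreal \<bar>det A\<bar>)) f"
    using f lborel_matrix_affine[OF A, of l] by simp
  then have "integrable (distr lborel borel (\<lambda>x. A *v x - l)) (\<lambda>x. \<bar>det A\<bar> *\<^sub>R f x)"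
    by (subst (asm) integrable_density) auto
  from integrable_scaleR_right[OF this, of "1 / \<bar>det A\<bar>"]
  have "integrable (distr lborel borel (\<lambda>x. A *v x - l)) f" using det by simp
  then show "integrable lborel (\<lambda>x. f (A *v x - l))"
    using integrable_distr[of "\<lambda>x. A *v x - l" lborel borel f] by simp
  show "(LINT x|lborel. f x) = of_real \<bar>det A\<bar> * (LINT x|lborel. f (A *v x - l))"
    by (subst lborel_matrix_affine[OF A, of l])
       (simp add: integral_density integral_distr scaleR_conv_of_real)
qed

section \<open>Gaussian integrals and integrability of Schwartz functions\<close>

lemma nn_integral_gaussian_real:
  assumes "d > 0"
  shows "(\<integral>\<^sup>+x. ennreal (exp (- d * x\<^sup>2)) \<partial>lborel) = ennreal (sqrt (pi / d))"
proof -
  \<comment> \<open>The standard deviation for which the normal density has exponent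
    \<open>- d * x\<^sup>2\<close>.\<close>
  define v where "v = 1 / sqrt (2 * d)"
  have v: "v > 0" "2 * v\<^sup>2 = 1 / d" using assms by (auto simp: v_def power_divide)
  have e: "exp (- d * x\<^sup>2) = sqrt (pi / d) * normal_density 0 v x" for x
  proof -
    have "2 * pi * v\<^sup>2 = pi * (2 * v\<^sup>2)" by simp
    also have "\<dots> = pi / d" unfolding v by simp
    finally show ?thesis unfolding normal_density_def v using assms by (simp add: mult.commute)
  qed
  have "(\<integral>\<^sup>+x. ennreal (normal_density 0 v x) \<partial>lborel) = 1"
    using integrable_normal_density[OF v(1)] integral_normal_density[OF v(1)]
    by (subst nn_integral_eq_integral) auto
  then show ?thesis
    using assms unfolding e by (simp add: ennreal_mult nn_integral_cmult)
qed

lemma exp_norm_square_prod: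
  fixes x :: "real^2"
  shows "exp (- d * (norm x)\<^sup>2) = (\<Prod>b\<in>Basis. exp (- d * (x \<bullet> b)\<^sup>2))"
proof -
  have "(norm x)\<^sup>2 = (\<Sum>b\<in>Basis. (x \<bullet> b)\<^sup>2)"
    unfolding power2_norm_eq_inner by (subst euclidean_inner) (simp add: power2_eq_square)
  then show ?thesis by (simp add: exp_sum[symmetric] sum_distrib_left sum_negf)
qed

lemma nn_integral_gaussian:
  assumes "d > 0"
  shows "(\<integral>\<^sup>+x. ennreal (exp (- d * (norm (x :: real^2))\<^sup>2)) \<partial>lborel) = ennreal (pi / d)"
proof -
  have "(\<integral>\<^sup>+x. ennreal (exp (- d * (norm (x :: real^2))\<^sup>2)) \<partial>lborel) =
      (\<integral>\<^sup>+x. (\<Prod>b\<in>Basis. ennreal (exp (- d * ((x :: real^2) \<bullet> b)\<^sup>2))) \<partial>lborel)"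
    unfolding exp_norm_square_prod by (simp add: prod_ennreal)
  also have "\<dots> = (\<Prod>b\<in>(Basis :: (real^2) set). \<integral>\<^sup>+x. ennreal (exp (- d * x\<^sup>2)) \<partial>lborel)"
    by (intro nn_integral_lborel_prod[where f = "\<lambda>b x. ennreal (exp (- d * x\<^sup>2))"]) auto
  also have "\<dots> = ennreal (sqrt (pi / d)) ^ 2"
    unfolding nn_integral_gaussian_real[OF assms] by simp
  also have "\<dots> = ennreal (pi / d)" using assms by (simp add: ennreal_power)
  finally show ?thesis .
qed

lemma integrable_gaussian:
  assumes "d > 0"
  shows "integrable lborel (\<lambda>x::real^2. exp (- d * (norm x)\<^sup>2))"
    and "(LINT x|lborel. exp (- d * (norm (x :: real^2))\<^sup>2)) = pi / d"
proof -
  have "has_bochner_integral lborel (\<lambda>x::real^2. exp (- d * (norm x)\<^sup>2)) (pi / d)"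
    by (rule has_bochner_integral_nn_integral) (use assms nn_integral_gaussian in auto)
  then show "integrable lborel (\<lambda>x::real^2. exp (- d * (norm x)\<^sup>2))"
    "(LINT x|lborel. exp (- d * (norm (x :: real^2))\<^sup>2)) = pi / d"
    by (auto simp: has_bochner_integral_iff)
qed

text \<open>The power 4 allows two powers per coordinate: the function is dominated by the product
  of \<open>inverse (1 + (x \<bullet> b)\<^sup>2)\<close> over the two coordinates, and this is
  integrable by Tonelli.\<close>

lemma integrable_inverse_power4:
  "integrable lborel (\<lambda>x::real^2. C / (1 + norm x) ^ 4)"
proof -
  have 1: "(\<integral>\<^sup>+x. ennreal (inverse (1 + x\<^sup>2)) \<partial>lborel) < \<infinity>"
    using integrable_inverse_1_plus_square
    by (simp add: set_integrable_def integrable_iff_bounded abs_inverse)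
  have "integrable lborel (\<lambda>x::real^2. 1 / (1 + norm x) ^ 4)"
  proof (rule integrableI_bounded)
    have "ennreal (norm (1 / (1 + norm x) ^ 4)) \<le> (\<Prod>b\<in>Basis. ennreal (inverse (1 + (x \<bullet> b)\<^sup>2)))" for x :: "real^2"
    proof -
      have "(\<Prod>b\<in>Basis. 1 + (x \<bullet> b)\<^sup>2) \<le> (\<Prod>b\<in>(Basis::(real^2) set). (1 + norm x)\<^sup>2)"
      proof (intro prod_mono conjI)
        fix b :: "real^2" assume "b \<in> Basis"
        then have "(x \<bullet> b)\<^sup>2 \<le> (norm x)\<^sup>2" using Basis_le_norm abs_le_square_iff by fastforce
        then show "1 + (x \<bullet> b)\<^sup>2 \<le> (1 + norm x)\<^sup>2" by (simp add: power2_sum add_increasing2)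
      qed auto
      also have "\<dots> = (1 + norm x) ^ 4" by (simp flip: power_mult)
      finally have "inverse ((1 + norm x) ^ 4) \<le> inverse (\<Prod>b\<in>Basis. 1 + (x \<bullet> b)\<^sup>2)"
        by (intro le_imp_inverse_le prod_pos) (auto intro: add_pos_nonneg)
      then have "norm (1 / (1 + norm x) ^ 4) \<le> (\<Prod>b\<in>Basis. inverse (1 + (x \<bullet> b)\<^sup>2))"
        by (simp add: prod_inversef[symmetric] o_def inverse_eq_divide prod_dividef)
      then show ?thesis
        by (subst prod_ennreal) (auto intro!: ennreal_leI)
    qed
    then have "(\<integral>\<^sup>+x. ennreal (norm (1 / (1 + norm (x::real^2)) ^ 4)) \<partial>lborel) \<le>
        (\<integral>\<^sup>+x. (\<Prod>b\<in>Basis. ennreal (inverse (1 + ((x::real^2) \<bullet> b)\<^sup>2))) \<partial>lborel)"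
      by (intro nn_integral_mono)
    also have "\<dots> = (\<Prod>b\<in>(Basis::(real^2) set). \<integral>\<^sup>+x. ennreal (inverse (1 + x\<^sup>2)) \<partial>lborel)"
      by (intro nn_integral_lborel_prod[where f = "\<lambda>b x. ennreal (inverse (1 + x\<^sup>2))"]) auto
    also have "\<dots> < \<infinity>" using 1 by (simp add: power_less_top_ennreal)
    finally show "(\<integral>\<^sup>+x. ennreal (norm (1 / (1 + norm (x::real^2)) ^ 4)) \<partial>lborel) < \<infinity>" .
  qed measurable
  from integrable_mult_right[OF this, of C] show ?thesis by simp
qed

lemma schwartz_measurable [measurable_dest]:
  "\<psi> \<in> schwartz \<Longrightarrow> \<psi> \<in> borel_measurable borel"
  using schwartz_differentiable differentiable_imp_continuous_within
  by (intro borel_measurable_continuous_onI continuous_at_imp_continuous_on) blast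

lemma schwartz_integrable:
  assumes "\<psi> \<in> schwartz"
  shows "integrable lborel \<psi>"
proof -
  obtain C where C: "C \<ge> 0" "\<And>x. cmod (\<psi> x) \<le> C / (1 + norm x) ^ 4"
    using schwartz_decay_div[OF assms] by blast
  show ?thesis
    by (rule Bochner_Integration.integrable_bound[OF integrable_inverse_power4[of C]])
       (use assms C schwartz_measurable in auto)
qed

text \<open>The second moment bounds the quadratic remainder when the Fourier transform is
  differentiated.\<close>

lemma schwartz_integrable_norm_square:
  assumes "\<psi> \<in> schwartz"
  shows "integrable lborel (\<lambda>x. (norm x)\<^sup>2 * cmod (\<psi> x))"
proof -
  obtain C where C: "C \<ge> 0" "\<And>x. (1 + norm x) ^ 6 * cmod (\<psi> x) \<le> C"
    using schwartz_decay[OF assms] by blast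
  have "(norm x)\<^sup>2 * cmod (\<psi> x) \<le> C / (1 + norm x) ^ 4" for x
  proof -
    have "(1 + norm x) ^ 4 * ((norm x)\<^sup>2 * cmod (\<psi> x)) \<le> (1 + norm x) ^ 4 * ((1 + norm x)\<^sup>2 * cmod (\<psi> x))"
      by (intro mult_left_mono mult_right_mono power_mono) auto
    also have "\<dots> = (1 + norm x) ^ 6 * cmod (\<psi> x)" by (simp flip: power_add mult.assoc)
    also have "\<dots> \<le> C" by (rule C)
    finally show ?thesis
      using zero_less_power[OF add_pos_nonneg[OF zero_less_one norm_ge_zero[of x]], of 4]
      by (simp add: pos_le_divide_eq mult.commute)
  qed
  moreover have [measurable]: "\<psi> \<in> borel_measurable borel" using assms by measurable
  ultimately show ?thesis
    by (intro Bochner_Integration.integrable_bound[OF integrable_inverse_power4[of C]])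
       (auto simp: C(1))
qed

section \<open>The Fourier transform of Schwartz functions\<close>

definition char_fun :: "real^2 \<Rightarrow> real^2 \<Rightarrow> complex" where
  "char_fun \<xi> x = exp (- 2 * of_real pi * \<i> * of_real (\<xi> \<bullet> x))"

lemma fourier_char_fun: "fourier f \<xi> = (LINT x|lborel. f x * char_fun \<xi> x)"
  by (simp add: fourier_def char_fun_def)

lemma cmod_char_fun [simp]: "cmod (char_fun \<xi> x) = 1"
  by (simp add: char_fun_def norm_exp_eq_Re)

lemma char_fun_add: "char_fun (\<xi> + \<eta>) x = char_fun \<xi> x * char_fun \<eta> x"
  "char_fun \<xi> (x + y) = char_fun \<xi> x * char_fun \<xi> y"
  by (simp_all add: char_fun_def inner_add_left inner_add_right exp_add[symmetric] algebra_simps)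

lemma char_fun_0 [simp]: "char_fun \<xi> 0 = 1"
  by (simp add: char_fun_def)

lemma char_fun_commute: "char_fun \<xi> x = char_fun x \<xi>"
  by (simp add: char_fun_def inner_commute)

lemma cnj_char_fun: "cnj (char_fun \<xi> x) = char_fun \<xi> (- x)"
  by (simp add: char_fun_def exp_cnj)

lemma char_fun_measurable [measurable]:
  "(\<lambda>x. char_fun \<xi> x) \<in> borel_measurable borel"
  unfolding char_fun_def by measurable

text \<open>Taylor remainder of the exponential. Being quadratic in both arguments, it serves the
  differentiation in frequency as well as the limit of difference quotients in space.\<close>

lemma char_fun_approx:
  "cmod (char_fun \<xi> x - 1 - (- 2 * of_real pi * \<i> * of_real (\<xi> \<bullet> x))) \<le> 2 * pi\<^sup>2 * (norm \<xi> * norm x)\<^sup>2"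
proof -
  let ?t = "- 2 * pi * (\<xi> \<bullet> x)"
  have "cmod (iexp ?t - (\<Sum>k\<le>1. (\<i> * of_real ?t) ^ k / fact k)) \<le> \<bar>?t\<bar> ^ Suc 1 / fact (Suc 1)"
    by (rule iexp_approx1)
  also have "\<bar>?t\<bar> ^ Suc 1 / fact (Suc 1) = 2 * pi\<^sup>2 * (\<xi> \<bullet> x)\<^sup>2"
    by (simp add: power2_eq_square abs_mult algebra_simps)
  also have "\<dots> \<le> 2 * pi\<^sup>2 * (norm \<xi> * norm x)\<^sup>2"
    using Cauchy_Schwarz_ineq2[of \<xi> x] by (intro mult_left_mono) (auto simp: abs_le_square_iff[symmetric])
  also have "iexp ?t - (\<Sum>k\<le>1. (\<i> * of_real ?t) ^ k / fact k) =
      char_fun \<xi> x - 1 - (- 2 * of_real pi * \<i> * of_real (\<xi> \<bullet> x))"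
    by (simp add: char_fun_def algebra_simps)
  finally show ?thesis .
qed

lemma integrable_mult_char_fun:
  assumes "integrable lborel f"
  shows "integrable lborel (\<lambda>x. f x * char_fun \<xi> x)"
  by (rule Bochner_Integration.integrable_bound[OF assms])
     (use assms in \<open>auto simp: norm_mult\<close>)

lemma cmod_fourier_le: "cmod (fourier f \<xi>) \<le> (LINT x|lborel. cmod (f x))"
  unfolding fourier_char_fun
  using integral_norm_bound[of lborel "\<lambda>x. f x * char_fun \<xi> x"] by (simp add: norm_mult)

text \<open>The assumption on \<open>B\<close> says that it is the inverse transpose of
  \<open>A\<close>, in a form that avoids \<open>matrix_inv\<close> and is used as it stands in the
  exponent of the kernel.\<close>

lemma fourier_affine:
  fixes A B :: "real^2^2"
  assumes A: "A' ** A = mat 1" "A ** A' = mat 1" and B: "\<And>\<xi> x. (B *v \<xi>) \<bullet> (A *v x) = \<xi> \<bullet> x"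
    and f: "integrable lborel f"
  shows "fourier (\<lambda>x. c * f (A *v x - l)) \<xi> =
    c * char_fun (B *v \<xi>) l / of_real \<bar>det A\<bar> * fourier f (B *v \<xi>)"
proof -
  define h where "h y = c * char_fun (B *v \<xi>) l * (f y * char_fun (B *v \<xi>) y)" for y
  have h: "integrable lborel h"
    unfolding h_def by (intro integrable_mult_right integrable_mult_char_fun f)
  have "c * f (A *v x - l) * char_fun \<xi> x = h (A *v x - l)" for x
  proof -
    have "char_fun \<xi> x = char_fun (B *v \<xi>) (l + (A *v x - l))" by (simp add: char_fun_def B)
    then show ?thesis unfolding char_fun_add h_def by simp
  qed
  then have 1: "fourier (\<lambda>x. c * f (A *v x - l)) \<xi> = (LINT x|lborel. h (A *v x - l))"
    by (simp add: fourier_char_fun)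
  have 2: "(LINT x|lborel. h x) = c * char_fun (B *v \<xi>) l * fourier f (B *v \<xi>)"
    by (simp add: h_def fourier_char_fun)
  have "det A \<noteq> 0" using A(1) det_mul[of A' A] by auto
  then show ?thesis
    using integrable_matrix_affine(2)[OF A h, of l] unfolding 1 2 by (simp add: field_simps)
qed

lemma fourier_translate:
  assumes "integrable lborel f"
  shows "fourier (\<lambda>x. f (x + a)) \<xi> = cnj (char_fun \<xi> a) * fourier f \<xi>"
  using fourier_affine[of "mat 1" "mat 1" "mat 1" f 1 "- a" \<xi>] assms
  by (simp add: cnj_char_fun)

section \<open>Differentiation against multiplication by coordinates\<close>

lemma schwartz_coord_mult: "\<psi> \<in> schwartz \<Longrightarrow> (\<lambda>x. c * (of_real (x $ m) * \<psi> x)) \<in> schwartz"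
  by (rule schwartz_mult[OF slowly_growing_coord])

text \<open>No dominated convergence is needed: the remainder of the kernel is integrated against
  \<psi>, and the finite second moment gives an error bound quadratic in the increment.\<close>

lemma has_derivative_fourier:
  assumes \<psi>: "\<psi> \<in> schwartz"
  shows "(fourier \<psi> has_derivative
    (\<lambda>h. of_real (h $ 1) * fourier (\<lambda>x. - 2 * of_real pi * \<i> * (of_real (x $ 1) * \<psi> x)) \<xi> +
         of_real (h $ 2) * fourier (\<lambda>x. - 2 * of_real pi * \<i> * (of_real (x $ 2) * \<psi> x)) \<xi>)) (at \<xi>)"
    (is "(_ has_derivative ?D) _")
proof -
  let ?\<psi> = "\<lambda>m x. - 2 * of_real pi * \<i> * (of_real (x $ m) * \<psi> x)"
  define K where "K = 2 * pi\<^sup>2 * (LINT x|lborel. (norm x)\<^sup>2 * cmod (\<psi> x))"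
  have int: "integrable lborel \<psi>" "integrable lborel (?\<psi> m)" for m
    using schwartz_integrable schwartz_coord_mult[OF \<psi>] \<psi> by blast+
  have D: "?D h = (LINT x|lborel. (\<psi> x * char_fun \<xi> x) * (- 2 * of_real pi * \<i> * of_real (h \<bullet> x)))"
    "integrable lborel (\<lambda>x. (\<psi> x * char_fun \<xi> x) * (- 2 * of_real pi * \<i> * of_real (h \<bullet> x)))" for h
  proof -
    have eq: "(\<psi> x * char_fun \<xi> x) * (- 2 * of_real pi * \<i> * of_real (h \<bullet> x)) =
       of_real (h $ 1) * (?\<psi> 1 x * char_fun \<xi> x) + of_real (h $ 2) * (?\<psi> 2 x * char_fun \<xi> x)" for x
      by (simp add: inner_vec_def sum_2 algebra_simps)
    have i: "integrable lborel (\<lambda>x. of_real (h $ m) * (?\<psi> m x * char_fun \<xi> x))" for m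
      by (intro integrable_mult_right integrable_mult_char_fun int)
    show "integrable lborel (\<lambda>x. (\<psi> x * char_fun \<xi> x) * (- 2 * of_real pi * \<i> * of_real (h \<bullet> x)))"
      unfolding eq by (intro Bochner_Integration.integrable_add i)
    show "?D h = (LINT x|lborel. (\<psi> x * char_fun \<xi> x) * (- 2 * of_real pi * \<i> * of_real (h \<bullet> x)))"
      unfolding eq Bochner_Integration.integral_add[OF i i] fourier_char_fun
      by (simp only: integral_mult_right_zero)
  qed
  have main: "cmod ((fourier \<psi> \<zeta> - fourier \<psi> \<xi>) - ?D (\<zeta> - \<xi>)) \<le> K * (norm (\<zeta> - \<xi>))\<^sup>2" for \<zeta>
  proof -
    define h where "h = \<zeta> - \<xi>"
    have z: "\<zeta> = \<xi> + h" by (simp add: h_def)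
    have "(fourier \<psi> \<zeta> - fourier \<psi> \<xi>) - ?D h =
      (LINT x|lborel. (\<psi> x * char_fun \<zeta> x - \<psi> x * char_fun \<xi> x) -
         (\<psi> x * char_fun \<xi> x) * (- 2 * of_real pi * \<i> * of_real (h \<bullet> x)))"
      unfolding fourier_char_fun[of \<psi>] D(1)
      by (simp only: Bochner_Integration.integral_diff Bochner_Integration.integrable_diff D(2)
            integrable_mult_char_fun int(1))
    also have "\<dots> = (LINT x|lborel. (\<psi> x * char_fun \<xi> x) *
         (char_fun h x - 1 - (- 2 * of_real pi * \<i> * of_real (h \<bullet> x))))"
      unfolding z char_fun_add by (simp add: algebra_simps)
    also have "cmod \<dots> \<le> (LINT x|lborel. 2 * pi\<^sup>2 * (norm h)\<^sup>2 * ((norm x)\<^sup>2 * cmod (\<psi> x)))"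
    proof (rule order_trans[OF integral_norm_bound integral_mono'])
      show "integrable lborel (\<lambda>x. 2 * pi\<^sup>2 * (norm h)\<^sup>2 * ((norm x)\<^sup>2 * cmod (\<psi> x)))"
        by (intro integrable_mult_right schwartz_integrable_norm_square \<psi>)
      fix x
      have "cmod (\<psi> x) * cmod (char_fun h x - 1 - (- 2 * of_real pi * \<i> * of_real (h \<bullet> x)))
        \<le> cmod (\<psi> x) * (2 * pi\<^sup>2 * (norm h * norm x)\<^sup>2)"
        by (intro mult_left_mono char_fun_approx) auto
      then show "norm ((\<psi> x * char_fun \<xi> x) *
         (char_fun h x - 1 - (- 2 * of_real pi * \<i> * of_real (h \<bullet> x))))
         \<le> 2 * pi\<^sup>2 * (norm h)\<^sup>2 * ((norm x)\<^sup>2 * cmod (\<psi> x))"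
        by (simp add: norm_mult power_mult_distrib mult_ac)
    qed auto
    also have "\<dots> = K * (norm h)\<^sup>2" by (simp add: K_def)
    finally show ?thesis unfolding h_def .
  qed
  show ?thesis
  proof (rule has_derivativeI_sandwich[where e = 1 and H = "\<lambda>\<zeta>. K * norm (\<zeta> - \<xi>)"])
    show "bounded_linear ?D"
      by (intro bounded_linear_add bounded_linear_mult_left[THEN bounded_linear_compose]
            bounded_linear_of_real[THEN bounded_linear_compose] bounded_linear_vec_nth)
    show "norm ((fourier \<psi> \<zeta> - fourier \<psi> \<xi>) - ?D (\<zeta> - \<xi>)) / norm (\<zeta> - \<xi>) \<le> K * norm (\<zeta> - \<xi>)"
      if "\<zeta> \<noteq> \<xi>" for \<zeta>
      using main[of \<zeta>] that by (simp add: pos_divide_le_eq power2_eq_square mult.assoc)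
    show "((\<lambda>\<zeta>. K * norm (\<zeta> - \<xi>)) \<longlongrightarrow> 0) (at \<xi>)"
      by (auto intro!: tendsto_eq_intros)
  qed auto
qed

lemma pderiv_dir_fourier:
  assumes "\<psi> \<in> schwartz"
  shows "pderiv_dir i (fourier \<psi>) = fourier (\<lambda>x. - 2 * of_real pi * \<i> * (of_real (x $ i) * \<psi> x))"
proof
  fix \<xi>
  have "i = 1 \<or> i = 2" using exhaust_2 by blast
  then show "pderiv_dir i (fourier \<psi>) \<xi> = fourier (\<lambda>x. - 2 * of_real pi * \<i> * (of_real (x $ i) * \<psi> x)) \<xi>"
    unfolding pderiv_dir_eqI[OF has_derivative_fourier[OF assms]] by (auto simp: axis_def)
qed

text \<open>Supplies the dominating function for difference quotients. By the mean value theorem the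
  increment is a derivative at a point at distance less than 1 from \<open>x\<close>; this changes
  \<open>1 + norm x\<close> by a factor of at most 2, whence 16 from the fourth power.\<close>

lemma schwartz_increment_bound:
  assumes "\<psi> \<in> schwartz"
  obtains C where "C \<ge> 0"
    "\<And>x t. 0 < t \<Longrightarrow> t \<le> 1 \<Longrightarrow> cmod (\<psi> (x + t *\<^sub>R axis i 1) - \<psi> x) \<le> t * (C / (1 + norm x) ^ 4)"
proof -
  let ?e = "axis i 1 :: real^2"
  obtain C where C: "C \<ge> 0" "\<And>x. cmod (pderiv_dir i \<psi> x) \<le> C / (1 + norm x) ^ 4"
    using schwartz_decay_div[OF schwartz_pderiv_dir[OF assms]] by blast
  have "cmod (\<psi> (x + t *\<^sub>R ?e) - \<psi> x) \<le> t * (16 * C / (1 + norm x) ^ 4)" if t: "0 < t" "t \<le> 1" for x t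
  proof -
    have d: "((\<lambda>s. \<psi> (x + s *\<^sub>R ?e)) has_derivative (\<lambda>s. s *\<^sub>R pderiv_dir i \<psi> (x + r *\<^sub>R ?e))) (at r)" for r
    proof -
      let ?D = "frechet_derivative \<psi> (at (x + r *\<^sub>R ?e))"
      have D: "(\<psi> has_derivative ?D) (at (x + r *\<^sub>R ?e))"
        using schwartz_differentiable[OF assms] frechet_derivative_works by blast
      have "((\<lambda>s. x + s *\<^sub>R ?e) has_derivative (\<lambda>s. s *\<^sub>R ?e)) (at r)"
        by (auto intro!: derivative_eq_intros)
      from has_derivative_compose[OF this D] show ?thesis
        using linear_cmul[OF has_derivative_linear[OF D]] by (simp add: pderiv_dir_def)
    qed
    have "continuous_on {0..t} (\<lambda>s. \<psi> (x + s *\<^sub>R ?e))"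
      using d has_derivative_continuous by (intro continuous_at_imp_continuous_on) blast
    from mvt_general[OF t(1) this, of "\<lambda>r s. s *\<^sub>R pderiv_dir i \<psi> (x + r *\<^sub>R ?e)"] d
    obtain r where r: "r \<in> {0<..<t}" "cmod (\<psi> (x + t *\<^sub>R ?e) - \<psi> x) \<le> cmod (t *\<^sub>R pderiv_dir i \<psi> (x + r *\<^sub>R ?e))"
      by auto
    let ?y = "x + r *\<^sub>R ?e"
    have "norm x \<le> norm ?y + norm (r *\<^sub>R ?e)"
      using norm_triangle_ineq4[of ?y "r *\<^sub>R ?e"] by simp
    moreover have "norm (r *\<^sub>R ?e) \<le> 1" using r t by simp
    moreover have "1 + a \<le> 2 * (1 + b)" if "a \<le> b + c" "c \<le> 1" "0 \<le> b" for a b c :: real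
      using that by simp
    ultimately have "1 + norm x \<le> 2 * (1 + norm ?y)" using norm_ge_zero by blast
    then have "(1 + norm x) ^ 4 \<le> (2 * (1 + norm ?y)) ^ 4" by (intro power_mono) auto
    then have n: "(1 + norm x) ^ 4 \<le> 16 * (1 + norm ?y) ^ 4" by (simp only: power_mult_distrib) simp
    have p: "0 < (1 + norm y) ^ 4" for y :: "real^2" by (intro zero_less_power add_pos_nonneg) auto
    have "C / (1 + norm ?y) ^ 4 \<le> 16 * C / (1 + norm x) ^ 4"
      using mult_left_mono[OF n C(1)] p[of x] p[of ?y] by (simp add: divide_simps mult_ac)
    then have "cmod (pderiv_dir i \<psi> ?y) \<le> 16 * C / (1 + norm x) ^ 4" using C(2)[of ?y] by linarith
    then show ?thesis using r(2) t mult_left_mono[of "cmod (pderiv_dir i \<psi> ?y)" _ t] by fastforce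
  qed
  then show ?thesis using that[of "16 * C"] C(1) by simp
qed

text \<open>Integration by parts, from the translation invariance of the Lebesgue measure.\<close>

lemma fourier_pderiv_dir:
  assumes \<psi>: "\<psi> \<in> schwartz"
  shows "fourier (pderiv_dir i \<psi>) \<xi> = 2 * of_real pi * \<i> * of_real (\<xi> $ i) * fourier \<psi> \<xi>"
proof (rule LIMSEQ_unique)
  let ?e = "axis i 1 :: real^2"
  define t :: "nat \<Rightarrow> real" where "t n = inverse (Suc n)" for n
  have t: "0 < t n" "t n \<le> 1" for n by (auto simp: t_def inverse_le_1_iff)
  have t0: "t \<longlonglongrightarrow> 0" unfolding t_def by (rule LIMSEQ_inverse_real_of_nat)
  \<comment> \<open>The integrals of these difference quotients are evaluated twice, and the lemma
    is the uniqueness of their limit. Dominated convergence gives the transform of the derivative;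
    shifting the increment onto the kernel gives a multiple of
    \<open>fourier \<psi> \<xi>\<close>.\<close>
  define s where "s n x = (1 / of_real (t n)) * (\<psi> (x + t n *\<^sub>R ?e) - \<psi> x) * char_fun \<xi> x" for n x
  obtain C where C: "C \<ge> 0"
    "\<And>x t. 0 < t \<Longrightarrow> t \<le> 1 \<Longrightarrow> cmod (\<psi> (x + t *\<^sub>R ?e) - \<psi> x) \<le> t * (C / (1 + norm x) ^ 4)"
    using schwartz_increment_bound[OF \<psi>, of i] by blast
  have [measurable]: "\<psi> \<in> borel_measurable borel" "pderiv_dir i \<psi> \<in> borel_measurable borel"
    using \<psi> schwartz_measurable schwartz_pderiv_dir by blast+
  show "(\<lambda>n. LINT x|lborel. s n x) \<longlonglongrightarrow> fourier (pderiv_dir i \<psi>) \<xi>"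
    unfolding fourier_char_fun
  proof (rule integral_dominated_convergence)
    show "integrable lborel (\<lambda>x::real^2. C / (1 + norm x) ^ 4)" by (rule integrable_inverse_power4)
    show "AE x in lborel. norm (s n x) \<le> C / (1 + norm x) ^ 4" for n
      using C(2)[OF t, of _ n] t[of n] by (auto simp: s_def norm_mult norm_divide pos_divide_le_eq mult.commute)
    show "AE x in lborel. (\<lambda>n. s n x) \<longlonglongrightarrow> pderiv_dir i \<psi> x * char_fun \<xi> x"
    proof (intro AE_I2)
      fix x
      let ?D = "frechet_derivative \<psi> (at x)"
      have D: "(\<psi> has_derivative ?D) (at x)"
        using schwartz_differentiable[OF \<psi>] frechet_derivative_works by blast
      then have l: "(\<lambda>h. norm (\<psi> (x + h) - \<psi> x - ?D h) / norm h) \<midarrow>0\<rightarrow> 0"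
        by (simp add: has_derivative_at)
      have ne: "t n *\<^sub>R ?e \<noteq> 0" for n using t[of n] by (simp add: axis_eq_0_iff)
      have "(\<lambda>n. t n *\<^sub>R ?e) \<longlonglongrightarrow> 0" using tendsto_scaleR[OF t0 tendsto_const[of ?e]] by simp
      then have "filterlim (\<lambda>n. t n *\<^sub>R ?e) (at 0) sequentially"
        using ne by (simp add: filterlim_at)
      from filterlim_compose[OF l this]
      have l2: "(\<lambda>n. norm (\<psi> (x + t n *\<^sub>R ?e) - \<psi> x - ?D (t n *\<^sub>R ?e)) / norm (t n *\<^sub>R ?e)) \<longlonglongrightarrow> 0" .
      have "norm (\<psi> (x + t n *\<^sub>R ?e) - \<psi> x - ?D (t n *\<^sub>R ?e)) / norm (t n *\<^sub>R ?e) =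
        norm ((1 / of_real (t n)) * (\<psi> (x + t n *\<^sub>R ?e) - \<psi> x) - pderiv_dir i \<psi> x)" for n
      proof -
        have "?D (t n *\<^sub>R ?e) = of_real (t n) * pderiv_dir i \<psi> x"
          using linear_cmul[OF has_derivative_linear[OF D]] by (simp add: pderiv_dir_def scaleR_conv_of_real)
        then have "(1 / of_real (t n)) * (\<psi> (x + t n *\<^sub>R ?e) - \<psi> x) - pderiv_dir i \<psi> x =
          (\<psi> (x + t n *\<^sub>R ?e) - \<psi> x - ?D (t n *\<^sub>R ?e)) / of_real (t n)"
          using t[of n] by (simp add: field_simps)
        then show ?thesis using t[of n] by (simp add: norm_divide)
      qed
      then have "(\<lambda>n. (1 / of_real (t n)) * (\<psi> (x + t n *\<^sub>R ?e) - \<psi> x) - pderiv_dir i \<psi> x) \<longlonglongrightarrow> 0"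
        using l2 by (simp add: tendsto_norm_zero_iff)
      then have "(\<lambda>n. (1 / of_real (t n)) * (\<psi> (x + t n *\<^sub>R ?e) - \<psi> x)) \<longlonglongrightarrow> pderiv_dir i \<psi> x"
        by (rule LIM_zero_cancel)
      then show "(\<lambda>n. s n x) \<longlonglongrightarrow> pderiv_dir i \<psi> x * char_fun \<xi> x"
        unfolding s_def by (intro tendsto_mult_right)
    qed
  qed (auto simp: s_def)
  show "(\<lambda>n. LINT x|lborel. s n x) \<longlonglongrightarrow> 2 * of_real pi * \<i> * of_real (\<xi> $ i) * fourier \<psi> \<xi>"
  proof -
    let ?z = "2 * of_real pi * \<i> * of_real (\<xi> $ i) :: complex"
    have int: "integrable lborel \<psi>" using schwartz_integrable \<psi> .
    have tr: "integrable lborel (\<lambda>x. \<psi> (x + a))" for a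
      using integrable_matrix_affine(1)[of "mat 1" "mat 1" \<psi> "- a"] int by simp
    \<comment> \<open>The difference quotient of the kernel at the origin, which is all that remains
      after the translation.\<close>
    define q where "q n = (char_fun \<xi> (- (t n *\<^sub>R ?e)) - 1) / of_real (t n)" for n
    have "(LINT x|lborel. s n x) = q n * fourier \<psi> \<xi>" for n
    proof -
      have "(LINT x|lborel. s n x) = (LINT x|lborel. (1 / of_real (t n)) *
          (\<psi> (x + t n *\<^sub>R ?e) * char_fun \<xi> x - \<psi> x * char_fun \<xi> x))"
        by (simp add: s_def algebra_simps)
      also have "\<dots> = (1 / of_real (t n)) * (fourier (\<lambda>x. \<psi> (x + t n *\<^sub>R ?e)) \<xi> - fourier \<psi> \<xi>)"
        unfolding fourier_char_fun
        by (subst Bochner_Integration.integral_diff[symmetric])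
           (auto intro!: integrable_mult_char_fun int tr)
      also have "\<dots> = q n * fourier \<psi> \<xi>"
        unfolding fourier_translate[OF int] q_def cnj_char_fun by (simp add: algebra_simps diff_divide_distrib)
      finally show ?thesis .
    qed
    moreover have "q \<longlonglongrightarrow> ?z"
    proof (rule LIM_zero_cancel, rule Lim_null_comparison)
      have "cmod (q n - ?z) \<le> 2 * pi\<^sup>2 * (norm \<xi>)\<^sup>2 * t n" for n
      proof -
        have "cmod (char_fun \<xi> (- (t n *\<^sub>R ?e)) - 1 - of_real (t n) * ?z) \<le> 2 * pi\<^sup>2 * (norm \<xi> * norm (t n *\<^sub>R ?e))\<^sup>2"
          using char_fun_approx[of \<xi> "- (t n *\<^sub>R ?e)"] by (simp add: inner_axis algebra_simps)
        also have "\<dots> = (2 * pi\<^sup>2 * (norm \<xi>)\<^sup>2 * t n) * t n"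
          by (simp add: power2_eq_square)
        also have "char_fun \<xi> (- (t n *\<^sub>R ?e)) - 1 - of_real (t n) * ?z = (q n - ?z) * of_real (t n)"
          using t[of n] by (simp add: q_def field_simps)
        finally show ?thesis using t[of n] by (simp add: norm_mult)
      qed
      then show "\<forall>\<^sub>F n in sequentially. cmod (q n - ?z) \<le> 2 * pi\<^sup>2 * (norm \<xi>)\<^sup>2 * t n" by simp
      show "(\<lambda>n. 2 * pi\<^sup>2 * (norm \<xi>)\<^sup>2 * t n) \<longlonglongrightarrow> 0" using tendsto_mult_right_zero[OF t0] by blast
    qed
    ultimately show ?thesis by (simp add: tendsto_mult_right)
  qed
qed

lemma norm_le_l1_vec2: "norm (x :: real^2) \<le> \<bar>x $ 1\<bar> + \<bar>x $ 2\<bar>"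
  using norm_le_l1_cart[of x] by (simp add: sum_2)

text \<open>One factor \<open>1 + norm \<xi>\<close> is at most \<open>1\<close> plus the moduli of
  the coordinates, and each coordinate is traded for a derivative of \<psi>. The induction is
  therefore general in \<psi>.\<close>

lemma fourier_decay:
  "\<psi> \<in> schwartz \<Longrightarrow> \<exists>C. \<forall>\<xi>. (1 + norm \<xi>) ^ N * cmod (fourier \<psi> \<xi>) \<le> C"
proof (induction N arbitrary: \<psi>)
  case 0
  then show ?case using cmod_fourier_le by auto
next
  case (Suc N)
  obtain C0 where C0: "\<And>\<xi>. (1 + norm \<xi>) ^ N * cmod (fourier \<psi> \<xi>) \<le> C0"
    using Suc by blast
  obtain C1 where C1: "\<And>\<xi>. (1 + norm \<xi>) ^ N * cmod (fourier (pderiv_dir 1 \<psi>) \<xi>) \<le> C1"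
    using Suc schwartz_pderiv_dir by blast
  obtain C2 where C2: "\<And>\<xi>. (1 + norm \<xi>) ^ N * cmod (fourier (pderiv_dir 2 \<psi>) \<xi>) \<le> C2"
    using Suc schwartz_pderiv_dir by blast
  have le: "\<bar>\<xi> $ i\<bar> * cmod (fourier \<psi> \<xi>) \<le> cmod (fourier (pderiv_dir i \<psi>) \<xi>)" for \<xi> i
  proof -
    have "1 * (\<bar>\<xi> $ i\<bar> * cmod (fourier \<psi> \<xi>)) \<le> (2 * pi) * (\<bar>\<xi> $ i\<bar> * cmod (fourier \<psi> \<xi>))"
      using pi_gt3 by (intro mult_right_mono) auto
    then show ?thesis unfolding fourier_pderiv_dir[OF Suc.prems] by (simp add: norm_mult)
  qed
  have "(1 + norm \<xi>) ^ Suc N * cmod (fourier \<psi> \<xi>) \<le> C0 + (C1 + C2)" for \<xi>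
  proof -
    have "(1 + norm \<xi>) ^ Suc N * cmod (fourier \<psi> \<xi>) = (1 + norm \<xi>) ^ N * ((1 + norm \<xi>) * cmod (fourier \<psi> \<xi>))"
      by simp
    also have "\<dots> \<le> (1 + norm \<xi>) ^ N * ((1 + (\<bar>\<xi> $ 1\<bar> + \<bar>\<xi> $ 2\<bar>)) * cmod (fourier \<psi> \<xi>))"
      using norm_le_l1_vec2[of \<xi>] by (intro mult_left_mono mult_right_mono) auto
    also have "\<dots> = (1 + norm \<xi>) ^ N * (cmod (fourier \<psi> \<xi>) + (\<bar>\<xi> $ 1\<bar> * cmod (fourier \<psi> \<xi>) + \<bar>\<xi> $ 2\<bar> * cmod (fourier \<psi> \<xi>)))"
      by (simp add: algebra_simps)
    also have "\<dots> \<le> (1 + norm \<xi>) ^ N * (cmod (fourier \<psi> \<xi>) + (cmod (fourier (pderiv_dir 1 \<psi>) \<xi>) + cmod (fourier (pderiv_dir 2 \<psi>) \<xi>)))"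
      by (intro mult_left_mono add_mono le) auto
    also have "\<dots> \<le> C0 + (C1 + C2)"
      using C0[of \<xi>] C1[of \<xi>] C2[of \<xi>] by (simp add: distrib_left)
    finally show ?thesis .
  qed
  then show ?case by blast
qed

text \<open>The image of the Schwartz class is stable under differentiation because a derivative in
  frequency is the transform of a coordinate multiple, which is again Schwartz.\<close>

lemma schwartz_fourier:
  assumes "\<psi> \<in> schwartz"
  shows "fourier \<psi> \<in> schwartz"
proof (rule schwartz_coinduct[where S = "fourier ` schwartz"])
  show "fourier \<psi> \<in> fourier ` schwartz" using assms by blast
  fix h assume "h \<in> fourier ` schwartz"
  then obtain \<psi> where h: "\<psi> \<in> schwartz" "h = fourier \<psi>" by blast
  show "pderiv_dir i h \<in> fourier ` schwartz" for i
    unfolding h(2) pderiv_dir_fourier[OF h(1)] using schwartz_coord_mult[OF h(1)] by blast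
  show "h differentiable at x" for x
    unfolding h(2) using has_derivative_fourier[OF h(1)] differentiableI by blast
  show "\<exists>C. \<forall>x. (1 + norm x) ^ N * cmod (h x) \<le> C" for N
    unfolding h(2) by (rule fourier_decay[OF h(1)])
qed

section \<open>The multiplication formula and Fourier inversion\<close>

lemma integral_fourier_mult:
  assumes f: "integrable lborel f" and g: "integrable lborel g"
  shows "(LINT \<xi>|lborel. fourier f \<xi> * g \<xi>) = (LINT x|lborel. f x * fourier g x)"
proof -
  have [measurable]: "f \<in> borel_measurable borel" "g \<in> borel_measurable borel" using f g by auto
  let ?h = "\<lambda>x \<xi>. f x * g \<xi> * char_fun \<xi> x"
  have [measurable]: "(\<lambda>p. char_fun (snd p) (fst p)) \<in> borel_measurable (lborel \<Otimes>\<^sub>M lborel)"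
    unfolding char_fun_def by measurable
  have "integrable (lborel \<Otimes>\<^sub>M lborel) (case_prod ?h)"
  proof (rule lborel_pair.Fubini_integrable)
    show "case_prod ?h \<in> borel_measurable (lborel \<Otimes>\<^sub>M lborel)"
      unfolding split_beta' by measurable
    show "integrable lborel (\<lambda>x. LINT y|lborel. norm (case (x, y) of (x, \<xi>) \<Rightarrow> ?h x \<xi>))"
      using f by (simp add: norm_mult)
    show "AE x in lborel. integrable lborel (\<lambda>y. case (x, y) of (x, \<xi>) \<Rightarrow> ?h x \<xi>)"
    proof (intro AE_I2)
      fix x
      have "integrable lborel (\<lambda>y. f x * (g y * char_fun x y))"
        by (intro integrable_mult_right integrable_mult_char_fun g)
      then show "integrable lborel (\<lambda>y. case (x, y) of (x, \<xi>) \<Rightarrow> ?h x \<xi>)"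
        by (simp add: char_fun_commute[of _ x] mult.assoc)
    qed
  qed
  from lborel_pair.Fubini_integral[OF this]
  have "(LINT \<xi>|lborel. LINT x|lborel. ?h x \<xi>) = (LINT x|lborel. LINT \<xi>|lborel. ?h x \<xi>)" .
  moreover have "(LINT x|lborel. ?h x \<xi>) = fourier f \<xi> * g \<xi>" for \<xi>
  proof -
    have "(LINT x|lborel. ?h x \<xi>) = (LINT x|lborel. (f x * char_fun \<xi> x) * g \<xi>)" by (simp add: mult_ac)
    then show ?thesis by (simp add: fourier_char_fun)
  qed
  moreover have "(LINT \<xi>|lborel. ?h x \<xi>) = f x * fourier g x" for x
  proof -
    have "(LINT \<xi>|lborel. ?h x \<xi>) = (LINT \<xi>|lborel. f x * (g \<xi> * char_fun x \<xi>))"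
      by (simp add: char_fun_commute[of _ x] mult_ac)
    then show ?thesis by (simp add: fourier_char_fun)
  qed
  ultimately show ?thesis by simp
qed

text \<open>\<open>lborel\<close> is the image of a product of one-dimensional measures, so after
  transport this is the product formula for finite product measures.\<close>

lemma integral_lborel_prod:
  fixes f :: "'a::euclidean_space \<Rightarrow> real \<Rightarrow> complex"
  assumes int: "\<And>b. b \<in> Basis \<Longrightarrow> integrable lborel (f b)"
  shows "(LINT x|lborel. (\<Prod>b\<in>Basis. f b (x \<bullet> b))) = (\<Prod>b\<in>Basis. LINT x|lborel. f b x)"
proof -
  interpret product_sigma_finite "\<lambda>_::'a. interval_measure (\<lambda>x. x)"
    by (simp add: product_sigma_finite_def sigma_finite_interval_measure)
  have int': "\<And>b. b \<in> Basis \<Longrightarrow> integrable (interval_measure (\<lambda>x. x)) (f b)"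
    using int by (simp add: lborel_eq_real)
  have [measurable]: "\<And>b. b \<in> Basis \<Longrightarrow> f b \<in> borel_measurable borel"
    using int by auto
  show ?thesis
    unfolding lborel_def[where 'a = 'a]
    by (subst integral_distr) (auto simp: product_integral_prod int' lborel_eq_real)
qed

text \<open>The standard normal density on the plane. With this normalisation its transform is read
  off from the characteristic function of the one-dimensional normal distribution.\<close>

definition gauss :: "real^2 \<Rightarrow> complex" where
  "gauss x = of_real (exp (- (1 / 2) * (norm x)\<^sup>2) / (2 * pi))"

lemma fourier_std_normal_density:
  "integrable lborel (\<lambda>u. of_real (std_normal_density u) * exp (- 2 * of_real pi * \<i> * of_real (a * u)))"
  "(LINT u|lborel. of_real (std_normal_density u) * exp (- 2 * of_real pi * \<i> * of_real (a * u))) =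
    of_real (exp (- (2 * pi\<^sup>2) * a\<^sup>2))"
proof -
  have i: "integrable lborel (\<lambda>u. complex_of_real (std_normal_density u))"
    by (intro integrable_of_real integrable_normal_density) simp
  show "integrable lborel (\<lambda>u. of_real (std_normal_density u) * exp (- 2 * of_real pi * \<i> * of_real (a * u)))"
    by (rule Bochner_Integration.integrable_bound[OF i]) (auto simp: norm_mult norm_exp_eq_Re)
  have "char std_normal_distribution (- 2 * pi * a) =
      (LINT u|lborel. of_real (std_normal_density u) * exp (- 2 * of_real pi * \<i> * of_real (a * u)))"
    unfolding char_def by (subst integral_density) (auto simp: scaleR_conv_of_real mult_ac)
  from this[symmetric] show "(LINT u|lborel. of_real (std_normal_density u) * exp (- 2 * of_real pi * \<i> * of_real (a * u))) =
    of_real (exp (- (2 * pi\<^sup>2) * a\<^sup>2))"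
    by (simp add: char_std_normal_distribution power_mult_distrib)
qed

lemma gauss_eq_prod: "gauss x = (\<Prod>b\<in>Basis. of_real (std_normal_density (x \<bullet> b)))"
proof -
  have "(\<Prod>b\<in>(Basis::(real^2) set). std_normal_density (x \<bullet> b)) =
    (\<Prod>b\<in>(Basis::(real^2) set). 1 / sqrt (2 * pi)) * (\<Prod>b\<in>Basis. exp (- (1 / 2) * (x \<bullet> b)\<^sup>2))"
    unfolding std_normal_density_def prod.distrib by simp
  also have "\<dots> = exp (- (1 / 2) * (norm x)\<^sup>2) / (2 * pi)"
    unfolding exp_norm_square_prod[symmetric] by (simp add: power_divide)
  finally show ?thesis unfolding gauss_def by (metis of_real_prod)
qed

lemma fourier_gauss: "fourier gauss \<xi> = of_real (exp (- (2 * pi\<^sup>2) * (norm \<xi>)\<^sup>2))"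
proof -
  let ?h = "\<lambda>b u. of_real (std_normal_density u) * exp (- 2 * of_real pi * \<i> * of_real ((\<xi> \<bullet> b) * u))"
  have "gauss x * char_fun \<xi> x = (\<Prod>b\<in>Basis. ?h b (x \<bullet> b))" for x
  proof -
    have "\<xi> \<bullet> x = (\<Sum>b\<in>Basis. (\<xi> \<bullet> b) * (x \<bullet> b))" by (rule euclidean_inner)
    then have "char_fun \<xi> x = (\<Prod>b\<in>Basis. exp (- 2 * of_real pi * \<i> * of_real ((\<xi> \<bullet> b) * (x \<bullet> b))))"
      unfolding char_fun_def by (simp add: exp_sum[symmetric] sum_distrib_left sum_negf)
    then show ?thesis unfolding gauss_eq_prod prod.distrib by simp
  qed
  then have "fourier gauss \<xi> = (LINT x|lborel. (\<Prod>b\<in>Basis. ?h b (x \<bullet> b)))"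
    by (simp add: fourier_char_fun)
  also have "\<dots> = (\<Prod>b\<in>Basis. LINT u|lborel. ?h b u)"
    by (rule integral_lborel_prod) (rule fourier_std_normal_density)
  also have "\<dots> = of_real (\<Prod>b\<in>Basis. exp (- (2 * pi\<^sup>2) * (\<xi> \<bullet> b)\<^sup>2))"
    unfolding fourier_std_normal_density by simp
  finally show ?thesis unfolding exp_norm_square_prod .
qed

lemma gauss_integrable: "integrable lborel gauss"
  unfolding gauss_def by (intro integrable_of_real integrable_divide integrable_gaussian) simp

lemma mat_mult_vec: "mat t *v x = t *\<^sub>R (x :: real^2)"
  by (simp add: vec_eq_iff forall_2 matrix_vector_mult_def sum_2 mat_def)

lemma det_mat_2: "det (mat t :: real^2^2) = t\<^sup>2"
  by (simp add: det_2 mat_def power2_eq_square)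

lemma mat_mult_mat: "mat s ** mat t = (mat (s * t) :: real^2^2)"
  by (simp add: vec_eq_iff forall_2 matrix_matrix_mult_def sum_2 mat_def)

text \<open>Inversion at the origin. In the multiplication formula with
  \<open>gauss (t n *\<^sub>R \<xi>)\<close>, letting \<open>t n\<close> tend to 0 produces the
  integral of \<open>fourier \<phi>\<close> times \<open>gauss 0\<close> on one side and
  \<open>\<phi> 0\<close> times the integral of \<open>fourier gauss\<close> on the other. Both
  constants are \<open>1 / (2 * pi)\<close>.\<close>

lemma integral_fourier:
  assumes \<phi>: "\<phi> \<in> schwartz"
  shows "(LINT \<xi>|lborel. fourier \<phi> \<xi>) = \<phi> 0"
proof -
  define t :: "nat \<Rightarrow> real" where "t n = inverse (Suc n)" for n
  have t: "0 < t n" "t n \<le> 1" for n by (auto simp: t_def inverse_le_1_iff)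
  have t0: "t \<longlonglongrightarrow> 0" unfolding t_def by (rule LIMSEQ_inverse_real_of_nat)
  let ?G = "\<lambda>y::real^2. complex_of_real (exp (- (2 * pi\<^sup>2) * (norm y)\<^sup>2))"
  have G: "integrable lborel ?G" "(LINT y|lborel. ?G y) = 1 / (2 * of_real pi)"
  proof -
    show "integrable lborel ?G" by (intro integrable_of_real integrable_gaussian) simp
    have "(LINT y|lborel. ?G y) = of_real (pi / (2 * pi\<^sup>2))"
      by (subst integral_complex_of_real, subst integrable_gaussian) auto
    then show "(LINT y|lborel. ?G y) = 1 / (2 * of_real pi)"
      by (simp add: power2_eq_square)
  qed
  have int: "integrable lborel \<phi>" "integrable lborel (fourier \<phi>)"
    using schwartz_integrable schwartz_fourier \<phi> by blast+
  have [measurable]: "\<phi> \<in> borel_measurable borel" "fourier \<phi> \<in> borel_measurable borel"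
    using int by auto
  have cont: "\<phi> \<midarrow>0\<rightarrow> \<phi> 0"
    using schwartz_differentiable[OF \<phi>] differentiable_imp_continuous_within isCont_def by blast
  have m: "mat (1 / t n) ** mat (t n) = (mat 1 :: real^2^2)" "mat (t n) ** mat (1 / t n) = (mat 1 :: real^2^2)" for n
    using t[of n] by (auto simp: mat_mult_mat)
  \<comment> \<open>The transform of the dilated Gaussian concentrates at the origin with height of
    order \<open>1 / (t n)\<^sup>2\<close>; the substitution of \<open>t n *\<^sub>R y\<close> moves
    the dilation to \<phi> and cancels this factor, so that a fixed dominating function
    exists.\<close>
  have eq: "(LINT \<xi>|lborel. fourier \<phi> \<xi> * gauss (t n *\<^sub>R \<xi>)) = (LINT y|lborel. \<phi> (t n *\<^sub>R y) * ?G y)" for n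
  proof -
    have "integrable lborel (\<lambda>x. gauss (t n *\<^sub>R x))"
      using integrable_matrix_affine(1)[OF m gauss_integrable, of n 0] by (simp add: mat_mult_vec)
    then have 1: "(LINT \<xi>|lborel. fourier \<phi> \<xi> * gauss (t n *\<^sub>R \<xi>)) =
        (LINT y|lborel. \<phi> y * fourier (\<lambda>\<xi>. gauss (t n *\<^sub>R \<xi>)) y)"
      by (rule integral_fourier_mult[OF int(1)])
    have 2: "fourier (\<lambda>\<xi>. gauss (t n *\<^sub>R \<xi>)) y = ?G ((1 / t n) *\<^sub>R y) / of_real ((t n)\<^sup>2)" for y
      using fourier_affine[OF m _ gauss_integrable, of "mat (1 / t n)" n 1 0 y] t[of n]
      by (simp add: mat_mult_vec det_mat_2 fourier_gauss)
    have i: "integrable lborel (\<lambda>y. \<phi> y * fourier (\<lambda>\<xi>. gauss (t n *\<^sub>R \<xi>)) y)"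
    proof (rule Bochner_Integration.integrable_bound[OF integrable_mult_right[OF int(1), of "1 / of_real ((t n)\<^sup>2)"]])
      show "AE y in lborel. norm (\<phi> y * fourier (\<lambda>\<xi>. gauss (t n *\<^sub>R \<xi>)) y) \<le> norm (1 / of_real ((t n)\<^sup>2) * \<phi> y)"
        unfolding 2 by (auto simp: norm_mult norm_divide intro!: divide_right_mono mult_left_le)
    qed (simp add: 2)
    have "(LINT y|lborel. \<phi> y * fourier (\<lambda>\<xi>. gauss (t n *\<^sub>R \<xi>)) y) =
      of_real ((t n)\<^sup>2) * (LINT y|lborel. \<phi> (t n *\<^sub>R y) * fourier (\<lambda>\<xi>. gauss (t n *\<^sub>R \<xi>)) (t n *\<^sub>R y))"
      using integrable_matrix_affine(2)[OF m i, of n 0] by (simp add: mat_mult_vec det_mat_2)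
    also have "\<dots> = (LINT y|lborel. \<phi> (t n *\<^sub>R y) * ?G y)"
      unfolding 2 using t[of n] by simp
    finally show ?thesis unfolding 1 .
  qed
  have "(\<lambda>n. t n *\<^sub>R y) \<longlonglongrightarrow> 0" for y :: "real^2"
    using tendsto_scaleR[OF t0 tendsto_const[of y]] by simp
  note tv = this
  have "isCont gauss 0" unfolding gauss_def by (intro continuous_intros) auto
  obtain C where C: "C \<ge> 0" "\<And>x. cmod (\<phi> x) \<le> C"
    using schwartz_decay[OF \<phi>, of 0] by auto
  have gb: "cmod (gauss x) \<le> 1" for x
  proof -
    have "exp (- (1 / 2) * (norm x)\<^sup>2) \<le> 1" by simp
    also have "1 \<le> 2 * pi" using pi_gt3 by simp
    finally show ?thesis unfolding gauss_def norm_of_real by (simp add: divide_le_eq)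
  qed
  have [measurable]: "gauss \<in> borel_measurable borel" using gauss_integrable by auto
  have L: "(\<lambda>n. LINT \<xi>|lborel. fourier \<phi> \<xi> * gauss (t n *\<^sub>R \<xi>)) \<longlonglongrightarrow> (LINT \<xi>|lborel. fourier \<phi> \<xi> * gauss 0)"
  proof (rule integral_dominated_convergence[where w = "\<lambda>\<xi>. cmod (fourier \<phi> \<xi>)"])
    show "AE \<xi> in lborel. (\<lambda>n. fourier \<phi> \<xi> * gauss (t n *\<^sub>R \<xi>)) \<longlonglongrightarrow> fourier \<phi> \<xi> * gauss 0"
      using isCont_tendsto_compose[OF \<open>isCont gauss 0\<close> tv] by (intro AE_I2 tendsto_mult_left)
    show "AE \<xi> in lborel. norm (fourier \<phi> \<xi> * gauss (t n *\<^sub>R \<xi>)) \<le> cmod (fourier \<phi> \<xi>)" for n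
      using gb by (auto simp: norm_mult intro!: mult_left_le)
  qed (use int in auto)
  have R: "(\<lambda>n. LINT y|lborel. \<phi> (t n *\<^sub>R y) * ?G y) \<longlonglongrightarrow> (LINT y|lborel. \<phi> 0 * ?G y)"
  proof (rule integral_dominated_convergence[where w = "\<lambda>y. C * cmod (?G y)"])
    have "isCont \<phi> 0" using cont by (simp add: isCont_def)
    then show "AE y in lborel. (\<lambda>n. \<phi> (t n *\<^sub>R y) * ?G y) \<longlonglongrightarrow> \<phi> 0 * ?G y"
      using isCont_tendsto_compose[OF _ tv] by (intro AE_I2 tendsto_mult_right) blast
    show "AE y in lborel. norm (\<phi> (t n *\<^sub>R y) * ?G y) \<le> C * cmod (?G y)" for n
      using C by (auto simp: norm_mult intro!: mult_right_mono)
    show "integrable lborel (\<lambda>y. C * cmod (?G y))"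
      by (intro integrable_mult_right integrable_norm G)
  qed auto
  have "(LINT \<xi>|lborel. fourier \<phi> \<xi> * gauss 0) = (LINT y|lborel. \<phi> 0 * ?G y)"
    using LIMSEQ_unique[OF L] R unfolding eq by blast
  moreover have "(LINT \<xi>|lborel. fourier \<phi> \<xi> * gauss 0) = (LINT \<xi>|lborel. fourier \<phi> \<xi>) / (2 * of_real pi)"
    by (simp add: gauss_def)
  moreover have "(LINT y|lborel. \<phi> 0 * ?G y) = \<phi> 0 / (2 * of_real pi)"
    using G(2) by simp
  ultimately show ?thesis by simp
qed

text \<open>Inversion at \<open>x\<close> is inversion at the origin for the translate by
  \<open>x\<close>. The conjugated form is the one that the sesquilinear pairing calls for.\<close>

lemma fourier_inversion:
  assumes \<phi>: "\<phi> \<in> schwartz"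
  shows "fourier (\<lambda>\<xi>. cnj (fourier \<phi> \<xi>)) x = cnj (\<phi> x)"
proof -
  have S: "(\<lambda>y. \<phi> (y + x)) \<in> schwartz"
    using schwartz_affine[OF \<phi>, of "mat 1" 1 "- x"] by (simp add: invertible_def)
  have "fourier (\<lambda>\<xi>. cnj (fourier \<phi> \<xi>)) x = (LINT \<xi>|lborel. cnj (cnj (char_fun \<xi> x) * fourier \<phi> \<xi>))"
    by (simp only: fourier_char_fun[of "\<lambda>\<xi>. cnj (fourier \<phi> \<xi>)"] char_fun_commute[of x]
          complex_cnj_mult complex_cnj_cnj mult.commute)
  also have "\<dots> = cnj (LINT \<xi>|lborel. cnj (char_fun \<xi> x) * fourier \<phi> \<xi>)"
    by (rule Bochner_Integration.integral_cnj)
  also have "\<dots> = cnj (LINT \<xi>|lborel. fourier (\<lambda>y. \<phi> (y + x)) \<xi>)"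
    by (simp add: fourier_translate schwartz_integrable[OF \<phi>])
  also have "\<dots> = cnj (\<phi> x)" unfolding integral_fourier[OF S] by simp
  finally show ?thesis .
qed

section \<open>Geometry of the wavepackets\<close>

text \<open>The transpose of \<open>A_mat j k\<close>, since the transpose of a rotation is the
  rotation by the opposite angle.\<close>

definition B_inv :: "nat \<Rightarrow> nat \<Rightarrow> real^2^2" where
  "B_inv j k = rot (- (2 * real k * pi / 2 ^ j)) ** dil j"

text \<open>This is \<^const>\<open>B_mat\<close>, written without \<^const>\<open>matrix_inv\<close>.\<close>

definition B_dual :: "nat \<Rightarrow> nat \<Rightarrow> real^2^2" where
  "B_dual j k = vector [vector [1 / 4 ^ j, 0], vector [0, 1 / 2 ^ j]] ** rot (2 * real k * pi / 2 ^ j)"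

definition A_inv :: "nat \<Rightarrow> nat \<Rightarrow> real^2^2" where
  "A_inv j k = rot (- (2 * real k * pi / 2 ^ j)) ** vector [vector [1 / 4 ^ j, 0], vector [0, 1 / 2 ^ j]]"

lemma vector_22 [simp]:
  "(vector [x, y] :: 'a::zero^2) $ 1 = x" "(vector [x, y] :: 'a::zero^2) $ 2 = y"
  by (rule vector_2)+

lemma rot_mult_vec:
  "(rot \<theta> *v x) $ 1 = cos \<theta> * x $ 1 - sin \<theta> * x $ 2"
  "(rot \<theta> *v x) $ 2 = sin \<theta> * x $ 1 + cos \<theta> * x $ 2"
  by (simp_all add: rot_def matrix_vector_mult_def sum_2)

lemma norm_vec2: "norm (x :: real^2) = sqrt ((x $ 1)\<^sup>2 + (x $ 2)\<^sup>2)"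
  by (simp add: norm_vec_def L2_set_def sum_2)

lemma norm_rot [simp]: "norm (rot \<theta> *v x) = norm x"
proof -
  have "(cos \<theta> * x $ 1 - sin \<theta> * x $ 2)\<^sup>2 + (sin \<theta> * x $ 1 + cos \<theta> * x $ 2)\<^sup>2 =
     ((cos \<theta>)\<^sup>2 + (sin \<theta>)\<^sup>2) * (x $ 1)\<^sup>2 + ((cos \<theta>)\<^sup>2 + (sin \<theta>)\<^sup>2) * (x $ 2)\<^sup>2"
    by algebra
  then show ?thesis by (simp add: norm_vec2 rot_mult_vec)
qed

lemma rot_uminus: "rot (- \<theta>) ** rot \<theta> = mat 1" "rot \<theta> ** rot (- \<theta>) = mat 1"
  by (simp_all add: vec_eq_iff forall_2 matrix_matrix_mult_def sum_2 rot_def mat_def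
        flip: power2_eq_square)

lemma dil_inverse:
  "vector [vector [1 / 4 ^ j, 0], vector [0, 1 / 2 ^ j]] ** dil j = mat 1"
  "dil j ** vector [vector [1 / 4 ^ j, 0], vector [0, 1 / 2 ^ j]] = mat 1"
  by (simp_all add: vec_eq_iff forall_2 matrix_matrix_mult_def sum_2 dil_def mat_def)

lemma A_inv: "A_inv j k ** A_mat j k = mat 1" "A_mat j k ** A_inv j k = mat 1"
proof -
  have "P' ** Q' ** (Q ** P) = P' ** ((Q' ** Q) ** P)" for P P' Q Q' :: "real^2^2"
    by (simp add: matrix_mul_assoc)
  then show "A_inv j k ** A_mat j k = mat 1" "A_mat j k ** A_inv j k = mat 1"
    unfolding A_inv_def A_mat_def by (simp_all add: dil_inverse rot_uminus)
qed

lemma invertible_A_mat: "invertible (A_mat j k)"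
  unfolding invertible_def by (intro exI[of _ "A_inv j k"] conjI A_inv)

lemma B_inv: "B_dual j k ** B_inv j k = mat 1" "B_inv j k ** B_dual j k = mat 1"
proof -
  have "P' ** Q' ** (Q ** P) = P' ** ((Q' ** Q) ** P)" for P P' Q Q' :: "real^2^2"
    by (simp add: matrix_mul_assoc)
  then show "B_dual j k ** B_inv j k = mat 1" "B_inv j k ** B_dual j k = mat 1"
    unfolding B_inv_def B_dual_def by (simp_all add: dil_inverse rot_uminus)
qed

lemma det_rot: "det (rot \<theta>) = 1"
  by (simp add: rot_def det_2 flip: power2_eq_square)

lemma det_dil: "det (dil j) = 8 ^ j"
  by (simp add: dil_def det_2 flip: power_mult_distrib)

lemma det_A_mat: "det (A_mat j k) = 8 ^ j"
  by (simp add: A_mat_def det_mul det_rot det_dil)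

lemma det_B_inv: "det (B_inv j k) = 8 ^ j"
  by (simp add: B_inv_def det_mul det_rot det_dil)

lemma A_mat_mult_vec:
  fixes j k :: nat
  defines "\<beta> \<equiv> 2 * real k * pi / 2 ^ j"
  shows "(A_mat j k *v x) $ 1 = 4 ^ j * (rot \<beta> *v x) $ 1"
    "(A_mat j k *v x) $ 2 = 2 ^ j * (rot \<beta> *v x) $ 2"
  unfolding A_mat_def matrix_vector_mul_assoc[symmetric] \<beta>_def
  by (simp_all add: dil_def matrix_vector_mult_def sum_2)

lemma B_dual_mult_vec:
  fixes j k :: nat
  defines "\<beta> \<equiv> 2 * real k * pi / 2 ^ j"
  shows "(B_dual j k *v x) $ 1 = (rot \<beta> *v x) $ 1 / 4 ^ j"
    "(B_dual j k *v x) $ 2 = (rot \<beta> *v x) $ 2 / 2 ^ j"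
  unfolding B_dual_def matrix_vector_mul_assoc[symmetric] \<beta>_def
  by (simp_all add: matrix_vector_mult_def sum_2)

lemma inner_rot: "(rot \<theta> *v \<xi>) \<bullet> (rot \<theta> *v x) = \<xi> \<bullet> x"
proof -
  have "(rot \<theta> *v \<xi>) \<bullet> (rot \<theta> *v x) = ((cos \<theta>)\<^sup>2 + (sin \<theta>)\<^sup>2) * (\<xi> $ 1 * x $ 1) + ((cos \<theta>)\<^sup>2 + (sin \<theta>)\<^sup>2) * (\<xi> $ 2 * x $ 2)"
    unfolding inner_vec_def sum_2 rot_mult_vec inner_real_def by algebra
  then show ?thesis by (simp add: inner_vec_def sum_2)
qed

lemma B_dual_inner_A_mat: "(B_dual j k *v \<xi>) \<bullet> (A_mat j k *v x) = \<xi> \<bullet> x"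
proof -
  let ?r = "\<lambda>x. rot (2 * real k * pi / 2 ^ j) *v x"
  have "(B_dual j k *v \<xi>) \<bullet> (A_mat j k *v x) = ?r \<xi> \<bullet> ?r x"
    by (simp add: inner_vec_def sum_2 A_mat_mult_vec B_dual_mult_vec)
  then show ?thesis by (simp add: inner_rot)
qed

text \<open>The smaller of the two dilation factors. It separates a packet from points at positive
  distance from its centre.\<close>

lemma norm_A_mat_ge: "2 ^ j * norm x \<le> norm (A_mat j k *v x)"
proof -
  let ?y = "rot (2 * real k * pi / 2 ^ j) *v x"
  have "2 ^ j * norm x = sqrt ((2 ^ j * ?y $ 1)\<^sup>2 + (2 ^ j * ?y $ 2)\<^sup>2)"
    unfolding power_mult_distrib distrib_left[symmetric] real_sqrt_mult
    by (simp flip: norm_vec2)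
  also have "\<dots> \<le> norm (A_mat j k *v x)"
    unfolding norm_vec2[of "A_mat j k *v x"] A_mat_mult_vec
    by (intro real_sqrt_le_mono add_mono) (auto simp: power_mult_distrib intro!: mult_right_mono power_mono)
  finally show ?thesis .
qed

text \<open>The smaller factor is now \<open>1 / 4 ^ j\<close>. Up to rotation it is attained on the
  first axis, so in the packet direction nothing better holds.\<close>

lemma norm_B_dual_ge: "norm \<xi> / 4 ^ j \<le> norm (B_dual j k *v \<xi>)"
proof -
  let ?y = "rot (2 * real k * pi / 2 ^ j) *v \<xi>"
  have "norm \<xi> / 4 ^ j = sqrt ((?y $ 1 / 4 ^ j)\<^sup>2 + (?y $ 2 / 4 ^ j)\<^sup>2)"
    unfolding power_divide add_divide_distrib[symmetric] real_sqrt_divide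
    by (simp flip: norm_vec2)
  also have "\<dots> \<le> norm (B_dual j k *v \<xi>)"
    unfolding norm_vec2[of "B_dual j k *v \<xi>"] B_dual_mult_vec
    by (intro real_sqrt_le_mono add_mono) (auto simp: power_divide intro!: divide_left_mono power_mono)
  finally show ?thesis .
qed

text \<open>Makes the vanishing condition on the first coordinate radial, hence independent of the
  direction of the packet.\<close>

lemma B_dual_1_le: "\<bar>(B_dual j k *v \<xi>) $ 1\<bar> \<le> norm \<xi> / 4 ^ j"
  using component_le_norm_cart[of "rot (2 * real k * pi / 2 ^ j) *v \<xi>" 1]
  by (simp add: B_dual_mult_vec divide_right_mono)

text \<open>Translation by \<open>l\<close> contributes a unimodular factor and disappears from the
  modulus; dividing \<open>8 powr (real j / 2)\<close> by the determinant \<open>8 ^ j\<close>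
  inverts the normalisation.\<close>

lemma fourier_wavepacket:
  assumes "\<phi> \<in> schwartz"
  shows "cmod (fourier (wavepacket \<phi> j k l) \<xi>) = 8 powr (- real j / 2) * cmod (fourier \<phi> (B_dual j k *v \<xi>))"
proof -
  have "8 powr (real j / 2) / 8 ^ j = 8 powr (- real j / 2)"
  proof -
    have "8 powr (real j / 2) / 8 ^ j = 8 powr (real j / 2) / 8 powr real j"
      by (simp add: powr_realpow)
    also have "\<dots> = 8 powr (real j / 2 - real j)" by (simp only: powr_diff)
    also have "real j / 2 - real j = - real j / 2" by simp
    finally show ?thesis .
  qed
  note this[symmetric]
  then show ?thesis
    unfolding wavepacket_def[abs_def]
      fourier_affine[OF A_inv B_dual_inner_A_mat schwartz_integrable[OF assms]] det_A_mat
    by (simp add: norm_mult norm_divide norm_power)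
qed

lemma schwartz_wavepacket:
  assumes "\<phi> \<in> schwartz"
  shows "wavepacket \<phi> j k l \<in> schwartz"
  unfolding wavepacket_def[abs_def]
  by (rule schwartz_affine[OF assms]) (use invertible_A_mat in auto)

lemma nn_integral_B_dual:
  assumes [measurable]: "F \<in> borel_measurable borel"
  shows "(\<integral>\<^sup>+\<xi>. F (B_dual j k *v \<xi>) \<partial>lborel) = ennreal (8 ^ j) * (\<integral>\<^sup>+y. F y \<partial>lborel)"
  using nn_integral_matrix_affine[OF B_inv, of "\<lambda>\<xi>. F (B_dual j k *v \<xi>)" j k 0]
  by (simp add: det_B_inv matrix_vector_mul_assoc B_inv)

text \<open>Outside the cone the second frequency component dominates, since the rotations
  \<open>rot (2 \<pi> k\<^sub>j / 2 ^ j) ** rot \<theta>\<^sub>0\<close> converge to the identity.\<close>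

lemma norm_B_dual_off_cone:
  assumes \<epsilon>: "\<epsilon> > 0"
    and grid: "\<And>j. j \<ge> 1 \<Longrightarrow> 2 * pi * real (k j) / 2 ^ j \<le> 2 * pi - \<theta>\<^sub>0"
      "\<And>j. j \<ge> 1 \<Longrightarrow> 2 * pi - \<theta>\<^sub>0 \<le> 2 * pi * (real (k j) + 1) / 2 ^ j"
  obtains J \<kappa> where "\<kappa> > 0"
    "\<And>j \<xi>. j \<ge> J \<Longrightarrow> \<xi> \<notin> (\<lambda>\<zeta>. rot \<theta>\<^sub>0 *v \<zeta>) ` cone_V \<epsilon> \<Longrightarrow> \<kappa> * norm \<xi> / 2 ^ j \<le> norm (B_dual j (k j) *v \<xi>)"
proof -
  \<comment> \<open>A tolerance for the angular error: \<open>\<epsilon> / 4\<close> keeps the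
    contribution of the first coordinate below a quarter of the second, and \<open>1 / 2\<close>
    keeps the cosine above \<open>3 / 4\<close>.\<close>
  define m where "m = min (\<epsilon> / 4) (1 / 2)"
  have m: "m > 0" using \<epsilon> by (simp add: m_def)
  obtain J0 where J0: "2 * pi / m < 2 ^ J0" using real_arch_pow[of 2 "2 * pi / m"] by auto
  \<comment> \<open>Outside the cone \<open>norm \<xi>\<close> is at most
    \<open>1 + 1 / \<epsilon>\<close> times the modulus of the second coordinate of \<zeta>; the
    factor 2 is the loss through the angular error.\<close>
  define \<kappa> where "\<kappa> = 1 / (2 * (1 + 1 / \<epsilon>))"
  have \<kappa>: "\<kappa> > 0" using \<epsilon> by (simp add: \<kappa>_def add_pos_pos)
  show ?thesis
  proof (rule that[of \<kappa> "max 1 J0", OF \<kappa>])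
    fix j \<xi> assume j: "max 1 J0 \<le> j" and \<xi>: "\<xi> \<notin> (\<lambda>\<zeta>. rot \<theta>\<^sub>0 *v \<zeta>) ` cone_V \<epsilon>"
    define \<beta> where "\<beta> = 2 * real (k j) * pi / 2 ^ j"
    \<comment> \<open>The angle of the packet rotation composed with
      \<open>rot \<theta>\<^sub>0\<close>, reduced by a full turn. The grid inequalities place it
      between \<open>- (2 * pi / 2 ^ j)\<close> and 0.\<close>
    define \<alpha> where "\<alpha> = \<beta> + \<theta>\<^sub>0 - 2 * pi"
    define \<zeta> where "\<zeta> = rot (- \<theta>\<^sub>0) *v \<xi>"
    have \<xi>\<zeta>: "\<xi> = rot \<theta>\<^sub>0 *v \<zeta>" by (simp add: \<zeta>_def matrix_vector_mul_assoc rot_uminus)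
    then have "\<zeta> \<notin> cone_V \<epsilon>" using \<xi> by blast
    then have z: "\<bar>\<zeta> $ 1\<bar> < \<bar>\<zeta> $ 2\<bar> / \<epsilon>"
      using \<epsilon> by (simp add: cone_V_def pos_less_divide_eq mult.commute)
    have "2 * pi / 2 ^ j \<le> 2 * pi / 2 ^ J0"
      using j by (intro divide_left_mono power_increasing) auto
    also have "\<dots> \<le> m" using J0 m by (simp add: field_simps)
    finally have "2 * pi / 2 ^ j \<le> m" .
    moreover have "\<alpha> \<le> 0" using grid(1)[of j] j by (simp add: \<alpha>_def \<beta>_def mult_ac)
    moreover have "- (2 * pi / 2 ^ j) \<le> \<alpha>"
      using grid(2)[of j] j by (simp add: \<alpha>_def \<beta>_def add_divide_distrib distrib_left mult_ac)
    ultimately have \<alpha>: "\<bar>\<alpha>\<bar> \<le> m" by linarith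
    have "\<bar>sin (\<alpha> / 2)\<bar> \<le> \<bar>\<alpha> / 2\<bar>" by (rule abs_sin_x_le_abs_x)
    also have "\<dots> \<le> 1 / 4" using \<alpha> by (simp add: m_def)
    finally have "(sin (\<alpha> / 2))\<^sup>2 \<le> (1 / 4)\<^sup>2" by (simp add: abs_le_square_iff[symmetric])
    then have c: "cos \<alpha> \<ge> 3 / 4" using cos_double_sin[of "\<alpha> / 2"] by (simp add: power2_eq_square)
    have "\<bar>sin \<alpha>\<bar> * \<bar>\<zeta> $ 1\<bar> \<le> (\<epsilon> / 4) * (\<bar>\<zeta> $ 2\<bar> / \<epsilon>)"
      using abs_sin_x_le_abs_x[of \<alpha>] \<alpha> z \<epsilon> by (intro mult_mono) (auto simp: m_def)
    then have s: "\<bar>sin \<alpha> * \<zeta> $ 1\<bar> \<le> \<bar>\<zeta> $ 2\<bar> / 4" using \<epsilon> by (simp add: abs_mult)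
    have "3 / 4 * \<bar>\<zeta> $ 2\<bar> \<le> \<bar>cos \<alpha> * \<zeta> $ 2\<bar>"
      unfolding abs_mult using c by (intro mult_right_mono) auto
    then have sc: "\<bar>\<zeta> $ 2\<bar> / 2 \<le> \<bar>sin \<alpha> * \<zeta> $ 1 + cos \<alpha> * \<zeta> $ 2\<bar>" using s by linarith
    have "sin (\<beta> + \<theta>\<^sub>0) = sin \<alpha>" "cos (\<beta> + \<theta>\<^sub>0) = cos \<alpha>"
      by (simp_all add: \<alpha>_def sin_diff cos_diff)
    have "(rot \<beta> *v \<xi>) $ 2 = sin \<alpha> * \<zeta> $ 1 + cos \<alpha> * \<zeta> $ 2"
      unfolding \<xi>\<zeta> by (simp add: rot_mult_vec sin_add cos_add flip: \<open>sin (\<beta> + \<theta>\<^sub>0) = sin \<alpha>\<close> \<open>cos (\<beta> + \<theta>\<^sub>0) = cos \<alpha>\<close>)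
        (simp add: algebra_simps)
    then have "\<bar>(B_dual j (k j) *v \<xi>) $ 2\<bar> \<ge> \<bar>\<zeta> $ 2\<bar> / 2 / 2 ^ j"
      using divide_right_mono[OF sc, of "2 ^ j"] by (simp add: B_dual_mult_vec \<beta>_def abs_divide)
    then have b: "\<bar>\<zeta> $ 2\<bar> / 2 / 2 ^ j \<le> norm (B_dual j (k j) *v \<xi>)"
      using component_le_norm_cart order_trans by blast
    have "norm \<xi> = norm \<zeta>" by (simp add: \<zeta>_def)
    also have "\<dots> \<le> \<bar>\<zeta> $ 1\<bar> + \<bar>\<zeta> $ 2\<bar>" by (rule norm_le_l1_vec2)
    also have "\<dots> \<le> (1 + 1 / \<epsilon>) * \<bar>\<zeta> $ 2\<bar>" using z by (simp add: algebra_simps)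
    finally have "\<kappa> * norm \<xi> \<le> \<kappa> * ((1 + 1 / \<epsilon>) * \<bar>\<zeta> $ 2\<bar>)" using \<kappa> by (intro mult_left_mono) auto
    also have "\<dots> = \<bar>\<zeta> $ 2\<bar> / 2"
    proof -
      have "1 / (2 * c) * (c * y) = y / 2" if "c > 0" for c y :: real using that by simp
      moreover have "1 + 1 / \<epsilon> > 0" using \<epsilon> by (simp add: add_pos_pos)
      ultimately show ?thesis unfolding \<kappa>_def by blast
    qed
    finally have "\<kappa> * norm \<xi> / 2 ^ j \<le> \<bar>\<zeta> $ 2\<bar> / 2 / 2 ^ j" by (rule divide_right_mono) simp
    then show "\<kappa> * norm \<xi> / 2 ^ j \<le> norm (B_dual j (k j) *v \<xi>)" using b by linarith
  qed
qed

section \<open>The part of the distribution away from the base point\<close>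

lemma pderiv_dir_zero_on_open:
  assumes "open U" "\<And>x. x \<in> U \<Longrightarrow> h x = 0" "x \<in> U"
  shows "pderiv_dir i h x = 0"
proof -
  have "(h has_derivative (\<lambda>_. 0)) (at x)"
    by (rule has_derivative_transform_within_open[of "\<lambda>_. 0" _ x UNIV U]) (use assms in auto)
  then show ?thesis by (rule pderiv_dir_eqI)
qed

lemma pderivs_zero_on_open:
  assumes "open U" "\<And>x. x \<in> U \<Longrightarrow> h x = 0" "x \<in> U"
  shows "pderivs is h x = 0"
  using assms(3)
proof (induction "is" arbitrary: x)
  case (Cons i "is")
  then show ?case using pderiv_dir_zero_on_open[OF assms(1), of "pderivs is h" x i] by simp
qed (use assms in simp)

text \<open>The complement of the closed support is open, so all derivatives vanish there; on the
  compact support they are bounded by continuity.\<close>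

lemma slowly_growing_compact_support:
  assumes "smooth \<eta>" and c: "compact (closure {x. \<eta> x \<noteq> 0})"
  shows "\<eta> \<in> slowly_growing"
proof -
  define K where "K = closure {x. \<eta> x \<noteq> 0}"
  have 0: "\<eta> x = 0" if "x \<in> - K" for x
  proof (rule ccontr)
    assume "\<eta> x \<noteq> 0"
    then have "x \<in> {x. \<eta> x \<noteq> 0}" by simp
    then have "x \<in> K" unfolding K_def by (rule subsetD[OF closure_subset])
    with that show False by simp
  qed
  have "open (- K)" unfolding K_def by (intro open_Compl closed_closure)
  then have z: "pderivs is \<eta> x = 0" if "x \<in> - K" for "is" x
    by (rule pderivs_zero_on_open[OF _ 0 that])
  have "\<exists>N C. \<forall>x. cmod (pderivs is \<eta> x) \<le> C * (1 + norm x) ^ N" for "is"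
  proof -
    have "continuous_on K (pderivs is \<eta>)"
      using assms(1) unfolding smooth_def
      by (intro continuous_at_imp_continuous_on ballI differentiable_imp_continuous_within) simp
    then have "bounded (pderivs is \<eta> ` K)" by (intro compact_imp_bounded compact_continuous_image c[folded K_def])
    then obtain C where C: "\<And>x. x \<in> K \<Longrightarrow> cmod (pderivs is \<eta> x) \<le> C" by (auto simp: bounded_iff)
    have "cmod (pderivs is \<eta> x) \<le> \<bar>C\<bar> * (1 + norm x) ^ 0" for x
    proof (cases "x \<in> K")
      case True
      then show ?thesis using C[of x] by simp
    next
      case False
      then have "pderivs is \<eta> x = 0" using z[of x] by simp
      then show ?thesis by simp
    qed
    then show ?thesis by blast
  qed
  then show ?thesis using assms(1) by (simp add: slowly_growing_def)
qed

lemma slowly_growing_diff: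
  assumes "f \<in> slowly_growing" "g \<in> slowly_growing"
  shows "(\<lambda>x. f x - g x) \<in> slowly_growing"
proof (rule slowly_growing_coinduct[where S = "(\<lambda>(f, g) x. f x - g x) ` (slowly_growing \<times> slowly_growing)"])
  show "(\<lambda>x. f x - g x) \<in> (\<lambda>(f, g) x. f x - g x) ` (slowly_growing \<times> slowly_growing)"
    using assms by (intro rev_image_eqI[of "(f, g)"]) auto
  fix h :: "real^2 \<Rightarrow> complex"
  assume "h \<in> (\<lambda>(f, g) x. f x - g x) ` (slowly_growing \<times> slowly_growing)"
  then obtain f g where fg: "f \<in> slowly_growing" "g \<in> slowly_growing" "h = (\<lambda>x. f x - g x)" by auto
  have D: "(h has_derivative (\<lambda>v. frechet_derivative f (at x) v - frechet_derivative g (at x) v)) (at x)" for x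
    unfolding fg(3) using fg slowly_growing_differentiable frechet_derivative_works
    by (intro has_derivative_diff) blast+
  then show "h differentiable at x" for x using differentiableI by blast
  have "pderiv_dir i h = (\<lambda>x. pderiv_dir i f x - pderiv_dir i g x)" for i
    using pderiv_dir_eqI[OF D] by (simp add: fun_eq_iff pderiv_dir_def)
  then show "pderiv_dir i h \<in> (\<lambda>(f, g) x. f x - g x) ` (slowly_growing \<times> slowly_growing)" for i
    using fg slowly_growing_pderiv_dir by (intro rev_image_eqI[of "(pderiv_dir i f, pderiv_dir i g)"]) auto
  obtain N C where 1: "C \<ge> 0" "\<And>x. cmod (f x) \<le> C * (1 + norm x) ^ N" using slowly_growing_bound[OF fg(1)] by metis
  obtain N' C' where 2: "C' \<ge> 0" "\<And>x. cmod (g x) \<le> C' * (1 + norm x) ^ N'" using slowly_growing_bound[OF fg(2)] by metis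
  have "cmod (h x) \<le> (C + C') * (1 + norm x) ^ (N + N')" for x
  proof -
    have "cmod (h x) \<le> cmod (f x) + cmod (g x)" unfolding fg(3) by (rule norm_triangle_ineq4)
    also have "\<dots> \<le> C * (1 + norm x) ^ N + C' * (1 + norm x) ^ N'" by (intro add_mono 1 2)
    also have "\<dots> \<le> C * (1 + norm x) ^ (N + N') + C' * (1 + norm x) ^ (N + N')"
      using 1 2 by (intro add_mono mult_left_mono power_increasing) auto
    finally show ?thesis by (simp add: distrib_right)
  qed
  then show "\<exists>N C. \<forall>x. cmod (h x) \<le> C * (1 + norm x) ^ N" by blast
qed

lemma packet_span_pderivs:
  assumes F: "F \<in> packet_span T A l"
    and T: "T \<subseteq> slowly_growing" "\<And>\<eta> i. \<eta> \<in> T \<Longrightarrow> pderiv_dir i \<eta> \<in> T"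
    and A: "K \<ge> 1" "\<And>j m i. \<bar>A j $ m $ i\<bar> \<le> K ^ Suc j"
  shows "(\<lambda>j. pderivs is (F j)) \<in> packet_span T A l"
proof (induction "is")
  case (Cons i "is")
  show ?case using packet_span_deriv[OF Cons.IH T A, of i] by simp
qed (use F in simp)

text \<open>Only finitely many derivatives enter the norm, each of them is again a packet family,
  and their constants can be added up.\<close>

lemma packet_span_schwartz_norm:
  assumes F: "F \<in> packet_span T A l"
    and T: "T \<subseteq> slowly_growing" "\<And>\<eta> i. \<eta> \<in> T \<Longrightarrow> pderiv_dir i \<eta> \<in> T"
      "\<And>\<eta> x. \<eta> \<in> T \<Longrightarrow> x \<notin> X \<Longrightarrow> \<eta> x = 0"
    and A: "K \<ge> 1" "\<And>j m i. \<bar>A j $ m $ i\<bar> \<le> K ^ Suc j"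
    and K': "\<And>j x. j \<in> J \<Longrightarrow> x \<in> X \<Longrightarrow> 2 ^ j \<le> K' * (1 + norm (A j *v x - l j))"
      "\<And>j x. j \<in> J \<Longrightarrow> x \<in> X \<Longrightarrow> 1 + norm x \<le> K' * (1 + norm (A j *v x - l j))"
  shows "\<exists>C. \<forall>j\<in>J. 0 \<le> schwartz_norm N (F j) \<and> schwartz_norm N (F j) \<le> C / (2 ^ j) ^ Q"
proof -
  have "\<exists>C. \<forall>j\<in>J. \<forall>x. (2 ^ j) ^ Q * ((1 + norm x) ^ N * cmod (pderivs is (F j) x)) \<le> C" for "is"
  proof (rule packet_span_decay[where K = K' and X = X])
    show "(\<lambda>j. pderivs is (F j)) \<in> packet_span T A l"
      by (rule packet_span_pderivs) (use F T A in auto)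
  qed (use T K' in auto)
  then have "\<exists>C. \<forall>is. \<forall>j\<in>J. \<forall>x. (2 ^ j) ^ Q * ((1 + norm x) ^ N * cmod (pderivs is (F j) x)) \<le> C is"
    by (intro choice allI)
  then obtain C where C: "\<And>is j x. j \<in> J \<Longrightarrow> (2 ^ j) ^ Q * ((1 + norm x) ^ N * cmod (pderivs is (F j) x)) \<le> C is"
    by blast
  have fin: "finite {is :: 2 list. length is \<le> N}"
    using finite_lists_length_le[of "UNIV :: 2 set" N] by simp
  define D where "D = (\<Sum>is | length is \<le> N. \<bar>C is\<bar>)"
  have "0 \<le> schwartz_norm N (F j) \<and> schwartz_norm N (F j) \<le> D / (2 ^ j) ^ Q" if j: "j \<in> J" for j
  proof -
    have le: "(1 + norm x) ^ N * cmod (pderivs is (F j) x) \<le> D / (2 ^ j) ^ Q" if "length is \<le> N" for "is" x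
    proof -
      have "(2 ^ j) ^ Q * ((1 + norm x) ^ N * cmod (pderivs is (F j) x)) \<le> \<bar>C is\<bar>"
        using C[OF j, of x "is"] by linarith
      also have "\<dots> \<le> D"
        unfolding D_def using fin that by (intro member_le_sum) auto
      finally show ?thesis by (simp add: pos_le_divide_eq mult_ac)
    qed
    let ?I = "{is :: 2 list. length is \<le> N} \<times> (UNIV :: (real^2) set)"
    let ?v = "\<lambda>(is, x). (1 + norm x) ^ N * cmod (pderivs is (F j) x)"
    \<comment> \<open>The real-valued \<open>SUP\<close> is meaningful only for a set that is
      bounded above.\<close>
    have bdd: "bdd_above (?v ` ?I)" using le by (intro bdd_aboveI2) auto
    have I0: "([], 0) \<in> ?I" by simp
    with bdd have "0 \<le> (SUP p\<in>?I. ?v p)"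
      by (intro cSUP_upper2[of _ _ "([], 0)"]) simp_all
    moreover have "(SUP p\<in>?I. ?v p) \<le> D / (2 ^ j) ^ Q"
    proof (rule cSUP_least)
      show "?I \<noteq> {}" using I0 by blast
    qed (use le in auto)
    ultimately show ?thesis unfolding schwartz_norm_def by blast
  qed
  then show ?thesis by blast
qed

lemma A_mat_entry_le: "\<bar>A_mat j k $ m $ i\<bar> \<le> 8 ^ Suc j"
proof -
  have "\<bar>A_mat j k $ m $ i\<bar> \<le> 4 ^ j"
  proof -
    have "m = 1 \<or> m = 2" "i = 1 \<or> i = 2" using exhaust_2 by blast+
    moreover have "(2::real) ^ j \<le> 4 ^ j" by (intro power_mono) auto
    moreover have "\<bar>(2::real) ^ j * c\<bar> \<le> 2 ^ j" "\<bar>(4::real) ^ j * c\<bar> \<le> 4 ^ j" if "\<bar>c\<bar> \<le> 1" for c :: real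
      using that by (auto simp: abs_mult mult_left_le)
    ultimately show ?thesis
      unfolding A_mat_def dil_def rot_def
      by (elim disjE) (auto simp: matrix_matrix_mult_def sum_2 intro: order_trans[of _ "2 ^ j"])
  qed
  also have "\<dots> \<le> 8 ^ j" by (intro power_mono) auto
  also have "\<dots> \<le> 8 ^ Suc j" by simp
  finally show ?thesis .
qed

text \<open>On the support of \<open>1 - \<eta>\<close> the distance to \<open>x\<^sub>0\<close> is
  bounded below, and \<open>A_mat\<close> stretches it by at least \<open>2 ^ j\<close>, whereas the
  centre \<open>l j\<close> stays within \<open>L\<close> of the image of \<open>x\<^sub>0\<close>.
  Schwartz decay thus yields any power of \<open>2 ^ j\<close>, whatever the derivatives cost. The
  order \<open>Q\<close> is left free, to be chosen according to \<open>s\<close>.\<close>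

lemma tail_estimate:
  assumes f: "tempered_distribution f" and \<phi>: "\<phi> \<in> schwartz"
    and \<eta>: "smooth \<eta>" "compact (closure {x. \<eta> x \<noteq> 0})" "\<forall>\<^sub>F x in nhds x\<^sub>0. \<eta> x = 1"
    and grid: "\<And>j. j \<ge> 1 \<Longrightarrow> norm (A_mat j (k j) *v x\<^sub>0 - l j) \<le> L"
  shows "\<exists>C\<ge>0. \<forall>j\<ge>1. cmod (f (\<lambda>x. (1 - \<eta> x) * cnj (wavepacket \<phi> j (k j) (l j) x))) \<le> C / (2 ^ j) ^ Q"
proof -
  let ?A = "\<lambda>j. A_mat j (k j)"
  obtain r where r: "r > 0" "\<And>x. x \<in> ball x\<^sub>0 r \<Longrightarrow> \<eta> x = 1"
    using \<eta>(3) unfolding eventually_nhds_metric by (metis dist_commute mem_ball)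
  \<comment> \<open>Vanishing on an open ball is inherited by derivatives, which makes this class of
    multipliers stable under differentiation; it need not consist of derivatives of
    \<open>1 - \<eta>\<close> alone.\<close>
  define T where "T = {h \<in> slowly_growing. \<forall>x\<in>ball x\<^sub>0 r. h x = 0}"
  have T: "T \<subseteq> slowly_growing" "\<And>h i. h \<in> T \<Longrightarrow> pderiv_dir i h \<in> T"
    "\<And>h x. h \<in> T \<Longrightarrow> x \<notin> - ball x\<^sub>0 r \<Longrightarrow> h x = 0"
    using slowly_growing_pderiv_dir pderiv_dir_zero_on_open[of "ball x\<^sub>0 r"]
    by (auto simp: T_def)
  have 1: "(\<lambda>x. 1 - \<eta> x) \<in> T"
    unfolding T_def using slowly_growing_diff slowly_growing_const slowly_growing_compact_support \<eta> r by auto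
  define F where "F j x = of_real (8 powr (real j / 2)) * ((1 - \<eta> x) * cnj (\<phi> (?A j *v x - l j)))" for j x
  have "cmod (of_real (8 powr (real j / 2))) \<le> 8 ^ Suc j" for j
  proof -
    have "8 powr (real j / 2) \<le> 8 powr real (Suc j)" by (intro powr_mono) auto
    then show ?thesis by (simp only: powr_realpow) simp
  qed
  then have c: "\<exists>K\<ge>1. \<forall>j. cmod (of_real (8 powr (real j / 2))) \<le> K ^ Suc j"
    by (intro exI[of _ 8]) auto
  have F: "F \<in> packet_span T ?A l"
    unfolding F_def using packet_span.prod[OF 1 schwartz_cnj[OF \<phi>] c] .
  \<comment> \<open>The order \<open>N\<close> is dictated by \<open>f\<close> and is beyond
    control, hence the need for decay of every derivative.\<close>
  obtain N C0 where f0: "\<And>\<psi>. \<psi> \<in> schwartz \<Longrightarrow> cmod (f \<psi>) \<le> C0 * schwartz_norm N \<psi>"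
    using f unfolding tempered_distribution_def by blast
  define L' where "L' = \<bar>L\<bar>"
  \<comment> \<open>The second summand gives the bound on \<open>2 ^ j\<close> outside the ball, the
    first the bound on \<open>1 + norm x\<close> everywhere.\<close>
  define K' where "K' = (1 + norm x\<^sub>0) * (2 + L') + (1 + L') / r"
  have K'1: "K' \<ge> (1 + norm x\<^sub>0) * (2 + L')" and K'2: "K' \<ge> (1 + L') / r"
    using r by (auto simp: K'_def L'_def)
  have far: "2 ^ j * norm (x - x\<^sub>0) \<le> (1 + L') * (1 + norm (?A j *v x - l j))" if "j \<ge> 1" for j x
  proof -
    have "2 ^ j * norm (x - x\<^sub>0) \<le> norm (?A j *v (x - x\<^sub>0))" by (rule norm_A_mat_ge)
    also have "?A j *v (x - x\<^sub>0) = (?A j *v x - l j) - (?A j *v x\<^sub>0 - l j)"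
      by (simp add: matrix_vector_mult_diff_distrib)
    also have "norm \<dots> \<le> norm (?A j *v x - l j) + norm (?A j *v x\<^sub>0 - l j)"
      by (rule norm_triangle_ineq4)
    also have "\<dots> \<le> norm (?A j *v x - l j) + L'" using grid[OF that] by (simp add: L'_def)
    also have "\<dots> \<le> (1 + L') * (1 + norm (?A j *v x - l j))" by (simp add: algebra_simps L'_def)
    finally show ?thesis .
  qed
  have k1: "2 ^ j \<le> K' * (1 + norm (?A j *v x - l j))" if "j \<in> {1..}" "x \<in> - ball x\<^sub>0 r" for j x
  proof -
    have "r \<le> norm (x - x\<^sub>0)" using that by (simp add: dist_norm norm_minus_commute)
    then have "2 ^ j * r \<le> 2 ^ j * norm (x - x\<^sub>0)" by (intro mult_left_mono) auto
    also have "\<dots> \<le> (1 + L') * (1 + norm (?A j *v x - l j))" using far that by auto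
    finally have "2 ^ j \<le> (1 + L') / r * (1 + norm (?A j *v x - l j))" using r by (simp add: pos_le_divide_eq)
    also have "\<dots> \<le> K' * (1 + norm (?A j *v x - l j))" using K'2 by (intro mult_right_mono) auto
    finally show ?thesis .
  qed
  have k2: "1 + norm x \<le> K' * (1 + norm (?A j *v x - l j))" if "j \<in> {1..}" for j x
  proof -
    let ?y = "1 + norm (?A j *v x - l j)"
    have "norm (x - x\<^sub>0) \<le> 2 ^ j * norm (x - x\<^sub>0)" by (simp add: mult_le_cancel_right1)
    also have "\<dots> \<le> (1 + L') * ?y" using far that by auto
    finally have d: "norm (x - x\<^sub>0) \<le> (1 + L') * ?y" .
    have y: "1 \<le> ?y" by simp
    have "1 + norm x \<le> 1 + (norm x\<^sub>0 + norm (x - x\<^sub>0))"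
      using norm_triangle_sub[of x x\<^sub>0] by linarith
    also have "\<dots> \<le> (1 + norm x\<^sub>0) * (1 + norm (x - x\<^sub>0))" by (simp add: algebra_simps)
    also have "\<dots> \<le> (1 + norm x\<^sub>0) * (?y + (1 + L') * ?y)"
      using d y by (intro mult_left_mono add_mono) auto
    also have "\<dots> = (1 + norm x\<^sub>0) * (2 + L') * ?y" by (simp add: algebra_simps)
    also have "\<dots> \<le> K' * ?y" using K'1 by (intro mult_right_mono) auto
    finally show ?thesis .
  qed
  have "\<exists>C. \<forall>j\<in>{1..}. 0 \<le> schwartz_norm N (F j) \<and> schwartz_norm N (F j) \<le> C / (2 ^ j) ^ Q"
  proof (rule packet_span_schwartz_norm[where K = 8 and K' = K' and X = "- ball x\<^sub>0 r"])
    show "F \<in> packet_span T ?A l" by (rule F)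
  qed (use T k1 k2 A_mat_entry_le in auto)
  then obtain C where C: "\<And>j. j \<ge> 1 \<Longrightarrow> 0 \<le> schwartz_norm N (F j) \<and> schwartz_norm N (F j) \<le> C / (2 ^ j) ^ Q"
    by auto
  have "cmod (f (\<lambda>x. (1 - \<eta> x) * cnj (wavepacket \<phi> j (k j) (l j) x))) \<le> (\<bar>C0\<bar> * \<bar>C\<bar>) / (2 ^ j) ^ Q" if j: "j \<ge> 1" for j
  proof -
    have Fj: "(\<lambda>x. (1 - \<eta> x) * cnj (wavepacket \<phi> j (k j) (l j) x)) = F j"
      by (simp add: F_def wavepacket_def fun_eq_iff mult_ac)
    have "F j \<in> schwartz"
      by (rule packet_span_schwartz[OF F T(1,2) _ A_mat_entry_le])
         (use invertible_A_mat in auto)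
    then have "cmod (f (F j)) \<le> C0 * schwartz_norm N (F j)" by (rule f0)
    also have "\<dots> \<le> \<bar>C0\<bar> * (\<bar>C\<bar> / (2 ^ j) ^ Q)"
    proof (intro mult_mono)
      have "C / (2 ^ j) ^ Q \<le> \<bar>C\<bar> / (2 ^ j) ^ Q" by (intro divide_right_mono) auto
      then show "schwartz_norm N (F j) \<le> \<bar>C\<bar> / (2 ^ j) ^ Q" using C[OF j] by linarith
    qed (use C[OF j] in auto)
    finally show ?thesis unfolding Fj by simp
  qed
  then show ?thesis by (intro exI[of _ "\<bar>C0\<bar> * \<bar>C\<bar>"]) auto
qed

section \<open>Summation over the scales\<close>

text \<open>On each side of \<open>n\<close> the distance to \<open>n\<close> is injective in
  \<open>j\<close>, so either part of the sum is at most one full geometric series.\<close>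

lemma geometric_two_sided:
  fixes r :: real
  assumes r: "0 < r" "r < 1" and F: "finite F"
  shows "(\<Sum>j\<in>F. r ^ nat \<bar>n - int j\<bar>) \<le> 2 / (1 - r)"
proof -
  have inj: "(\<Sum>j\<in>E. r ^ nat \<bar>n - int j\<bar>) \<le> 1 / (1 - r)" if E: "inj_on (\<lambda>j. nat \<bar>n - int j\<bar>) E" "E \<subseteq> F" for E
  proof -
    have "(\<Sum>j\<in>E. r ^ nat \<bar>n - int j\<bar>) = (\<Sum>i\<in>(\<lambda>j. nat \<bar>n - int j\<bar>) ` E. r ^ i)"
      by (simp add: sum.reindex[OF E(1)])
    also have "\<dots> \<le> (\<Sum>i. r ^ i)"
      using r F E finite_subset by (intro sum_le_suminf summable_geometric) auto
    finally show ?thesis using r by (simp add: suminf_geometric)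
  qed
  let ?E = "{j\<in>F. int j \<le> n}" and ?E' = "{j\<in>F. \<not> int j \<le> n}"
  have "(\<Sum>j\<in>F. r ^ nat \<bar>n - int j\<bar>) = (\<Sum>j\<in>?E. r ^ nat \<bar>n - int j\<bar>) + (\<Sum>j\<in>?E'. r ^ nat \<bar>n - int j\<bar>)"
    using F by (subst sum.union_disjoint[symmetric]) (auto intro!: sum.cong)
  also have "\<dots> \<le> 1 / (1 - r) + 1 / (1 - r)"
    by (intro add_mono inj) (auto simp: inj_on_def)
  finally show ?thesis by simp
qed

text \<open>On the logarithmic scale the terms are
  \<open>4 powr (- a * \<bar>p - real j\<bar>)\<close>. Rounding \<open>p\<close> to an integer
  costs at most the factor \<open>1 / r\<close>, and a two-sided geometric sum remains, bounded
  uniformly in the position of \<open>p\<close>.\<close>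

lemma dyadic_sum_bound:
  fixes a :: real
  assumes "a > 0"
  obtains C where "C \<ge> 0"
    "\<And>\<tau> F. \<tau> > 0 \<Longrightarrow> finite F \<Longrightarrow> (\<Sum>j\<in>F. min ((\<tau> / 4 ^ j) powr a) ((\<tau> / 4 ^ j) powr - a)) \<le> C"
proof -
  define r where "r = 4 powr - a"
  have r: "0 < r" "r < 1" using assms by (auto simp: r_def powr_less_one)
  show ?thesis
  proof (rule that)
    show "0 \<le> 1 / r * (2 / (1 - r))" using r by simp
    fix \<tau> :: real and F :: "nat set" assume \<tau>: "\<tau> > 0" and F: "finite F"
    define p where "p = log 4 \<tau>"
    define n where "n = \<lfloor>p\<rfloor>"
    have n: "real_of_int n \<le> p" "p < real_of_int n + 1" by (auto simp: n_def)
    have t: "\<tau> / 4 ^ j = 4 powr (p - real j)" for j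
      using \<tau> by (simp add: p_def powr_diff powr_realpow)
    have "min ((\<tau> / 4 ^ j) powr a) ((\<tau> / 4 ^ j) powr - a) \<le> 1 / r * r ^ nat \<bar>n - int j\<bar>" for j
    proof (cases "int j \<le> n")
      case True
      have "(\<tau> / 4 ^ j) powr - a = 4 powr (- a * (p - real j))"
        unfolding t powr_powr by (simp add: mult.commute)
      also have "\<dots> \<le> 4 powr (- a * (real_of_int n - real j))"
        using n assms by (intro powr_mono) auto
      also have "\<dots> = r powr (real_of_int n - real j)" by (simp add: r_def powr_powr)
      also have "real_of_int n - real j = real (nat \<bar>n - int j\<bar>)" using True by simp
      also have "r powr real (nat \<bar>n - int j\<bar>) = r ^ nat \<bar>n - int j\<bar>" by (rule powr_realpow[OF r(1)])
      also have "\<dots> \<le> 1 / r * r ^ nat \<bar>n - int j\<bar>" using r by (simp add: field_simps)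
      finally show ?thesis by simp
    next
      case False
      have "(\<tau> / 4 ^ j) powr a = 4 powr (a * (p - real j))"
        unfolding t powr_powr by (simp add: mult.commute)
      also have "\<dots> \<le> 4 powr (a * (real_of_int n + 1 - real j))"
        using n assms by (intro powr_mono) auto
      also have "\<dots> = 4 powr (- a * ((real j - real_of_int n) - 1))" by (simp add: algebra_simps)
      also have "\<dots> = r powr ((real j - real_of_int n) - 1)" by (simp only: r_def powr_powr)
      also have "\<dots> = r powr (real j - real_of_int n) / r" using r by (simp add: powr_diff)
      also have "real j - real_of_int n = real (nat \<bar>n - int j\<bar>)" using False by simp
      also have "r powr real (nat \<bar>n - int j\<bar>) / r = 1 / r * r ^ nat \<bar>n - int j\<bar>"
        unfolding powr_realpow[OF r(1)] by simp
      finally show ?thesis by simp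
    qed
    then have "(\<Sum>j\<in>F. min ((\<tau> / 4 ^ j) powr a) ((\<tau> / 4 ^ j) powr - a)) \<le> (\<Sum>j\<in>F. 1 / r * r ^ nat \<bar>n - int j\<bar>)"
      by (intro sum_mono)
    also have "\<dots> = 1 / r * (\<Sum>j\<in>F. r ^ nat \<bar>n - int j\<bar>)" by (simp only: sum_distrib_left)
    also have "\<dots> \<le> 1 / r * (2 / (1 - r))"
      using geometric_two_sided[OF r F] r by (intro mult_left_mono) auto
    finally show "(\<Sum>j\<in>F. min ((\<tau> / 4 ^ j) powr a) ((\<tau> / 4 ^ j) powr - a)) \<le> 1 / r * (2 / (1 - r))" .
  qed
qed

text \<open>The power is dominated through \<open>(1 + z / N) ^ N \<le> exp z\<close> at
  \<open>z = d * (1 + x\<^sup>2)\<close>; the exponential of \<open>d * x\<^sup>2\<close> then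
  cancels and only \<open>exp d\<close> is left.\<close>

lemma powr_times_gaussian_bounded:
  fixes d m :: real
  assumes d: "d > 0"
  obtains D where "D > 0" "\<And>x. x \<ge> 0 \<Longrightarrow> (1 + x) powr m * exp (- d * x\<^sup>2) \<le> D"
proof -
  obtain n :: nat where n: "m \<le> real n" using real_arch_simple by blast
  define N where "N = Suc n"
  have N: "m \<le> real N" "N > 0" using n by (simp_all add: N_def)
  \<comment> \<open>Chosen so that the power of \<open>2 * (1 + x\<^sup>2)\<close> becomes
    \<open>c\<close> times the power of \<open>z / N\<close>.\<close>
  define c where "c = (2 * real N / d) ^ N"
  have c: "c > 0" using d N by (simp add: c_def)
  show ?thesis
  proof (rule that)
    show "c * exp d > 0" using c by simp
    fix x :: real assume x: "x \<ge> 0"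
    have "(1 + x) powr m \<le> (1 + x) powr real N" using x N by (intro powr_mono) auto
    also have "\<dots> = (1 + x) ^ N" using x by (simp add: powr_realpow)
    also have "\<dots> \<le> (2 * (1 + x\<^sup>2)) ^ N"
    proof (intro power_mono)
      have "0 \<le> (x - 1)\<^sup>2 + x\<^sup>2 + x" using x by simp
      then show "1 + x \<le> 2 * (1 + x\<^sup>2)" by (simp add: power2_eq_square algebra_simps)
    qed (use x in auto)
    also have "\<dots> = c * (d * (1 + x\<^sup>2) / real N) ^ N"
      using d N by (simp add: c_def flip: power_mult_distrib)
    also have "\<dots> \<le> c * exp (d * (1 + x\<^sup>2))"
    proof (intro mult_left_mono)
      have "(d * (1 + x\<^sup>2) / real N) ^ N \<le> (1 + d * (1 + x\<^sup>2) / real N) ^ N"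
        using d by (intro power_mono) auto
      also have "\<dots> \<le> exp (d * (1 + x\<^sup>2))"
      proof (rule exp_ge_one_plus_x_over_n_power_n)
        have "0 \<le> d * (1 + x\<^sup>2)" using d by simp
        then show "- real N \<le> d * (1 + x\<^sup>2)" using N by linarith
      qed (use N in auto)
      finally show "(d * (1 + x\<^sup>2) / real N) ^ N \<le> exp (d * (1 + x\<^sup>2))" .
    qed (use c in auto)
    finally have "(1 + x) powr m * exp (- d * x\<^sup>2) \<le> c * exp (d * (1 + x\<^sup>2)) * exp (- d * x\<^sup>2)"
      by (rule mult_right_mono) simp
    also have "\<dots> = c * exp d" by (simp add: mult.assoc exp_add[symmetric] algebra_simps)
    finally show "(1 + x) powr m * exp (- d * x\<^sup>2) \<le> c * exp d" .
  qed
qed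

text \<open>A radial majorant for squared packet transforms. The Gaussian has rate \<delta> although
  squaring produces twice that rate: the other half is reserved for the weight in
  Cauchy-Schwarz.\<close>

definition profile :: "real \<Rightarrow> real \<Rightarrow> real \<Rightarrow> real" where
  "profile \<sigma> \<delta> t = (min 1 (t powr \<sigma>))\<^sup>2 * exp (- \<delta> * t\<^sup>2)"

lemma profile_nonneg: "0 \<le> profile \<sigma> \<delta> t"
  by (simp add: profile_def)

lemma profile_measurable [measurable]: "profile \<sigma> \<delta> \<in> borel_measurable borel"
  unfolding profile_def by measurable

text \<open>With \<open>t = \<tau> / 4 ^ j\<close> the weight \<open>4 powr (2 * real j * s)\<close>
  equals \<open>\<tau> powr (2 * s) * t powr (- 2 * s)\<close>. Near 0 the vanishing leaves the
  positive order \<open>2 * (\<sigma> - s)\<close>, and for large \<open>t\<close> the Gaussian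
  beats every power, so the terms decay geometrically on both sides of
  \<open>4 ^ j = \<tau>\<close>.\<close>

lemma profile_sum_bound:
  fixes s \<sigma> \<delta> :: real
  assumes s: "s \<ge> 0" "\<sigma> > s" and \<delta>: "\<delta> > 0"
  obtains D where "D \<ge> 0"
    "\<And>\<tau> n. \<tau> \<ge> 0 \<Longrightarrow> (\<Sum>j<n. 4 powr (2 * real j * s) * profile \<sigma> \<delta> (\<tau> / 4 ^ j)) \<le> D * \<tau> powr (2 * s)"
proof -
  define a where "a = 2 * (\<sigma> - s)"
  have a: "a > 0" using s by (simp add: a_def)
  obtain D1 where D1: "D1 > 0" "\<And>x. x \<ge> 0 \<Longrightarrow> (1 + x) powr a * exp (- \<delta> * x\<^sup>2) \<le> D1"
    using powr_times_gaussian_bounded[OF \<delta>] by blast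
  obtain C where C: "C \<ge> 0"
    "\<And>\<tau> F. \<tau> > 0 \<Longrightarrow> finite F \<Longrightarrow> (\<Sum>j\<in>F. min ((\<tau> / 4 ^ j) powr a) ((\<tau> / 4 ^ j) powr - a)) \<le> C"
    using dyadic_sum_bound[OF a] by blast
  have main: "t powr (- 2 * s) * profile \<sigma> \<delta> t \<le> (1 + D1) * min (t powr a) (t powr - a)" if t: "t > 0" for t
  proof (cases "t \<le> 1")
    case True
    have "t powr (- 2 * s) * profile \<sigma> \<delta> t \<le> t powr (- 2 * s) * ((t powr \<sigma>)\<^sup>2 * 1)"
      unfolding profile_def using \<delta> by (intro mult_left_mono mult_mono power_mono) auto
    also have "\<dots> = t powr a"
      by (simp add: a_def powr_add[symmetric] powr_power[symmetric] power2_eq_square algebra_simps)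
    also have "\<dots> = min (t powr a) (t powr - a)"
    proof -
      have "t powr a \<le> t powr (- a)" using True t a by (intro powr_mono') auto
      then show ?thesis by simp
    qed
    also have "\<dots> \<le> (1 + D1) * min (t powr a) (t powr - a)"
      using D1 mult_right_mono[of 1 "1 + D1" "min (t powr a) (t powr - a)"] by simp
    finally show ?thesis .
  next
    case False
    have "t powr (- 2 * s) * profile \<sigma> \<delta> t \<le> 1 * (1 * exp (- \<delta> * t\<^sup>2))"
    proof (intro mult_mono)
      show "t powr (- 2 * s) \<le> 1" using False s powr_mono[of "- 2 * s" 0 t] by simp
      show "profile \<sigma> \<delta> t \<le> 1 * exp (- \<delta> * t\<^sup>2)"
        unfolding profile_def by (intro mult_right_mono power_le_one) auto
    qed (auto simp: profile_nonneg)
    also have "1 * (1 * exp (- \<delta> * t\<^sup>2)) \<le> D1 * t powr - a"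
    proof -
      have "t powr a * exp (- \<delta> * t\<^sup>2) \<le> (1 + t) powr a * exp (- \<delta> * t\<^sup>2)"
        using t a by (intro mult_right_mono powr_mono2) auto
      also have "\<dots> \<le> D1" using D1 t by simp
      finally show ?thesis using t by (simp add: powr_minus field_simps)
    qed
    also have "\<dots> \<le> (1 + D1) * (t powr - a)" by (intro mult_right_mono) auto
    also have "t powr - a = min (t powr a) (t powr - a)"
    proof -
      have "t powr (- a) \<le> t powr a" using False t a by (intro powr_mono) auto
      then show ?thesis by simp
    qed
    finally show ?thesis .
  qed
  show ?thesis
  proof (rule that)
    show "0 \<le> (1 + D1) * C" using D1 C by simp
    fix \<tau> :: real and n :: nat assume "\<tau> \<ge> 0"
    show "(\<Sum>j<n. 4 powr (2 * real j * s) * profile \<sigma> \<delta> (\<tau> / 4 ^ j)) \<le> (1 + D1) * C * \<tau> powr (2 * s)"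
    \<comment> \<open>As \<open>powr\<close> with base 0 is 0 for every exponent, both sides vanish
      in this case, even for \<open>s = 0\<close>.\<close>
    proof (cases "\<tau> = 0")
      case True
      then show ?thesis by (simp add: profile_def)
    next
      case False
      with \<open>\<tau> \<ge> 0\<close> have \<tau>: "\<tau> > 0" by simp
      have "4 powr (2 * real j * s) * profile \<sigma> \<delta> (\<tau> / 4 ^ j) \<le>
          \<tau> powr (2 * s) * ((1 + D1) * min ((\<tau> / 4 ^ j) powr a) ((\<tau> / 4 ^ j) powr - a))" for j
      proof -
        have "(4::real) ^ j = 4 powr real j" by (simp add: powr_realpow)
        then have "4 powr (2 * real j * s) = (4 ^ j) powr (2 * s)" by (simp add: powr_powr mult_ac)
        also have "\<dots> = \<tau> powr (2 * s) * (\<tau> / 4 ^ j) powr (- 2 * s)"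
          using \<tau> by (simp add: powr_divide powr_minus field_simps)
        finally have "4 powr (2 * real j * s) * profile \<sigma> \<delta> (\<tau> / 4 ^ j) =
          \<tau> powr (2 * s) * ((\<tau> / 4 ^ j) powr (- 2 * s) * profile \<sigma> \<delta> (\<tau> / 4 ^ j))" by simp
        also have "\<dots> \<le> \<tau> powr (2 * s) * ((1 + D1) * min ((\<tau> / 4 ^ j) powr a) ((\<tau> / 4 ^ j) powr - a))"
          using \<tau> by (intro mult_left_mono main) auto
        finally show ?thesis .
      qed
      then have "(\<Sum>j<n. 4 powr (2 * real j * s) * profile \<sigma> \<delta> (\<tau> / 4 ^ j)) \<le>
        (\<Sum>j<n. \<tau> powr (2 * s) * ((1 + D1) * min ((\<tau> / 4 ^ j) powr a) ((\<tau> / 4 ^ j) powr - a)))"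
        by (intro sum_mono)
      also have "\<dots> = \<tau> powr (2 * s) * ((1 + D1) * (\<Sum>j<n. min ((\<tau> / 4 ^ j) powr a) ((\<tau> / 4 ^ j) powr - a)))"
        by (simp only: sum_distrib_left)
      also have "\<dots> \<le> \<tau> powr (2 * s) * ((1 + D1) * C)"
        using C(2)[OF \<tau>, of "{..<n}"] D1 by (intro mult_left_mono) auto
      finally show ?thesis by (simp add: mult_ac)
    qed
  qed
qed

section \<open>Contributions of the cone and of its complement\<close>

lemma ennreal_le_of_square_le:
  assumes "(x :: ennreal)\<^sup>2 \<le> ennreal y" "0 \<le> y"
  shows "x \<le> ennreal (sqrt y)"
proof (cases x)
  case (real r)
  then have "r\<^sup>2 \<le> y" using assms by (simp add: ennreal_power)
  then show ?thesis using real by (simp add: real_le_rsqrt ennreal_leI)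
qed (use assms in \<open>simp add: power2_eq_square top_unique ennreal_mult_top\<close>)

text \<open>Only the vanishing factor is made radial. The Gaussian keeps its argument
  \<open>B_dual j k *v \<xi>\<close>, because over the cone it is integrated by a change of
  variables and off the cone it has a better lower bound.\<close>

lemma fourier_wavepacket_square_le:
  assumes \<phi>: "\<phi> \<in> schwartz" and c: "c > 0" and \<sigma>: "\<sigma> > 0"
    and bound: "\<And>\<xi>. cmod (fourier \<phi> \<xi>) \<le> c * (min 1 (\<bar>\<xi> $ 1\<bar> powr \<sigma>) * exp (- \<delta> * (norm \<xi>)\<^sup>2))"
  shows "(cmod (fourier (wavepacket \<phi> j k l) \<xi>))\<^sup>2 \<le>
    c\<^sup>2 / 8 ^ j * ((min 1 ((norm \<xi> / 4 ^ j) powr \<sigma>))\<^sup>2 * exp (- 2 * \<delta> * (norm (B_dual j k *v \<xi>))\<^sup>2))"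
proof -
  let ?b = "B_dual j k *v \<xi>"
  have e: "(8 powr (- real j / 2))\<^sup>2 = 1 / 8 ^ j"
  proof -
    have "(8 powr (- real j / 2))\<^sup>2 = 8 powr (- real j)"
      by (simp add: power2_eq_square powr_add[symmetric])
    then show ?thesis by (simp add: powr_minus powr_realpow inverse_eq_divide)
  qed
  have "cmod (fourier \<phi> ?b) \<le> c * (min 1 (\<bar>?b $ 1\<bar> powr \<sigma>) * exp (- \<delta> * (norm ?b)\<^sup>2))"
    by (rule bound)
  also have "\<dots> \<le> c * (min 1 ((norm \<xi> / 4 ^ j) powr \<sigma>) * exp (- \<delta> * (norm ?b)\<^sup>2))"
    using B_dual_1_le[of j k \<xi>] c \<sigma> by (intro mult_left_mono mult_right_mono min.mono powr_mono2) auto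
  finally have "(cmod (fourier \<phi> ?b))\<^sup>2 \<le> (c * (min 1 ((norm \<xi> / 4 ^ j) powr \<sigma>) * exp (- \<delta> * (norm ?b)\<^sup>2)))\<^sup>2"
    by (intro power_mono) auto
  also have "\<dots> = c\<^sup>2 * ((min 1 ((norm \<xi> / 4 ^ j) powr \<sigma>))\<^sup>2 * exp (- 2 * \<delta> * (norm ?b)\<^sup>2))"
    by (simp add: power_mult_distrib exp_double[symmetric] mult_ac)
  finally show ?thesis
    unfolding fourier_wavepacket[OF \<phi>] power_mult_distrib e by (simp add: divide_right_mono)
qed

text \<open>Cauchy-Schwarz at each scale bounds the square by a constant times the integral of
  \<open>H j\<close>. The sum over \<open>j\<close> is then carried out under the integral, at fixed
  frequency. No angular information enters: the cone matters only as the set on which the Sobolev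
  integral is finite.\<close>

lemma cone_estimate:
  fixes \<sigma> \<delta> s c :: real and k :: "nat \<Rightarrow> nat" and l :: "nat \<Rightarrow> real^2" and \<phi> :: "real^2 \<Rightarrow> complex"
  defines "h \<equiv> \<lambda>j \<xi>. cmod (fourier (wavepacket \<phi> j (k j) (l j)) \<xi>)"
  assumes \<phi>: "\<phi> \<in> schwartz" and c: "c > 0" and \<sigma>: "\<sigma> > s" "s \<ge> 0" and \<delta>: "\<delta> > 0"
    and bound: "\<And>\<xi>. cmod (fourier \<phi> \<xi>) \<le> c * (min 1 (\<bar>\<xi> $ 1\<bar> powr \<sigma>) * exp (- \<delta> * (norm \<xi>)\<^sup>2))"
    and g [measurable]: "g \<in> borel_measurable borel" and \<Gamma> [measurable]: "\<Gamma> \<in> sets borel"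
    and fin: "(\<integral>\<^sup>+\<xi>\<in>\<Gamma>. ennreal ((cmod (g \<xi>))\<^sup>2 * norm \<xi> powr (2 * s)) \<partial>lborel) < \<infinity>"
  obtains p where "\<And>j. 0 \<le> p j"
    "\<And>j. (\<integral>\<^sup>+\<xi>\<in>\<Gamma>. ennreal (cmod (g \<xi>) * h j \<xi>) \<partial>lborel) = ennreal (p j)"
    "summable (\<lambda>j. (p j)\<^sup>2 * 4 powr (2 * real j * s))"
proof -
  define P where "P j = (\<integral>\<^sup>+\<xi>\<in>\<Gamma>. ennreal (cmod (g \<xi>) * h j \<xi>) \<partial>lborel)" for j
  define H where "H j \<xi> = (cmod (g \<xi>))\<^sup>2 * profile \<sigma> \<delta> (norm \<xi> / 4 ^ j) * indicat_real \<Gamma> \<xi>" for j \<xi>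
  define w where "w j = 4 powr (2 * real j * s)" for j :: nat
  have w: "w j > 0" for j by (simp add: w_def)
  have [measurable]: "h j \<in> borel_measurable borel" for j
    unfolding h_def using schwartz_measurable[OF schwartz_fourier[OF schwartz_wavepacket[OF \<phi>]]]
    by measurable
  have H0: "0 \<le> H j \<xi>" for j \<xi> by (simp add: H_def profile_nonneg)
  have [measurable]: "H j \<in> borel_measurable borel" for j unfolding H_def by measurable
  obtain D where D: "D \<ge> 0"
    "\<And>\<tau> n. \<tau> \<ge> 0 \<Longrightarrow> (\<Sum>j<n. 4 powr (2 * real j * s) * profile \<sigma> \<delta> (\<tau> / 4 ^ j)) \<le> D * \<tau> powr (2 * s)"
    using profile_sum_bound[OF \<sigma>(2,1) \<delta>] by blast
  define X where "X = ennreal (c\<^sup>2 * pi / \<delta>) *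
    (ennreal D * (\<integral>\<^sup>+\<xi>\<in>\<Gamma>. ennreal ((cmod (g \<xi>))\<^sup>2 * norm \<xi> powr (2 * s)) \<partial>lborel))"
  have X: "X < \<infinity>" using fin unfolding X_def by (auto simp: ennreal_mult_less_top)
  have P2: "(P j)\<^sup>2 \<le> ennreal (c\<^sup>2 * pi / \<delta>) * (\<integral>\<^sup>+\<xi>. ennreal (H j \<xi>) \<partial>lborel)" for j
  proof -
    let ?b = "\<lambda>\<xi>. B_dual j (k j) *v \<xi>"
    \<comment> \<open>The Gaussian weight of rate \<open>\<delta> / 2\<close> in \<open>?b\<close>
      is inserted and removed. Its square uses half of the decay of the squared transform, and the
      other half remains for \<open>profile\<close>.\<close>
    define u where "u \<xi> = cmod (g \<xi>) * h j \<xi> * exp (\<delta> / 2 * (norm (?b \<xi>))\<^sup>2) * indicat_real \<Gamma> \<xi>" for \<xi>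
    define v where "v \<xi> = exp (- (\<delta> / 2) * (norm (?b \<xi>))\<^sup>2)" for \<xi>
    have uv: "0 \<le> u \<xi>" "0 \<le> v \<xi>" for \<xi> by (simp_all add: u_def v_def h_def)
    have [measurable]: "u \<in> borel_measurable borel" "v \<in> borel_measurable borel"
      unfolding u_def v_def by measurable
    have "ennreal (cmod (g \<xi>) * h j \<xi>) * indicator \<Gamma> \<xi> = ennreal (u \<xi>) * ennreal (v \<xi>)" for \<xi>
    proof -
      have "u \<xi> * v \<xi> = cmod (g \<xi>) * h j \<xi> * indicat_real \<Gamma> \<xi> * (exp (\<delta> / 2 * (norm (?b \<xi>))\<^sup>2) * exp (- (\<delta> / 2) * (norm (?b \<xi>))\<^sup>2))"
        by (simp add: u_def v_def)
      also have "\<dots> = cmod (g \<xi>) * h j \<xi> * indicat_real \<Gamma> \<xi>" by (simp add: exp_add[symmetric])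
      finally show ?thesis
        using uv by (simp add: ennreal_mult[symmetric]) (simp add: ennreal_indicator[symmetric] ennreal_mult'' h_def)
    qed
    then have "(P j)\<^sup>2 = (\<integral>\<^sup>+\<xi>. ennreal (u \<xi>) * ennreal (v \<xi>) \<partial>lborel)\<^sup>2" by (simp add: P_def)
    also have "\<dots> \<le> (\<integral>\<^sup>+\<xi>. (ennreal (u \<xi>))\<^sup>2 \<partial>lborel) * (\<integral>\<^sup>+\<xi>. (ennreal (v \<xi>))\<^sup>2 \<partial>lborel)"
      by (intro Cauchy_Schwarz_nn_integral) auto
    \<comment> \<open>This determinant factor is what cancels the normalisation
      \<open>1 / 8 ^ j\<close>.\<close>
    also have "(\<integral>\<^sup>+\<xi>. (ennreal (v \<xi>))\<^sup>2 \<partial>lborel) = ennreal (8 ^ j) * ennreal (pi / \<delta>)"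
    proof -
      have "(ennreal (v \<xi>))\<^sup>2 = ennreal (exp (- \<delta> * (norm (?b \<xi>))\<^sup>2))" for \<xi>
        using uv by (simp add: ennreal_power v_def exp_double[symmetric])
      then show ?thesis
        using nn_integral_B_dual[of "\<lambda>y. ennreal (exp (- \<delta> * (norm y)\<^sup>2))" j "k j"]
        by (simp only: nn_integral_gaussian[OF \<delta>]) simp
    qed
    also have "(\<integral>\<^sup>+\<xi>. (ennreal (u \<xi>))\<^sup>2 \<partial>lborel) \<le> (\<integral>\<^sup>+\<xi>. ennreal (c\<^sup>2 / 8 ^ j) * ennreal (H j \<xi>) \<partial>lborel)"
    proof (intro nn_integral_mono)
      fix \<xi>
      have b: "norm \<xi> / 4 ^ j \<le> norm (?b \<xi>)" by (rule norm_B_dual_ge)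
      have "(h j \<xi>)\<^sup>2 * exp (\<delta> * (norm (?b \<xi>))\<^sup>2) \<le>
          c\<^sup>2 / 8 ^ j * ((min 1 ((norm \<xi> / 4 ^ j) powr \<sigma>))\<^sup>2 * exp (- 2 * \<delta> * (norm (?b \<xi>))\<^sup>2)) * exp (\<delta> * (norm (?b \<xi>))\<^sup>2)"
        unfolding h_def using \<sigma> by (intro mult_right_mono fourier_wavepacket_square_le \<phi> c bound) auto
      also have "\<dots> = c\<^sup>2 / 8 ^ j * ((min 1 ((norm \<xi> / 4 ^ j) powr \<sigma>))\<^sup>2 * exp (- \<delta> * (norm (?b \<xi>))\<^sup>2))"
        by (simp add: mult.assoc exp_add[symmetric])
      also have "\<dots> \<le> c\<^sup>2 / 8 ^ j * profile \<sigma> \<delta> (norm \<xi> / 4 ^ j)"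
        unfolding profile_def using b \<delta> by (intro mult_left_mono) (auto intro!: power_mono)
      finally have 1: "(h j \<xi>)\<^sup>2 * exp (\<delta> * (norm (?b \<xi>))\<^sup>2) \<le> c\<^sup>2 / 8 ^ j * profile \<sigma> \<delta> (norm \<xi> / 4 ^ j)" .
      have "(u \<xi>)\<^sup>2 = (cmod (g \<xi>))\<^sup>2 * indicat_real \<Gamma> \<xi> * ((h j \<xi>)\<^sup>2 * exp (\<delta> * (norm (?b \<xi>))\<^sup>2))"
        by (simp add: u_def power_mult_distrib exp_double[symmetric] indicator_def)
      also have "\<dots> \<le> (cmod (g \<xi>))\<^sup>2 * indicat_real \<Gamma> \<xi> * (c\<^sup>2 / 8 ^ j * profile \<sigma> \<delta> (norm \<xi> / 4 ^ j))"
        by (intro mult_left_mono 1) auto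
      also have "\<dots> = c\<^sup>2 / 8 ^ j * H j \<xi>" by (simp add: H_def)
      finally have "ennreal ((u \<xi>)\<^sup>2) \<le> ennreal (c\<^sup>2 / 8 ^ j * H j \<xi>)" by (rule ennreal_leI)
      then show "(ennreal (u \<xi>))\<^sup>2 \<le> ennreal (c\<^sup>2 / 8 ^ j) * ennreal (H j \<xi>)"
        unfolding ennreal_power[OF uv(1)] by (subst ennreal_mult[symmetric]) (auto simp: H0)
    qed
    also have "\<dots> = ennreal (c\<^sup>2 / 8 ^ j) * (\<integral>\<^sup>+\<xi>. ennreal (H j \<xi>) \<partial>lborel)"
      by (intro nn_integral_cmult) measurable
    finally have "(P j)\<^sup>2 \<le> ennreal (c\<^sup>2 / 8 ^ j) * (\<integral>\<^sup>+\<xi>. ennreal (H j \<xi>) \<partial>lborel) * (ennreal (8 ^ j) * ennreal (pi / \<delta>))"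
      by (meson mult_right_mono order_trans zero_le)
    also have "\<dots> = ennreal (c\<^sup>2 / 8 ^ j * (8 ^ j * (pi / \<delta>))) * (\<integral>\<^sup>+\<xi>. ennreal (H j \<xi>) \<partial>lborel)"
    proof -
      have "ennreal (c\<^sup>2 / 8 ^ j * (8 ^ j * (pi / \<delta>))) = ennreal (c\<^sup>2 / 8 ^ j) * (ennreal (8 ^ j) * ennreal (pi / \<delta>))"
        using \<delta> ennreal_mult[of "c\<^sup>2 / 8 ^ j" "8 ^ j * (pi / \<delta>)"] ennreal_mult[of "8 ^ j" "pi / \<delta>"] by simp
      then show ?thesis by (simp only: mult_ac)
    qed
    also have "c\<^sup>2 / 8 ^ j * (8 ^ j * (pi / \<delta>)) = c\<^sup>2 * pi / \<delta>" by simp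
    finally show ?thesis .
  qed
  have sum: "(\<Sum>j<n. ennreal (w j) * (P j)\<^sup>2) \<le> X" for n
  proof -
    have "(\<Sum>j<n. ennreal (w j) * (P j)\<^sup>2) \<le>
        (\<Sum>j<n. ennreal (w j) * (ennreal (c\<^sup>2 * pi / \<delta>) * (\<integral>\<^sup>+\<xi>. ennreal (H j \<xi>) \<partial>lborel)))"
      by (intro sum_mono mult_left_mono P2) auto
    also have "\<dots> = ennreal (c\<^sup>2 * pi / \<delta>) * (\<Sum>j<n. ennreal (w j) * (\<integral>\<^sup>+\<xi>. ennreal (H j \<xi>) \<partial>lborel))"
      by (simp add: sum_distrib_left mult.left_commute)
    also have "(\<Sum>j<n. ennreal (w j) * (\<integral>\<^sup>+\<xi>. ennreal (H j \<xi>) \<partial>lborel)) =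
        (\<integral>\<^sup>+\<xi>. (\<Sum>j<n. ennreal (w j) * ennreal (H j \<xi>)) \<partial>lborel)"
      by (simp add: nn_integral_sum nn_integral_cmult)
    also have "\<dots> \<le> (\<integral>\<^sup>+\<xi>. ennreal D * (ennreal ((cmod (g \<xi>))\<^sup>2 * norm \<xi> powr (2 * s)) * indicator \<Gamma> \<xi>) \<partial>lborel)"
    proof (intro nn_integral_mono)
      fix \<xi>
      have "(\<Sum>j<n. w j * H j \<xi>) = (cmod (g \<xi>))\<^sup>2 * indicat_real \<Gamma> \<xi> * (\<Sum>j<n. w j * profile \<sigma> \<delta> (norm \<xi> / 4 ^ j))"
        unfolding sum_distrib_left by (intro sum.cong) (auto simp: H_def)
      also have "\<dots> \<le> (cmod (g \<xi>))\<^sup>2 * indicat_real \<Gamma> \<xi> * (D * norm \<xi> powr (2 * s))"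
        unfolding w_def by (intro mult_left_mono D) auto
      also have "\<dots> = D * ((cmod (g \<xi>))\<^sup>2 * norm \<xi> powr (2 * s) * indicat_real \<Gamma> \<xi>)" by simp
      finally have "ennreal (\<Sum>j<n. w j * H j \<xi>) \<le> ennreal \<dots>" by (rule ennreal_leI)
      moreover have "(\<Sum>j<n. ennreal (w j) * ennreal (H j \<xi>)) = ennreal (\<Sum>j<n. w j * H j \<xi>)"
        using H0 w by (simp add: ennreal_mult[symmetric] less_imp_le sum_ennreal)
      ultimately show "(\<Sum>j<n. ennreal (w j) * ennreal (H j \<xi>)) \<le>
          ennreal D * (ennreal ((cmod (g \<xi>))\<^sup>2 * norm \<xi> powr (2 * s)) * indicator \<Gamma> \<xi>)"
        using D(1) by (simp add: ennreal_mult ennreal_mult'' ennreal_indicator)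
    qed
    also have "\<dots> = ennreal D * (\<integral>\<^sup>+\<xi>\<in>\<Gamma>. ennreal ((cmod (g \<xi>))\<^sup>2 * norm \<xi> powr (2 * s)) \<partial>lborel)"
      by (intro nn_integral_cmult) measurable
    finally show ?thesis unfolding X_def by (meson mult_left_mono order_trans zero_le)
  qed
  \<comment> \<open>Finiteness comes from the bounded sum: an infinite \<open>P j\<close> would make
    one of its terms infinite, as the weight is positive.\<close>
  have Pfin: "P j < \<infinity>" for j
  proof (rule ccontr)
    assume "\<not> P j < \<infinity>"
    then have "P j = \<infinity>" by (simp add: not_less top_unique)
    then have "ennreal (w j) * (P j)\<^sup>2 = \<infinity>"
      using w[of j] by (simp add: power2_eq_square ennreal_mult_top)
    moreover have "ennreal (w j) * (P j)\<^sup>2 \<le> (\<Sum>i<Suc j. ennreal (w i) * (P i)\<^sup>2)"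
      by (intro member_le_sum) auto
    ultimately have "X = \<infinity>" using sum[of "Suc j"] by (simp add: top_unique)
    then show False using X by simp
  qed
  define p where "p j = enn2real (P j)" for j
  have p: "P j = ennreal (p j)" "0 \<le> p j" for j using Pfin[of j] by (simp_all add: p_def)
  have "summable (\<lambda>j. (p j)\<^sup>2 * w j)"
  proof (rule summableI_nonneg_bounded[where x = "enn2real X"])
    show "0 \<le> (p j)\<^sup>2 * w j" for j using w[of j] by simp
    show "(\<Sum>j<n. (p j)\<^sup>2 * w j) \<le> enn2real X" for n
    proof -
      have "ennreal (\<Sum>j<n. (p j)\<^sup>2 * w j) = (\<Sum>j<n. ennreal (w j) * (P j)\<^sup>2)"
        using w p(2) by (simp add: p(1) ennreal_power ennreal_mult[symmetric] less_imp_le sum_ennreal mult.commute)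
      also have "\<dots> \<le> ennreal (enn2real X)" using sum[of n] X by simp
      finally show ?thesis by (subst (asm) ennreal_le_iff) auto
    qed
  qed
  then show ?thesis using that[of p] p by (simp add: P_def w_def)
qed

text \<open>In the variable \<open>y = norm \<xi> / 2 ^ j\<close> the packet transform is Gaussian
  on \<Gamma>. The vanishing factor is at most \<open>(y / 2 ^ j) powr \<sigma>\<close> and the
  weight at most \<open>(2 ^ j * (1 + y)) powr M\<close>. The powers of \<open>2 ^ j\<close> come
  out, those of \<open>1 + y\<close> are absorbed, and no smoothness of \<open>g\<close> is
  used.\<close>

lemma off_cone_estimate:
  fixes \<sigma> \<delta> s M c \<kappa> :: real and k :: "nat \<Rightarrow> nat" and l :: "nat \<Rightarrow> real^2" and \<phi> :: "real^2 \<Rightarrow> complex" and J :: nat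
  defines "h \<equiv> \<lambda>j \<xi>. cmod (fourier (wavepacket \<phi> j (k j) (l j)) \<xi>)"
  assumes \<phi>: "\<phi> \<in> schwartz" and c: "c > 0" and \<sigma>: "\<sigma> > 0" and M: "M \<ge> 0" and \<delta>: "\<delta> > 0" and \<kappa>: "\<kappa> > 0"
    and exponent: "4 * s + 2 * M - 2 * \<sigma> - 1 < 0"
    and bound: "\<And>\<xi>. cmod (fourier \<phi> \<xi>) \<le> c * (min 1 (\<bar>\<xi> $ 1\<bar> powr \<sigma>) * exp (- \<delta> * (norm \<xi>)\<^sup>2))"
    and g [measurable]: "g \<in> borel_measurable borel" and \<Gamma> [measurable]: "\<Gamma> \<in> sets borel"
    and off: "\<And>j \<xi>. j \<ge> J \<Longrightarrow> \<xi> \<in> \<Gamma> \<Longrightarrow> \<kappa> * norm \<xi> / 2 ^ j \<le> norm (B_dual j (k j) *v \<xi>)"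
    and fin: "(\<integral>\<^sup>+\<xi>. ennreal ((cmod (g \<xi>))\<^sup>2 * (1 + norm \<xi>) powr (- 2 * M)) \<partial>lborel) < \<infinity>"
  obtains q C \<rho> where "\<And>j. 0 \<le> q j"
    "\<And>j. j \<ge> J \<Longrightarrow> (\<integral>\<^sup>+\<xi>\<in>\<Gamma>. ennreal (cmod (g \<xi>) * h j \<xi>) \<partial>lborel) \<le> ennreal (q j)"
    "\<And>j. (q j)\<^sup>2 * 4 powr (2 * real j * s) = C * \<rho> ^ j" "0 < \<rho>" "\<rho> < 1"
proof -
  have [measurable]: "h j \<in> borel_measurable borel" for j
    unfolding h_def using schwartz_measurable[OF schwartz_fourier[OF schwartz_wavepacket[OF \<phi>]]]
    by measurable
  \<comment> \<open>The Gaussian rate in \<open>y\<close>, after the lower bound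
    \<open>\<kappa> * y\<close> has been inserted.\<close>
  define d where "d = \<delta> * \<kappa>\<^sup>2"
  have d: "d > 0" using \<delta> \<kappa> by (simp add: d_def)
  obtain D where D: "D > 0" "\<And>x. x \<ge> 0 \<Longrightarrow> (1 + x) powr (2 * M + 2 * \<sigma>) * exp (- d * x\<^sup>2) \<le> D"
    using powr_times_gaussian_bounded[OF d] by blast
  define N0 where "N0 = enn2real (\<integral>\<^sup>+\<xi>. ennreal ((cmod (g \<xi>))\<^sup>2 * (1 + norm \<xi>) powr (- 2 * M)) \<partial>lborel)"
  have N0: "(\<integral>\<^sup>+\<xi>. ennreal ((cmod (g \<xi>))\<^sup>2 * (1 + norm \<xi>) powr (- 2 * M)) \<partial>lborel) = ennreal N0" "N0 \<ge> 0"
    using fin by (simp_all add: N0_def)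
  define C where "C = N0 * (c\<^sup>2 * D * pi / d)"
  have C: "C \<ge> 0" using N0 D d by (simp add: C_def)
  define Y where "Y j = C * (2 ^ j) powr (2 * M - 2 * \<sigma> - 1)" for j :: nat
  have Y: "0 \<le> Y j" for j using C by (simp add: Y_def)
  have main: "(\<integral>\<^sup>+\<xi>\<in>\<Gamma>. ennreal (cmod (g \<xi>) * h j \<xi>) \<partial>lborel)\<^sup>2 \<le> ennreal (Y j)" if j: "j \<ge> J" for j
  proof -
    define u where "u \<xi> = cmod (g \<xi>) * (1 + norm \<xi>) powr (- M)" for \<xi>
    define v where "v \<xi> = h j \<xi> * (1 + norm \<xi>) powr M * indicat_real \<Gamma> \<xi>" for \<xi>
    have uv: "0 \<le> u \<xi>" "0 \<le> v \<xi>" for \<xi> by (simp_all add: u_def v_def h_def)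
    have [measurable]: "u \<in> borel_measurable borel" "v \<in> borel_measurable borel"
      unfolding u_def v_def by measurable
    have n1: "1 + norm \<xi> > 0" for \<xi> :: "real^2" by (intro add_pos_nonneg) auto
    have "ennreal (cmod (g \<xi>) * h j \<xi>) * indicator \<Gamma> \<xi> = ennreal (u \<xi>) * ennreal (v \<xi>)" for \<xi>
    proof -
      have "u \<xi> * v \<xi> = cmod (g \<xi>) * h j \<xi> * indicat_real \<Gamma> \<xi> * ((1 + norm \<xi>) powr (- M) * (1 + norm \<xi>) powr M)"
        by (simp add: u_def v_def)
      also have "(1 + norm \<xi>) powr (- M) * (1 + norm \<xi>) powr M = 1"
        using n1[of \<xi>] by (simp add: powr_add[symmetric])
      finally show ?thesis
        using uv by (simp add: ennreal_mult[symmetric]) (simp add: ennreal_indicator[symmetric] ennreal_mult'' h_def)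
    qed
    then have "(\<integral>\<^sup>+\<xi>\<in>\<Gamma>. ennreal (cmod (g \<xi>) * h j \<xi>) \<partial>lborel)\<^sup>2 = (\<integral>\<^sup>+\<xi>. ennreal (u \<xi>) * ennreal (v \<xi>) \<partial>lborel)\<^sup>2"
      by simp
    also have "\<dots> \<le> (\<integral>\<^sup>+\<xi>. (ennreal (u \<xi>))\<^sup>2 \<partial>lborel) * (\<integral>\<^sup>+\<xi>. (ennreal (v \<xi>))\<^sup>2 \<partial>lborel)"
      by (intro Cauchy_Schwarz_nn_integral) auto
    also have "(\<integral>\<^sup>+\<xi>. (ennreal (u \<xi>))\<^sup>2 \<partial>lborel) = ennreal N0"
    proof -
      have "(ennreal (u \<xi>))\<^sup>2 = ennreal ((cmod (g \<xi>))\<^sup>2 * (1 + norm \<xi>) powr (- 2 * M))" for \<xi>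
        using uv n1[of \<xi>] by (simp add: ennreal_power u_def power_mult_distrib) (simp add: power2_eq_square powr_add[symmetric])
      then show ?thesis using N0 by simp
    qed
    also have "(\<integral>\<^sup>+\<xi>. (ennreal (v \<xi>))\<^sup>2 \<partial>lborel) \<le>
      (\<integral>\<^sup>+\<xi>. ennreal (c\<^sup>2 * D / 8 ^ j * (2 ^ j) powr (2 * M - 2 * \<sigma>)) * ennreal (exp (- (d / 4 ^ j) * (norm (\<xi> :: real^2))\<^sup>2)) \<partial>lborel)"
    proof (intro nn_integral_mono)
      fix \<xi> :: "real^2"
      define y where "y = norm \<xi> / 2 ^ j"
      have y: "y \<ge> 0" by (simp add: y_def)
      have "(v \<xi>)\<^sup>2 \<le> c\<^sup>2 * D / 8 ^ j * (2 ^ j) powr (2 * M - 2 * \<sigma>) * exp (- (d / 4 ^ j) * (norm \<xi>)\<^sup>2)"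
      proof (cases "\<xi> \<in> \<Gamma>")
        case True
        have ny: "norm \<xi> / 4 ^ j = y / 2 ^ j" by (simp add: y_def flip: power_mult_distrib)
        have b: "\<kappa> * y \<le> norm (B_dual j (k j) *v \<xi>)" using off[OF j True] by (simp add: y_def)
        have "(h j \<xi>)\<^sup>2 \<le> c\<^sup>2 / 8 ^ j * ((min 1 ((norm \<xi> / 4 ^ j) powr \<sigma>))\<^sup>2 * exp (- 2 * \<delta> * (norm (B_dual j (k j) *v \<xi>))\<^sup>2))"
          unfolding h_def by (intro fourier_wavepacket_square_le \<phi> c \<sigma> bound)
        also have "\<dots> \<le> c\<^sup>2 / 8 ^ j * (((y / 2 ^ j) powr \<sigma>)\<^sup>2 * exp (- 2 * \<delta> * (\<kappa> * y)\<^sup>2))"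
          unfolding ny using b \<delta> \<kappa> y by (intro mult_left_mono mult_mono power_mono) (auto intro!: power_mono)
        also have "((y / 2 ^ j) powr \<sigma>)\<^sup>2 = y powr (2 * \<sigma>) * (2 ^ j) powr (- 2 * \<sigma>)"
          using y by (simp add: power2_eq_square powr_add[symmetric] powr_divide powr_minus field_simps)
        \<comment> \<open>One factor absorbs \<open>(1 + y) powr (2 * M + 2 * \<sigma>)\<close>, the
          other is left for the integration over \<xi>.\<close>
        also have "exp (- 2 * \<delta> * (\<kappa> * y)\<^sup>2) = exp (- d * y\<^sup>2) * exp (- d * y\<^sup>2)"
          by (simp add: exp_add[symmetric] d_def power_mult_distrib)
        finally have h2: "(h j \<xi>)\<^sup>2 \<le> c\<^sup>2 / 8 ^ j * (y powr (2 * \<sigma>) * (2 ^ j) powr (- 2 * \<sigma>) * (exp (- d * y\<^sup>2) * exp (- d * y\<^sup>2)))" .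
        have "1 + norm \<xi> \<le> 2 ^ j * (1 + y)" by (simp add: y_def distrib_left)
        then have "(1 + norm \<xi>) powr (2 * M) \<le> (2 ^ j * (1 + y)) powr (2 * M)"
          using M n1[of \<xi>] by (intro powr_mono2) auto
        also have "\<dots> = (2 ^ j) powr (2 * M) * (1 + y) powr (2 * M)" using y by (simp add: powr_mult)
        finally have m2: "(1 + norm \<xi>) powr (2 * M) \<le> (2 ^ j) powr (2 * M) * (1 + y) powr (2 * M)" .
        have "(v \<xi>)\<^sup>2 = (h j \<xi>)\<^sup>2 * (1 + norm \<xi>) powr (2 * M)"
          using True by (simp add: v_def power_mult_distrib) (simp add: power2_eq_square powr_add[symmetric])
        also have "\<dots> \<le> c\<^sup>2 / 8 ^ j * (y powr (2 * \<sigma>) * (2 ^ j) powr (- 2 * \<sigma>) * (exp (- d * y\<^sup>2) * exp (- d * y\<^sup>2))) *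
            ((2 ^ j) powr (2 * M) * (1 + y) powr (2 * M))"
          by (intro mult_mono h2 m2) auto
        also have "\<dots> \<le> c\<^sup>2 / 8 ^ j * ((1 + y) powr (2 * \<sigma>) * (2 ^ j) powr (- 2 * \<sigma>) * (exp (- d * y\<^sup>2) * exp (- d * y\<^sup>2))) *
            ((2 ^ j) powr (2 * M) * (1 + y) powr (2 * M))"
          using y \<sigma> by (intro mult_right_mono mult_left_mono powr_mono2) auto
        also have "\<dots> = c\<^sup>2 / 8 ^ j * ((2 ^ j) powr (2 * M - 2 * \<sigma>) * exp (- d * y\<^sup>2)) * ((1 + y) powr (2 * M + 2 * \<sigma>) * exp (- d * y\<^sup>2))"
        proof -
          have "(2 ^ j :: real) powr (2 * M - 2 * \<sigma>) = (2 ^ j) powr (2 * M) * (2 ^ j) powr (- 2 * \<sigma>)"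
            by (simp add: powr_add[symmetric])
          moreover have "(1 + y) powr (2 * M + 2 * \<sigma>) = (1 + y) powr (2 * M) * (1 + y) powr (2 * \<sigma>)"
            by (rule powr_add)
          ultimately show ?thesis by (simp only: mult_ac)
        qed
        also have "\<dots> \<le> c\<^sup>2 / 8 ^ j * ((2 ^ j) powr (2 * M - 2 * \<sigma>) * exp (- d * y\<^sup>2)) * D"
          by (intro mult_left_mono D y) auto
        also have "- d * y\<^sup>2 = - (d / 4 ^ j) * (norm \<xi>)\<^sup>2"
          by (simp add: y_def power_divide power_mult[symmetric] power2_eq_square mult.commute flip: power_mult_distrib)
        finally show ?thesis by (simp add: mult_ac)
      qed (use D in \<open>simp add: v_def\<close>)
      then show "(ennreal (v \<xi>))\<^sup>2 \<le> ennreal (c\<^sup>2 * D / 8 ^ j * (2 ^ j) powr (2 * M - 2 * \<sigma>)) * ennreal (exp (- (d / 4 ^ j) * (norm \<xi>)\<^sup>2))"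
        using uv D by (simp add: ennreal_power ennreal_mult[symmetric] ennreal_leI)
    qed
    also have "\<dots> = ennreal (c\<^sup>2 * D / 8 ^ j * (2 ^ j) powr (2 * M - 2 * \<sigma>)) * ennreal (pi / (d / 4 ^ j))"
    proof -
      have "d / 4 ^ j > 0" using d by simp
      from nn_integral_gaussian[OF this] show ?thesis by (subst nn_integral_cmult) auto
    qed
    also have "\<dots> = ennreal (c\<^sup>2 * D * pi / d * (2 ^ j) powr (2 * M - 2 * \<sigma> - 1))"
    proof -
      \<comment> \<open>The area \<open>4 ^ j\<close> of the Gaussian against the normalisation
        leaves \<open>1 / 2 ^ j\<close>, the source of the \<open>- 1\<close> in the
        exponent.\<close>
      have e: "(8::real) ^ j = 4 ^ j * 2 ^ j" by (simp flip: power_mult_distrib)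
      have "c\<^sup>2 * D / 8 ^ j * (2 ^ j) powr (2 * M - 2 * \<sigma>) * (pi / (d / 4 ^ j)) = c\<^sup>2 * D * pi / d * ((2 ^ j) powr (2 * M - 2 * \<sigma>) / 2 ^ j)"
        unfolding e using d by (simp add: field_simps)
      also have "(2 ^ j :: real) powr (2 * M - 2 * \<sigma>) / 2 ^ j = (2 ^ j) powr (2 * M - 2 * \<sigma> - 1)"
        by (simp add: powr_diff)
      finally show ?thesis using D d by (simp add: ennreal_mult[symmetric])
    qed
    finally have "(\<integral>\<^sup>+\<xi>\<in>\<Gamma>. ennreal (cmod (g \<xi>) * h j \<xi>) \<partial>lborel)\<^sup>2 \<le> ennreal N0 * ennreal (c\<^sup>2 * D * pi / d * (2 ^ j) powr (2 * M - 2 * \<sigma> - 1))"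
      by (meson mult_left_mono order_trans zero_le)
    also have "\<dots> = ennreal (Y j)"
      using N0 D d by (simp add: Y_def C_def ennreal_mult[symmetric] mult.assoc)
    finally show ?thesis .
  qed
  define \<rho> where "\<rho> = 2 powr (4 * s + 2 * M - 2 * \<sigma> - 1)"
  show ?thesis
  proof (rule that[of "\<lambda>j. sqrt (Y j)" C \<rho>])
    show "(\<integral>\<^sup>+\<xi>\<in>\<Gamma>. ennreal (cmod (g \<xi>) * h j \<xi>) \<partial>lborel) \<le> ennreal (sqrt (Y j))" if "j \<ge> J" for j
      by (rule ennreal_le_of_square_le[OF main[OF that] Y])
    show "(sqrt (Y j))\<^sup>2 * 4 powr (2 * real j * s) = C * \<rho> ^ j" for j
    proof -
      have 2: "(2::real) ^ j = 2 powr real j" by (simp add: powr_realpow)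
      have 4: "(4::real) = 2 powr 2" by simp
      have "4 powr (2 * real j * s) = (2 ^ j) powr (4 * s)"
        unfolding 2 4 powr_powr by (simp add: mult_ac)
      then have "(sqrt (Y j))\<^sup>2 * 4 powr (2 * real j * s) = C * ((2 ^ j) powr (2 * M - 2 * \<sigma> - 1) * (2 ^ j) powr (4 * s))"
        using Y by (simp add: Y_def)
      also have "(2 ^ j :: real) powr (2 * M - 2 * \<sigma> - 1) * (2 ^ j) powr (4 * s) = (2 ^ j) powr (4 * s + 2 * M - 2 * \<sigma> - 1)"
        unfolding powr_add[symmetric] by (simp add: algebra_simps)
      also have "\<dots> = \<rho> ^ j"
        unfolding 2 powr_powr \<rho>_def by (simp add: powr_power)
      finally show ?thesis .
    qed
    show "\<rho> < 1" using exponent by (simp add: \<rho>_def powr_less_one)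
  qed (use Y in \<open>auto simp: \<rho>_def\<close>)
qed

section \<open>Assembly of the contributions\<close>

lemma cone_measurable: "(\<lambda>\<zeta>. rot \<theta> *v \<zeta>) ` cone_V \<epsilon> \<in> sets borel"
proof -
  have "closed (cone_V \<epsilon>)"
    unfolding cone_V_def by (intro closed_Collect_le continuous_intros)
  then have [measurable]: "cone_V \<epsilon> \<in> sets borel" by (rule borel_closed)
  have "(\<lambda>\<zeta>. rot \<theta> *v \<zeta>) ` cone_V \<epsilon> = (\<lambda>\<xi>. rot (- \<theta>) *v \<xi>) -` cone_V \<epsilon> \<inter> space borel"
  proof (intro equalityI subsetI)
    fix \<xi> assume "\<xi> \<in> (\<lambda>\<xi>. rot (- \<theta>) *v \<xi>) -` cone_V \<epsilon> \<inter> space borel"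
    moreover have "\<xi> = rot \<theta> *v (rot (- \<theta>) *v \<xi>)"
      by (simp add: matrix_vector_mul_assoc rot_uminus)
    ultimately show "\<xi> \<in> (\<lambda>\<zeta>. rot \<theta> *v \<zeta>) ` cone_V \<epsilon>" by blast
  qed (auto simp: matrix_vector_mul_assoc rot_uminus)
  also have "\<dots> \<in> sets borel" by measurable
  finally show ?thesis .
qed

text \<open>The test function is the conjugate of \<open>fourier w\<close>, whose transform is the
  conjugate of \<open>w\<close>, so that the action of \<eta>f becomes an integral against
  \<open>g\<close>. With the integral in \<open>ennreal\<close> the regions can be estimated without
  integrability conditions.\<close>

lemma pairing_le:
  assumes f: "tempered_distribution f" and \<eta>: "\<eta> \<in> slowly_growing" and w: "w \<in> schwartz"
    and g: "dist_is_function (fourier_dist (mult_dist \<eta> f)) g"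
  shows "ennreal (cmod (pairing f w)) \<le>
    (\<integral>\<^sup>+\<xi>. ennreal (cmod (g \<xi>) * cmod (fourier w \<xi>)) \<partial>lborel) +
    ennreal (cmod (f (\<lambda>x. (1 - \<eta> x) * cnj (w x))))"
proof -
  have cw: "(\<lambda>x. cnj (w x)) \<in> schwartz" by (rule schwartz_cnj[OF w])
  define \<psi> where "\<psi> \<xi> = cnj (fourier w \<xi>)" for \<xi>
  have \<psi>: "\<psi> \<in> schwartz" unfolding \<psi>_def by (intro schwartz_cnj schwartz_fourier w)
  have F: "fourier \<psi> x = cnj (w x)" for x unfolding \<psi>_def by (rule fourier_inversion[OF w])
  have "(\<lambda>x. 1 - \<eta> x) \<in> slowly_growing" by (intro slowly_growing_diff slowly_growing_const \<eta>)
  then have s: "(\<lambda>x. \<eta> x * cnj (w x)) \<in> schwartz" "(\<lambda>x. (1 - \<eta> x) * cnj (w x)) \<in> schwartz"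
    using schwartz_mult[OF _ cw, of _ 1] \<eta> by auto
  have add: "\<forall>\<phi>\<in>schwartz. \<forall>\<psi>\<in>schwartz. f (\<lambda>x. \<phi> x + \<psi> x) = f \<phi> + f \<psi>"
    using f unfolding tempered_distribution_def by (rule conjunct1)
  have "pairing f w = f (\<lambda>x. \<eta> x * cnj (w x) + (1 - \<eta> x) * cnj (w x))"
    by (simp add: pairing_def algebra_simps)
  also have "\<dots> = f (\<lambda>x. \<eta> x * cnj (w x)) + f (\<lambda>x. (1 - \<eta> x) * cnj (w x))"
    using bspec[OF bspec[OF add s(1)] s(2)] .
  also have "f (\<lambda>x. \<eta> x * cnj (w x)) = fourier_dist (mult_dist \<eta> f) \<psi>"
    by (simp add: fourier_dist_def mult_dist_def F)
  also have "\<dots> = (LINT \<xi>|lborel. g \<xi> * \<psi> \<xi>)"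
    using g \<psi> by (simp add: dist_is_function_def regular_dist_def)
  finally have "cmod (pairing f w) \<le> cmod (LINT \<xi>|lborel. g \<xi> * \<psi> \<xi>) + cmod (f (\<lambda>x. (1 - \<eta> x) * cnj (w x)))"
    by (simp add: norm_triangle_ineq)
  then have "ennreal (cmod (pairing f w)) \<le> ennreal (cmod (LINT \<xi>|lborel. g \<xi> * \<psi> \<xi>)) + ennreal (cmod (f (\<lambda>x. (1 - \<eta> x) * cnj (w x))))"
    by (simp add: ennreal_leI flip: ennreal_plus)
  also have "ennreal (cmod (LINT \<xi>|lborel. g \<xi> * \<psi> \<xi>)) \<le> (\<integral>\<^sup>+\<xi>. ennreal (norm (g \<xi> * \<psi> \<xi>)) \<partial>lborel)"
    using g \<psi> by (intro integral_norm_bound_ennreal) (simp add: dist_is_function_def)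
  also have "\<dots> = (\<integral>\<^sup>+\<xi>. ennreal (cmod (g \<xi>) * cmod (fourier w \<xi>)) \<partial>lborel)"
    by (simp add: norm_mult \<psi>_def)
  finally show ?thesis by (simp add: add_right_mono)
qed

lemma square_sum3_le:
  fixes a x y z :: real
  assumes "0 \<le> a" "a \<le> x + y + z"
  shows "a\<^sup>2 \<le> 3 * (x\<^sup>2 + y\<^sup>2 + z\<^sup>2)"
proof -
  have "a\<^sup>2 \<le> (x + y + z)\<^sup>2" using assms by (intro power_mono) auto
  also have "\<dots> \<le> 3 * (x\<^sup>2 + y\<^sup>2 + z\<^sup>2)"
  proof -
    have "0 \<le> (x - y)\<^sup>2 + (y - z)\<^sup>2 + (x - z)\<^sup>2" by simp
    then show ?thesis by (simp add: power2_eq_square algebra_simps)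
  qed
  finally show ?thesis .
qed

theorem theorem4p1:
  fixes s M \<delta> \<sigma> L \<theta>\<^sub>0 :: real
    and \<phi> :: "real^2 \<Rightarrow> complex"
    and \<Lambda> :: "(real^2) set"
    and x\<^sub>0 :: "real^2"
    and k :: "nat \<Rightarrow> nat"
    and l :: "nat \<Rightarrow> real^2"
    and f :: "(real^2 \<Rightarrow> complex) \<Rightarrow> complex"
  assumes "s \<ge> 0" and "M \<ge> 0"
    and "\<phi> \<in> schwartz"
    and "\<delta> > 0" and "\<sigma> > 2"
    and "\<exists>c>0. \<forall>\<xi>. cmod (fourier \<phi> \<xi>) \<le>
           c * (min 1 (\<bar>\<xi> $ 1\<bar> powr \<sigma>) * exp (- \<delta> * (norm \<xi>)\<^sup>2))"
    and "covering_condition \<delta> \<phi>"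
    and "\<sigma> > 2 * s + 2 * M - 1 / 2"
    and "is_lattice \<Lambda>"
    and "\<forall>x. \<exists>p\<in>\<Lambda>. dist x p \<le> L"
    and "0 \<le> \<theta>\<^sub>0" and "\<theta>\<^sub>0 < 2 * pi"
    and "grid_parameters \<Lambda> L x\<^sub>0 \<theta>\<^sub>0 k l"
    and "f \<in> microlocal_sobolev s M x\<^sub>0 \<theta>\<^sub>0"
  shows "(\<lambda>j. (cmod (pairing f (wavepacket \<phi> j (k j) (l j))))\<^sup>2 * 4 powr (2 * real j * s))
           summable_on {1..}"
proof -
  have \<phi>: "\<phi> \<in> schwartz" and f: "tempered_distribution f"
    using assms by (auto simp: microlocal_sobolev_def)
  obtain c where c: "c > 0"
    "\<And>\<xi>. cmod (fourier \<phi> \<xi>) \<le> c * (min 1 (\<bar>\<xi> $ 1\<bar> powr \<sigma>) * exp (- \<delta> * (norm \<xi>)\<^sup>2))"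
    using assms(6) by blast
  obtain \<epsilon> \<eta> g where \<epsilon>: "\<epsilon> > 0"
    and \<eta>: "smooth \<eta>" "compact (closure {x. \<eta> x \<noteq> 0})" "\<forall>\<^sub>F x in nhds x\<^sub>0. \<eta> x = 1"
    and g: "dist_is_function (fourier_dist (mult_dist \<eta> f)) g"
    and cone: "(\<integral>\<^sup>+\<xi>\<in>(\<lambda>\<zeta>. rot \<theta>\<^sub>0 *v \<zeta>) ` cone_V \<epsilon>.
              ennreal ((cmod (g \<xi>))\<^sup>2 * norm \<xi> powr (2 * s)) \<partial>lborel) < \<infinity>"
    and all: "(\<integral>\<^sup>+\<xi>. ennreal ((cmod (g \<xi>))\<^sup>2 * (1 + norm \<xi>) powr (- 2 * M)) \<partial>lborel) < \<infinity>"
    using assms(14) unfolding microlocal_sobolev_def by blast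
  define \<Gamma> where "\<Gamma> = (\<lambda>\<zeta>. rot \<theta>\<^sub>0 *v \<zeta>) ` cone_V \<epsilon>"
  have \<Gamma> [measurable]: "\<Gamma> \<in> sets borel" "- \<Gamma> \<in> sets borel"
    unfolding \<Gamma>_def using cone_measurable by (auto intro: borel_comp)
  have gm [measurable]: "g \<in> borel_measurable borel" using g by (simp add: dist_is_function_def)
  have grid: "2 * pi * real (k j) / 2 ^ j \<le> 2 * pi - \<theta>\<^sub>0"
      "2 * pi - \<theta>\<^sub>0 \<le> 2 * pi * (real (k j) + 1) / 2 ^ j"
      "norm (A_mat j (k j) *v x\<^sub>0 - l j) \<le> L" if "j \<ge> 1" for j
    using assms(13) that unfolding grid_parameters_def by blast+
  let ?w = "\<lambda>j. wavepacket \<phi> j (k j) (l j)"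
  let ?h = "\<lambda>j \<xi>. cmod (fourier (?w j) \<xi>)"
  have hm [measurable]: "?h j \<in> borel_measurable borel" for j
    using schwartz_measurable[OF schwartz_fourier[OF schwartz_wavepacket[OF \<phi>]]] by measurable
  \<comment> \<open>The bound \<open>\<sigma> > s\<close> follows from \<open>\<sigma> > 2\<close>
    for \<open>s \<le> 2\<close> and from the other lower bound on \<sigma> for larger
    \<open>s\<close>; that bound also makes the exponent less than \<open>- 2 * M\<close>.\<close>
  have \<sigma>: "\<sigma> > s" "\<sigma> > 0" "4 * s + 2 * M - 2 * \<sigma> - 1 < 0" using assms(1,2,5,8) by argo+
  obtain p where p: "\<And>j. 0 \<le> p j"
    "\<And>j. (\<integral>\<^sup>+\<xi>\<in>\<Gamma>. ennreal (cmod (g \<xi>) * ?h j \<xi>) \<partial>lborel) = ennreal (p j)"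
    "summable (\<lambda>j. (p j)\<^sup>2 * 4 powr (2 * real j * s))"
    using cone_estimate[OF \<phi> c(1) \<sigma>(1) assms(1) assms(4) c(2) gm \<Gamma>(1) cone[folded \<Gamma>_def], where k = k and l = l]
    by blast
  obtain J \<kappa> where \<kappa>: "\<kappa> > 0"
    "\<And>j \<xi>. j \<ge> J \<Longrightarrow> \<xi> \<notin> \<Gamma> \<Longrightarrow> \<kappa> * norm \<xi> / 2 ^ j \<le> norm (B_dual j (k j) *v \<xi>)"
    using norm_B_dual_off_cone[OF \<epsilon>, of k \<theta>\<^sub>0] grid unfolding \<Gamma>_def by metis
  have off: "\<And>j \<xi>. j \<ge> J \<Longrightarrow> \<xi> \<in> - \<Gamma> \<Longrightarrow> \<kappa> * norm \<xi> / 2 ^ j \<le> norm (B_dual j (k j) *v \<xi>)"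
    using \<kappa>(2) by simp
  obtain q C \<rho> where q: "\<And>j. 0 \<le> q j"
    "\<And>j. j \<ge> J \<Longrightarrow> (\<integral>\<^sup>+\<xi>\<in>- \<Gamma>. ennreal (cmod (g \<xi>) * ?h j \<xi>) \<partial>lborel) \<le> ennreal (q j)"
    "\<And>j. (q j)\<^sup>2 * 4 powr (2 * real j * s) = C * \<rho> ^ j" "0 < \<rho>" "\<rho> < 1"
    using off_cone_estimate[OF \<phi> c(1) \<sigma>(2) assms(2) assms(4) \<kappa>(1) \<sigma>(3) c(2) gm \<Gamma>(2) off all, where l = l]
    by blast
  \<comment> \<open>This order turns the weighted square of the tail into at most a multiple of
    \<open>(1 / 4) ^ j\<close>.\<close>
  obtain Q :: nat where Q: "2 * s + 1 \<le> real Q" using real_arch_simple by blast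
  obtain E where E: "E \<ge> 0"
    "\<And>j. j \<ge> 1 \<Longrightarrow> cmod (f (\<lambda>x. (1 - \<eta> x) * cnj (?w j x))) \<le> E / (2 ^ j) ^ Q"
    using tail_estimate[OF f \<phi> \<eta> grid(3), where Q = Q] by blast
  \<comment> \<open>The tail bound starts at 1 and the angular bound at \<open>J\<close>. The
    finitely many earlier scales do not affect convergence, so a comparison for large
    \<open>j\<close> suffices.\<close>
  have a_le: "cmod (pairing f (?w j)) \<le> p j + q j + E / (2 ^ j) ^ Q" if j: "j \<ge> max 1 J" for j
  proof -
    have "(\<integral>\<^sup>+\<xi>. ennreal (cmod (g \<xi>) * ?h j \<xi>) \<partial>lborel) =
      (\<integral>\<^sup>+\<xi>\<in>\<Gamma>. ennreal (cmod (g \<xi>) * ?h j \<xi>) \<partial>lborel) + (\<integral>\<^sup>+\<xi>\<in>- \<Gamma>. ennreal (cmod (g \<xi>) * ?h j \<xi>) \<partial>lborel)"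
      by (subst nn_integral_add[symmetric]) (auto intro!: nn_integral_cong split: split_indicator)
    also have "\<dots> \<le> ennreal (p j) + ennreal (q j)"
      using p(2) q(2)[of j] j by (intro add_mono) auto
    finally have "ennreal (cmod (pairing f (?w j))) \<le> ennreal (p j) + ennreal (q j) + ennreal (E / (2 ^ j) ^ Q)"
      using pairing_le[OF f slowly_growing_compact_support[OF \<eta>(1,2)] schwartz_wavepacket[OF \<phi>] g, of j "k j" "l j"]
        E(2)[of j] j by (meson add_mono ennreal_leI max.boundedE order_trans)
    also have "\<dots> = ennreal (p j + q j + E / (2 ^ j) ^ Q)"
      using p(1) q(1) E(1) by (simp add: ennreal_plus)
    finally show ?thesis using p(1)[of j] q(1)[of j] E(1) by (subst (asm) ennreal_le_iff) auto
  qed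
  have tail: "(E / (2 ^ j) ^ Q)\<^sup>2 * 4 powr (2 * real j * s) \<le> E\<^sup>2 * (1 / 4) ^ j" for j
  proof -
    have "((2 ^ j) ^ Q)\<^sup>2 = ((2 :: real)\<^sup>2) ^ (j * Q)"
      unfolding power_mult[symmetric] by (simp only: mult.commute)
    also have "\<dots> = 4 powr real (j * Q)"
      by (subst powr_realpow) simp_all
    finally have "((2 ^ j) ^ Q)\<^sup>2 = (4 :: real) powr (real j * real Q)" by simp
    then have "(E / (2 ^ j) ^ Q)\<^sup>2 * 4 powr (2 * real j * s) = E\<^sup>2 * 4 powr (2 * real j * s - real j * real Q)"
      by (simp add: power_divide powr_diff)
    also have "\<dots> \<le> E\<^sup>2 * 4 powr (- real j)"
    proof (intro mult_left_mono powr_mono)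
      have "real j * (2 * s + 1) \<le> real j * real Q" using Q by (intro mult_left_mono) auto
      then show "2 * real j * s - real j * real Q \<le> - real j" by (simp add: algebra_simps)
    qed auto
    also have "4 powr (- real j) = (1 / 4 :: real) ^ j"
      by (simp add: powr_minus powr_realpow power_divide inverse_eq_divide)
    finally show ?thesis .
  qed
  have "summable (\<lambda>j. (cmod (pairing f (?w j)))\<^sup>2 * 4 powr (2 * real j * s))"
  proof (rule summable_comparison_test_ev)
    show "summable (\<lambda>j. 3 * ((p j)\<^sup>2 * 4 powr (2 * real j * s) + C * \<rho> ^ j + E\<^sup>2 * (1 / 4) ^ j))"
      using q(4,5) by (intro summable_mult summable_add p(3) summable_geometric) auto
    have "norm ((cmod (pairing f (?w j)))\<^sup>2 * 4 powr (2 * real j * s)) \<le>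
        3 * ((p j)\<^sup>2 * 4 powr (2 * real j * s) + C * \<rho> ^ j + E\<^sup>2 * (1 / 4) ^ j)" if "j \<ge> max 1 J" for j
    proof -
      have "(cmod (pairing f (?w j)))\<^sup>2 * 4 powr (2 * real j * s) \<le>
        3 * ((p j)\<^sup>2 + (q j)\<^sup>2 + (E / (2 ^ j) ^ Q)\<^sup>2) * 4 powr (2 * real j * s)"
        by (intro mult_right_mono square_sum3_le a_le that) auto
      also have "\<dots> = 3 * ((p j)\<^sup>2 * 4 powr (2 * real j * s) + (q j)\<^sup>2 * 4 powr (2 * real j * s) +
          (E / (2 ^ j) ^ Q)\<^sup>2 * 4 powr (2 * real j * s))"
        by (simp add: algebra_simps)
      also have "\<dots> \<le> 3 * ((p j)\<^sup>2 * 4 powr (2 * real j * s) + C * \<rho> ^ j + E\<^sup>2 * (1 / 4) ^ j)"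
        unfolding q(3) using tail[of j] by simp
      finally show ?thesis by simp
    qed
    then show "\<forall>\<^sub>F j in sequentially. norm ((cmod (pairing f (?w j)))\<^sup>2 * 4 powr (2 * real j * s)) \<le>
        3 * ((p j)\<^sup>2 * 4 powr (2 * real j * s) + C * \<rho> ^ j + E\<^sup>2 * (1 / 4) ^ j)"
      unfolding eventually_sequentially by blast
  qed
  \<comment> \<open>For nonnegative terms convergence is unconditional. The index 0, on which the
    grid conditions say nothing, is removed afterwards by restriction.\<close>
  then have "(\<lambda>j. (cmod (pairing f (?w j)))\<^sup>2 * 4 powr (2 * real j * s)) summable_on UNIV"
    by (subst summable_on_UNIV_nonneg_real_iff) auto
  then show ?thesis by (rule summable_on_subset_banach) simp
qed

end
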